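(* Let $\tilde{A}$ be a semi-free DG ring, and let $B$ be any DG ring. Then the simplicial set $\operatorname{SHom}(\tilde{A}, B) = \{ \operatorname{Hom}_{\mathsf{DGRng}}(\tilde{A}, \operatorname{Cyl}_q(B)) \}_{q \in \mathbb{N}}$ is a Kan complex.
   Context: A DG ring is a graded ring $A = \bigoplus_{i \in \mathbb{Z}} A^i$ (associative, unital) with a differential $\mathrm{d}$ of degree $1$ satisfying $\mathrm{d} \circ \mathrm{d} = 0$ and $\mathrm{d}(a b) = \mathrm{d}(a) b + (-1)^i a\, \mathrm{d}(b)$ for $a \in A^i$. DG ring homomorphisms are unital, degree $0$, and commute with differentials; $\mathsf{DGRng}$ is the category of DG rings. Semi-free: a filtered graded set $(X,F)$ is a graded set $X = \coprod_{i \in \mathbb{Z}} X^i$ with an ascending filtration $\{F_j(X)\}_{j \geq -1}$ by graded subsets, such that $F_{-1}(X) = \varnothing$ and $X = \bigcup_j F_j(X)$. Let $\mathbb{Z}\langle X \rangle$ be the noncommutative graded polynomial ring on $X$, filtered by $F_j(\mathbb{Z}\langle X\rangle) := \mathbb{Z}\langle F_j(X)\rangle$ for $j \geq 0$ and $F_{-1}(\mathbb{Z}\langle X \rangle) := 0$. A DG ring $\tilde{A}$ is (noncommutative) semi-free if there are a filtered graded set $(X,F)$ and an isomorphism of graded rings $\tilde{A} \cong \mathbb{Z}\langle X\rangle$ (forgetting differentials) under which $\mathrm{d}(F_j(X)) \subseteq F_{j-1}(\mathbb{Z}\langle X\rangle)$ for all $j \geq 0$. The DG rings $\operatorname{N}(X,B)$: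 for a simplicial set $X$, with face maps $\partial_i$, let $\operatorname{N}^p(X,\mathbb{Z})$ be the group of functions $\phi : X_p \to \mathbb{Z}$ vanishing on degenerate simplices, and $\operatorname{N}(X,\mathbb{Z}) := \bigoplus_{p \geq 0} \operatorname{N}^p(X,\mathbb{Z})$. It is a DG ring with differential $(\mathrm{d}\phi)(x) = \sum_{i=0}^{p+1} (-1)^i \phi(\partial_i x)$ for $\phi\in \operatorname{N}^p$, and Alexander-Whitney multiplication $(\phi * \psi)(x) = \phi(\partial_{>p}(x)) \cdot \psi(\partial_{<p}(x))$ for $\phi \in \operatorname{N}^p$, $\psi \in \operatorname{N}^q$, $x \in X_{p+q}$, where $\partial_{>p}(x) \in X_p$ is the front face of $x$ (induced by $[p] \to [p+q]$, $i \mapsto i$) and $\partial_{<p}(x) \in X_q$ is the back face (induced by $[q] \to [p+q]$, $i \mapsto p+i$). For a DG ring $B$ set $\operatorname{N}(X,B) := \operatorname{N}(X,\mathbb{Z}) \otimes_{\mathbb{Z}} B$, the tensor product of DG rings with the usual Koszul signs. This is contravariantly functorial in $X$ and covariantly functorial in $B$. Cylinders: $\operatorname{Cyl}_q(B) := \operatorname{N}(\Delta^q, B)$, where $\Delta^q$ is the standard $q$-simplex. The cosimplicial structure of $\{\Delta^q\}_{q}$ makes $\operatorname{Cyl}(B) = \{\operatorname{Cyl}_q(B)\}_{q \in \mathbb{N}}$ a simplicial DG ring, and $\operatorname{SHom}(\tilde{A},B)$ gets its simplicial structure from it. *)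

theory Defs
  imports "HOL-Algebra.Free_Abelian_Groups" "HOL-Algebra.Generated_Groups" "HOL-Algebra.QuotRing"
begin

section \<open>Graded rings and DG rings\<close>

record 'a graded_ring = "'a ring" +
  grd :: "int \<Rightarrow> 'a set"

record 'a dg_ring = "'a graded_ring" +
  differential :: "'a \<Rightarrow> 'a"

definition homog_decomp ::
    "('a, 'm) graded_ring_scheme \<Rightarrow> 'a \<Rightarrow> (int \<Rightarrow> 'a) \<Rightarrow> bool" where
  "homog_decomp A a c \<longleftrightarrow>
     (\<forall>i. c i \<in> grd A i) \<and> finite {i. c i \<noteq> \<zero>\<^bsub>A\<^esub>} \<and>
     a = finsum A c {i. c i \<noteq> \<zero>\<^bsub>A\<^esub>}"

locale graded_ring = ring A for A :: "('a, 'm) graded_ring_scheme" (structure) +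
  assumes grd_subgroup: "subgroup (grd A i) (add_monoid A)"
    and direct_sum: "a \<in> carrier A \<Longrightarrow> \<exists>!c. homog_decomp A a c"
    and one_grd: "\<one> \<in> grd A 0"
    and mult_grd: "\<lbrakk>a \<in> grd A i; b \<in> grd A j\<rbrakk> \<Longrightarrow> a \<otimes> b \<in> grd A (i + j)"

text \<open>The sign $(-1)^i$.\<close>

definition ksign :: "int \<Rightarrow> int" where
  "ksign i = (if even i then 1 else -1)"

locale dg_ring = graded_ring A for A :: "('a, 'm) dg_ring_scheme" (structure) +
  assumes diff_closed: "a \<in> carrier A \<Longrightarrow> differential A a \<in> carrier A"
    and diff_add: "\<lbrakk>a \<in> carrier A; b \<in> carrier A\<rbrakk> \<Longrightarrow>
      differential A (a \<oplus> b) = differential A a \<oplus> differential A b"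
    and diff_grd: "a \<in> grd A i \<Longrightarrow> differential A a \<in> grd A (i + 1)"
    and diff_diff: "a \<in> carrier A \<Longrightarrow> differential A (differential A a) = \<zero>"
    and leibniz: "\<lbrakk>a \<in> grd A i; b \<in> carrier A\<rbrakk> \<Longrightarrow>
      differential A (a \<otimes> b) =
        (differential A a \<otimes> b) \<oplus> ([ksign i] \<cdot> (a \<otimes> differential A b))"

text \<open>Homomorphisms are restricted to the carrier, so that equality of functions is
  equality of morphisms. The source and target are not required here to be DG rings.\<close>

definition dg_hom ::
    "('a, 'm) dg_ring_scheme \<Rightarrow> ('b, 'n) dg_ring_scheme \<Rightarrow> ('a \<Rightarrow> 'b) set" where
  "dg_hom A B = {f \<in> ring_hom A B. f \<in> extensional (carrier A) \<and>
     (\<forall>i. f ` grd A i \<subseteq> grd B i) \<and>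
     (\<forall>a\<in>carrier A. f (differential A a) = differential B (f a))}"

definition graded_ring_iso ::
    "('a, 'm) graded_ring_scheme \<Rightarrow> ('b, 'n) graded_ring_scheme \<Rightarrow> ('a \<Rightarrow> 'b) set" where
  "graded_ring_iso A B = {f \<in> ring_iso A B. \<forall>i. f ` grd A i = grd B i}"


section \<open>Semi-free DG rings\<close>

text \<open>The noncommutative polynomial ring on a graded set: the free abelian group on the
  words in \<open>X\<close>, multiplied by concatenation. A graded set is a set together with a degree
  function, of which only the values on \<open>X\<close> matter.\<close>

definition free_graded_ring :: "'x set \<Rightarrow> ('x \<Rightarrow> int) \<Rightarrow> ('x list \<Rightarrow>\<^sub>0 int) graded_ring" where
  "free_graded_ring X deg =
    \<lparr>carrier = carrier (free_Abelian_group (lists X)),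
     monoid.mult = (\<lambda>u v. frag_extend (\<lambda>s. frag_extend (\<lambda>t. frag_of (s @ t)) v) u),
     one = frag_of [],
     zero = 0,
     add = (+),
     grd = (\<lambda>i. {u \<in> carrier (free_Abelian_group (lists X)).
                  \<forall>w \<in> Poly_Mapping.keys u. sum_list (map deg w) = i})\<rparr>"

definition filtration :: "'x set \<Rightarrow> (int \<Rightarrow> 'x set) \<Rightarrow> bool" where
  "filtration X F \<longleftrightarrow>
     F (-1) = {} \<and> (\<forall>i j. -1 \<le> i \<and> i \<le> j \<longrightarrow> F i \<subseteq> F j) \<and> X = (\<Union>j\<in>{-1..}. F j)"

definition free_filtration :: "(int \<Rightarrow> 'x set) \<Rightarrow> ('x \<Rightarrow> int) \<Rightarrow> int \<Rightarrow> ('x list \<Rightarrow>\<^sub>0 int) set" where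
  "free_filtration F deg j =
     (if 0 \<le> j then carrier (free_graded_ring (F j) deg) else {0})"

text \<open>The type \<open>'x\<close> from which the generators are taken is a parameter; a statement
  assuming \<open>semi_free TYPE('x) A\<close> for a type variable \<open>'x\<close> covers all of them.
  The isomorphism \<open>h\<close> goes from the free ring to \<open>A\<close>.\<close>

definition semi_free :: "'x itself \<Rightarrow> ('a, 'm) dg_ring_scheme \<Rightarrow> bool" where
  "semi_free (_ :: 'x itself) A \<longleftrightarrow>
     (\<exists>(X :: 'x set) deg F h.
        filtration X F \<and> h \<in> graded_ring_iso (free_graded_ring X deg) A \<and>
        (\<forall>j\<ge>0. \<forall>x\<in>F j. differential A (h (frag_of [x])) \<in> h ` free_filtration F deg (j - 1)))"


section \<open>Simplicial sets and Kan complexes\<close>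

text \<open>Monotone maps $[m] \to [n]$, where $[n] = \{0, \dots, n\}$.\<close>

definition mono_maps :: "nat \<Rightarrow> nat \<Rightarrow> (nat \<Rightarrow> nat) set" where
  "mono_maps m n = {\<theta> \<in> {..m} \<rightarrow>\<^sub>E {..n}. mono_on {..m} \<theta>}"

text \<open>For $\theta : [m] \to [n]$, \<open>act X m n \<theta>\<close> is the induced map $X_n \to X_m$.\<close>

record 's simp_set =
  simplices :: "nat \<Rightarrow> 's set"
  act :: "nat \<Rightarrow> nat \<Rightarrow> (nat \<Rightarrow> nat) \<Rightarrow> 's \<Rightarrow> 's"

locale simplicial_set =
  fixes X :: "('s, 'm) simp_set_scheme"
  assumes act_closed: "\<lbrakk>\<theta> \<in> mono_maps m n; x \<in> simplices X n\<rbrakk> \<Longrightarrow>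
      act X m n \<theta> x \<in> simplices X m"
    and act_id: "x \<in> simplices X n \<Longrightarrow> act X n n (\<lambda>i\<in>{..n}. i) x = x"
    and act_comp: "\<lbrakk>\<eta> \<in> mono_maps l m; \<theta> \<in> mono_maps m n; x \<in> simplices X n\<rbrakk> \<Longrightarrow>
      act X l n (compose {..l} \<theta> \<eta>) x = act X l m \<eta> (act X m n \<theta> x)"

definition simplicial_map ::
    "('s, 'm) simp_set_scheme \<Rightarrow> ('t, 'n) simp_set_scheme \<Rightarrow> (nat \<Rightarrow> 's \<Rightarrow> 't) \<Rightarrow> bool" where
  "simplicial_map X Y f \<longleftrightarrow>
     (\<forall>n. f n \<in> simplices X n \<rightarrow> simplices Y n) \<and>
     (\<forall>m n. \<forall>\<theta>\<in>mono_maps m n. \<forall>x\<in>simplices X n.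
        f m (act X m n \<theta> x) = act Y m n \<theta> (f n x))"

definition std_simplex :: "nat \<Rightarrow> (nat \<Rightarrow> nat) simp_set" where
  "std_simplex q =
    \<lparr>simplices = (\<lambda>n. mono_maps n q), act = (\<lambda>m n \<theta> x. compose {..m} x \<theta>)\<rparr>"

text \<open>The map $\Delta^m \to \Delta^n$ induced by $\theta : [m] \to [n]$.\<close>

definition std_simplex_map :: "(nat \<Rightarrow> nat) \<Rightarrow> nat \<Rightarrow> (nat \<Rightarrow> nat) \<Rightarrow> (nat \<Rightarrow> nat)" where
  "std_simplex_map \<theta> p x = compose {..p} \<theta> x"

text \<open>$\Lambda^n_k$: a simplex of $\Delta^n$ belongs to the horn iff it lies in the face
  opposite to some vertex other than \<open>k\<close>.\<close>

definition horn :: "nat \<Rightarrow> nat \<Rightarrow> (nat \<Rightarrow> nat) simp_set" where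
  "horn n k =
    \<lparr>simplices = (\<lambda>p. {x \<in> mono_maps p n. \<exists>i\<le>n. i \<noteq> k \<and> i \<notin> x ` {..p}}),
     act = act (std_simplex n)\<rparr>"

locale kan_complex = simplicial_set X for X :: "('s, 'm) simp_set_scheme" +
  assumes horn_filler: "\<lbrakk>1 \<le> n; k \<le> n; simplicial_map (horn n k) X f\<rbrakk> \<Longrightarrow>
    \<exists>g. simplicial_map (std_simplex n) X g \<and>
        (\<forall>p. \<forall>x\<in>simplices (horn n k) p. g p x = f p x)"


section \<open>Normalized cochains\<close>

definition coface :: "nat \<Rightarrow> nat \<Rightarrow> (nat \<Rightarrow> nat)" where
  "coface n i = (\<lambda>j\<in>{..n}. if j < i then j else Suc j)"

definition codegen :: "nat \<Rightarrow> nat \<Rightarrow> (nat \<Rightarrow> nat)" where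
  "codegen n i = (\<lambda>j\<in>{..Suc n}. if j \<le> i then j else j - 1)"

definition face :: "('s, 'm) simp_set_scheme \<Rightarrow> nat \<Rightarrow> nat \<Rightarrow> 's \<Rightarrow> 's" where
  "face X n i = act X n (Suc n) (coface n i)"

definition degenerate :: "('s, 'm) simp_set_scheme \<Rightarrow> nat \<Rightarrow> 's set" where
  "degenerate X p =
     {act X (Suc n) n (codegen n i) y |n i y. p = Suc n \<and> i \<le> n \<and> y \<in> simplices X n}"

definition front_face :: "('s, 'm) simp_set_scheme \<Rightarrow> nat \<Rightarrow> nat \<Rightarrow> 's \<Rightarrow> 's" where
  "front_face X p q = act X p (p + q) (\<lambda>i\<in>{..p}. i)"

definition back_face :: "('s, 'm) simp_set_scheme \<Rightarrow> nat \<Rightarrow> nat \<Rightarrow> 's \<Rightarrow> 's" where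
  "back_face X p q = act X q (p + q) (\<lambda>i\<in>{..q}. p + i)"

text \<open>An element of $\bigoplus_p \mathrm{N}^p(X,\mathbb{Z})$ is a family \<open>\<phi>\<close> with
  \<open>\<phi> p\<close> in $\mathrm{N}^p(X,\mathbb{Z})$; a function on \<open>simplices X p\<close> is extended by zero to
  the whole type.\<close>

definition cochain_carrier :: "('s, 'm) simp_set_scheme \<Rightarrow> (nat \<Rightarrow> 's \<Rightarrow> int) set" where
  "cochain_carrier X =
     {\<phi>. (\<forall>p x. x \<notin> simplices X p \<or> x \<in> degenerate X p \<longrightarrow> \<phi> p x = 0) \<and>
         finite {p. \<exists>x. \<phi> p x \<noteq> 0}}"

definition cochains :: "('s, 'm) simp_set_scheme \<Rightarrow> (nat \<Rightarrow> 's \<Rightarrow> int) dg_ring" where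
  "cochains X =
    \<lparr>carrier = cochain_carrier X,
     monoid.mult = (\<lambda>\<phi> \<psi> n x. if x \<in> simplices X n
        then \<Sum>p\<le>n. \<phi> p (front_face X p (n - p) x) * \<psi> (n - p) (back_face X p (n - p) x)
        else 0),
     one = (\<lambda>n x. if n = 0 \<and> x \<in> simplices X 0 then 1 else 0),
     zero = (\<lambda>n x. 0),
     add = (\<lambda>\<phi> \<psi> n x. \<phi> n x + \<psi> n x),
     grd = (\<lambda>i. {\<phi> \<in> cochain_carrier X. \<forall>p x. int p \<noteq> i \<longrightarrow> \<phi> p x = 0}),
     differential = (\<lambda>\<phi> n x. case n of
        0 \<Rightarrow> 0
      | Suc p \<Rightarrow> if x \<in> simplices X (Suc p)
          then \<Sum>i\<le>Suc p. (-1) ^ i * \<phi> p (face X p i x) else 0)\<rparr>"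

text \<open>The pullback of cochains along a simplicial map \<open>f\<close> with source \<open>X\<close>.\<close>

definition cochain_map ::
    "('s, 'm) simp_set_scheme \<Rightarrow> (nat \<Rightarrow> 's \<Rightarrow> 't) \<Rightarrow> (nat \<Rightarrow> 't \<Rightarrow> int) \<Rightarrow> (nat \<Rightarrow> 's \<Rightarrow> int)" where
  "cochain_map X f \<phi> = (\<lambda>p x. if x \<in> simplices X p then \<phi> p (f p x) else 0)"


section \<open>Tensor products of DG rings\<close>

definition hcomp :: "('a, 'm) graded_ring_scheme \<Rightarrow> 'a \<Rightarrow> int \<Rightarrow> 'a" where
  "hcomp A a = (THE c. homog_decomp A a c)"

definition hsupp :: "('a, 'm) graded_ring_scheme \<Rightarrow> 'a \<Rightarrow> int set" where
  "hsupp A a = {i. hcomp A a i \<noteq> \<zero>\<^bsub>A\<^esub>}"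

text \<open>The tensor product over $\mathbb{Z}$ is the free abelian group on pairs modulo the
  subgroup generated by the biadditivity relations; its elements are cosets.\<close>

definition tensor_free ::
    "('a, 'm) ring_scheme \<Rightarrow> ('b, 'n) ring_scheme \<Rightarrow> (('a \<times> 'b) \<Rightarrow>\<^sub>0 int) monoid" where
  "tensor_free A B = free_Abelian_group (carrier A \<times> carrier B)"

definition tensor_rel ::
    "('a, 'm) ring_scheme \<Rightarrow> ('b, 'n) ring_scheme \<Rightarrow> (('a \<times> 'b) \<Rightarrow>\<^sub>0 int) set" where
  "tensor_rel A B = generate (tensor_free A B)
     ({frag_of (a \<oplus>\<^bsub>A\<^esub> a', b) - frag_of (a, b) - frag_of (a', b) |a a' b.
         a \<in> carrier A \<and> a' \<in> carrier A \<and> b \<in> carrier B} \<union>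
      {frag_of (a, b \<oplus>\<^bsub>B\<^esub> b') - frag_of (a, b) - frag_of (a, b') |a b b'.
         a \<in> carrier A \<and> b \<in> carrier B \<and> b' \<in> carrier B})"

definition tensor_class ::
    "('a, 'm) ring_scheme \<Rightarrow> ('b, 'n) ring_scheme \<Rightarrow>
     (('a \<times> 'b) \<Rightarrow>\<^sub>0 int) \<Rightarrow> (('a \<times> 'b) \<Rightarrow>\<^sub>0 int) set" where
  "tensor_class A B u = tensor_rel A B #>\<^bsub>tensor_free A B\<^esub> u"

text \<open>On representatives, the product is the biadditive extension of
  $(a \otimes b)(a' \otimes b') = (-1)^{ij}\, a a' \otimes b b'$ for \<open>a'\<close> of degree \<open>i\<close> and
  \<open>b\<close> of degree \<open>j\<close>, and the differential is the additive extension of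
  $a \otimes b \mapsto \mathrm{d}a \otimes b + (-1)^i a \otimes \mathrm{d}b$ for \<open>a\<close> of
  degree \<open>i\<close>; inhomogeneous elements are first split into their components.\<close>

definition tensor_mult_rep ::
    "('a, 'm) graded_ring_scheme \<Rightarrow> ('b, 'n) graded_ring_scheme \<Rightarrow>
     (('a \<times> 'b) \<Rightarrow>\<^sub>0 int) \<Rightarrow> (('a \<times> 'b) \<Rightarrow>\<^sub>0 int) \<Rightarrow> (('a \<times> 'b) \<Rightarrow>\<^sub>0 int)" where
  "tensor_mult_rep A B u v =
     frag_extend (\<lambda>(a, b). frag_extend (\<lambda>(a', b').
       \<Sum>i\<in>hsupp A a'. \<Sum>j\<in>hsupp B b.
         frag_cmul (ksign (i * j)) (frag_of (a \<otimes>\<^bsub>A\<^esub> hcomp A a' i, hcomp B b j \<otimes>\<^bsub>B\<^esub> b'))) v) u"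

definition tensor_diff_rep ::
    "('a, 'm) dg_ring_scheme \<Rightarrow> ('b, 'n) dg_ring_scheme \<Rightarrow>
     (('a \<times> 'b) \<Rightarrow>\<^sub>0 int) \<Rightarrow> (('a \<times> 'b) \<Rightarrow>\<^sub>0 int)" where
  "tensor_diff_rep A B =
     frag_extend (\<lambda>(a, b). frag_of (differential A a, b) +
       (\<Sum>i\<in>hsupp A a. frag_cmul (ksign i) (frag_of (hcomp A a i, differential B b))))"

definition tensor ::
    "('a, 'm) dg_ring_scheme \<Rightarrow> ('b, 'n) dg_ring_scheme \<Rightarrow> (('a \<times> 'b) \<Rightarrow>\<^sub>0 int) set dg_ring" where
  "tensor A B = (let Q = tensor_free A B Mod tensor_rel A B in
    \<lparr>carrier = carrier Q,
     monoid.mult = (\<lambda>U V. \<Union>u\<in>U. \<Union>v\<in>V. tensor_class A B (tensor_mult_rep A B u v)),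
     one = tensor_class A B (frag_of (\<one>\<^bsub>A\<^esub>, \<one>\<^bsub>B\<^esub>)),
     zero = monoid.one Q,
     add = monoid.mult Q,
     grd = (\<lambda>n. generate Q {tensor_class A B (frag_of (a, b)) |a b.
                   \<exists>i j. i + j = n \<and> a \<in> grd A i \<and> b \<in> grd B j}),
     differential = (\<lambda>U. \<Union>u\<in>U. tensor_class A B (tensor_diff_rep A B u))\<rparr>)"

text \<open>The map $f \otimes g$ into the tensor product of \<open>A'\<close> and \<open>B'\<close>.\<close>

definition tensor_map ::
    "('c, 'm) ring_scheme \<Rightarrow> ('d, 'n) ring_scheme \<Rightarrow> ('a \<Rightarrow> 'c) \<Rightarrow> ('b \<Rightarrow> 'd) \<Rightarrow>
     (('a \<times> 'b) \<Rightarrow>\<^sub>0 int) set \<Rightarrow> (('c \<times> 'd) \<Rightarrow>\<^sub>0 int) set" where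
  "tensor_map A' B' f g U =
     (\<Union>u\<in>U. tensor_class A' B' (frag_extend (\<lambda>(a, b). frag_of (f a, g b)) u))"


section \<open>Cylinders and the simplicial set of homomorphisms\<close>

definition N_ring ::
    "('s, 'm) simp_set_scheme \<Rightarrow> ('b, 'n) dg_ring_scheme \<Rightarrow>
     (((nat \<Rightarrow> 's \<Rightarrow> int) \<times> 'b) \<Rightarrow>\<^sub>0 int) set dg_ring" where
  "N_ring X B = tensor (cochains X) B"

text \<open>The map \<open>N_ring Y B \<rightarrow> N_ring X B\<close> induced by a simplicial map
  \<open>f\<close> from \<open>X\<close> to \<open>Y\<close>.\<close>

definition N_map ::
    "('s, 'm) simp_set_scheme \<Rightarrow> (nat \<Rightarrow> 's \<Rightarrow> 't) \<Rightarrow> ('b, 'n) dg_ring_scheme \<Rightarrow>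
     (((nat \<Rightarrow> 't \<Rightarrow> int) \<times> 'b) \<Rightarrow>\<^sub>0 int) set \<Rightarrow> (((nat \<Rightarrow> 's \<Rightarrow> int) \<times> 'b) \<Rightarrow>\<^sub>0 int) set" where
  "N_map X f B = tensor_map (cochains X) B (cochain_map X f) (\<lambda>b. b)"

type_synonym 'b cyl = "(((nat \<Rightarrow> (nat \<Rightarrow> nat) \<Rightarrow> int) \<times> 'b) \<Rightarrow>\<^sub>0 int) set"

definition Cyl :: "nat \<Rightarrow> ('b, 'n) dg_ring_scheme \<Rightarrow> 'b cyl dg_ring" where
  "Cyl q B = N_ring (std_simplex q) B"

text \<open>The simplicial structure: $\theta : [m] \to [n]$ induces
  $\mathrm{Cyl}_n(B) \to \mathrm{Cyl}_m(B)$.\<close>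

definition Cyl_act ::
    "nat \<Rightarrow> (nat \<Rightarrow> nat) \<Rightarrow> ('b, 'n) dg_ring_scheme \<Rightarrow> 'b cyl \<Rightarrow> 'b cyl" where
  "Cyl_act m \<theta> B = N_map (std_simplex m) (std_simplex_map \<theta>) B"

definition SHom ::
    "('a, 'm) dg_ring_scheme \<Rightarrow> ('b, 'n) dg_ring_scheme \<Rightarrow> ('a \<Rightarrow> 'b cyl) simp_set" where
  "SHom A B =
    \<lparr>simplices = (\<lambda>q. dg_hom A (Cyl q B)),
     act = (\<lambda>m n \<theta> f. compose (carrier A) (Cyl_act m \<theta> B) f)\<rparr>"

end

theory Submission
  imports Defs "HOL-Library.Sublist"
begin

text \<open>The ring \<open>N(\<Delta>\<^sup>q, B)\<close> is identified with the functions on the nondegenerate simplices of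
  \<open>\<Delta>\<^sup>q\<close>, written as strictly increasing words in \<open>0, \<dots>, q\<close>, with values in \<open>B\<close>. A map from a horn
  to \<open>SHom(A, B)\<close> is a compatible family of homomorphisms from \<open>A\<close> to the cochains of the simplices of
  the horn. Since restriction from the cochains of \<open>\<Delta>\<^sup>n\<close> to those of the horn is surjective with acyclic
  kernel, such a family lifts to \<open>A \<rightarrow> N(\<Delta>\<^sup>n, B)\<close>, one filtration step of the free generators of \<open>A\<close> at
  a time: the prescribed boundary of a new generator is already a cocycle lifting the given data. The
  kernel is concentrated on the top simplex and the omitted face, so a single value has to be chosen.\<close>

section \<open>Linear extension from free abelian groups\<close>

text \<open>The definition of \<open>tensor\<close> is a quotient whose operations are unions over
  representatives, so at the outset no law is available for \<open>Cyl\<close>, not even those of a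
  ring. Since \<open>\<Delta>\<^sup>q\<close> has finitely many nondegenerate simplices, its
  normalized cochains are free of finite rank and a tensor amounts to a finite family of elements of
  \<open>B\<close>. The DG ring identities are proved for such families, and the Kan property is
  carried back along a bijection at the very end.

  Words are handled letter by letter. Fixing the first letter of a cochain leaves a function on the
  remaining words that may be nonzero at the empty word. The algebra is therefore developed for
  arbitrary functions on words, the coboundary treating the empty word as a simplex of dimension -1;
  normalization is imposed afterwards.

  The ring of cochains on the horn is never formed. The lifting theorem takes instead a family of
  maps, one for every simplex of the horn, degenerate ones included, together with an extension
  hypothesis about single elements. Acyclicity enters only through that hypothesis, as one unknown
  value fixed by one equation.\<close>

context abelian_group
begin

lemma zmul_closed [simp, intro]: "x \<in> carrier G \<Longrightarrow> [(k::int)] \<cdot> x \<in> carrier G"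
  by (simp add: add_pow_def group.int_pow_closed[OF a_group, simplified])

lemma zmul_add_left: "x \<in> carrier G \<Longrightarrow> [(i + j::int)] \<cdot> x = [i] \<cdot> x \<oplus> [j] \<cdot> x"
  by (simp add: add_pow_def group.int_pow_mult[OF a_group, simplified])

lemma zmul_add_right:
  "\<lbrakk>x \<in> carrier G; y \<in> carrier G\<rbrakk> \<Longrightarrow> [(i::int)] \<cdot> (x \<oplus> y) = [i] \<cdot> x \<oplus> [i] \<cdot> y"
  by (simp add: add_pow_def comm_group.int_pow_distrib[OF a_comm_group, simplified])

lemma zmul_zero_left [simp]: "[(0::int)] \<cdot> x = \<zero>"
  by (simp add: add_pow_def)

lemma zmul_zero_right [simp]: "[(i::int)] \<cdot> \<zero> = \<zero>"
  using group.int_pow_one[OF a_group] by (simp add: add_pow_def)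

lemma zmul_one [simp]: "x \<in> carrier G \<Longrightarrow> [(1::int)] \<cdot> x = x"
  by (simp add: add_pow_def group.int_pow_1[OF a_group, simplified])

lemma zmul_minus_left [simp]: "x \<in> carrier G \<Longrightarrow> [(- i::int)] \<cdot> x = \<ominus> ([i] \<cdot> x)"
  using group.int_pow_neg[OF a_group, of x i] by (simp add: add_pow_def a_inv_def)

lemma zmul_minus_right [simp]: "x \<in> carrier G \<Longrightarrow> [(i::int)] \<cdot> (\<ominus> x) = \<ominus> ([i] \<cdot> x)"
  using group.int_pow_inv[OF a_group, of x i] by (simp add: add_pow_def a_inv_def)

lemma zmul_zmul: "x \<in> carrier G \<Longrightarrow> [(i::int)] \<cdot> ([(j::int)] \<cdot> x) = [(i * j)] \<cdot> x"
  using group.int_pow_pow[OF a_group, of x j i] by (simp add: add_pow_def mult.commute)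

lemma zmul_finsum_right:
  "finite I \<Longrightarrow> g \<in> I \<rightarrow> carrier G \<Longrightarrow> [(k::int)] \<cdot> (\<Oplus>i\<in>I. g i) = (\<Oplus>i\<in>I. [k] \<cdot> g i)"
  by (induction I rule: finite_induct) (auto simp: zmul_add_right Pi_iff)

lemma minus_eq_iff:
  "\<lbrakk>x \<in> carrier G; y \<in> carrier G; z \<in> carrier G\<rbrakk> \<Longrightarrow> x \<ominus> y = z \<longleftrightarrow> x = z \<oplus> y"
  by (metis a_minus_def a_inv_closed add.inv_solve_right')

lemma a_inv_image_grd: "subgroup H (add_monoid G) \<Longrightarrow> x \<in> H \<Longrightarrow> \<ominus> x \<in> H"
  using subgroup.m_inv_closed by (fastforce simp: a_inv_def)

lemma zmul_mem:
  assumes "subgroup H (add_monoid G)" "x \<in> H"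
  shows "[(k::int)] \<cdot> x \<in> H"
  using group.subgroup_int_pow_closed[OF a_group assms] by (simp add: add_pow_def)

end

text \<open>A choice of the homomorphism provided by the universal property of the free abelian
  group. It is pinned down only on combinations supported in \<open>S\<close>, hence the support
  conditions below.\<close>

definition lin :: "('a, 'm) ring_scheme \<Rightarrow> 'c set \<Rightarrow> ('c \<Rightarrow> 'a) \<Rightarrow> ('c \<Rightarrow>\<^sub>0 int) \<Rightarrow> 'a" where
  "lin G S f = (SOME h. h \<in> hom (free_Abelian_group S) (add_monoid G) \<and>
                        (\<forall>x\<in>S. h (frag_of x) = f x))"

context abelian_group
begin

context
  fixes S :: "'c set" and f :: "'c \<Rightarrow> 'a"
  assumes f: "\<And>x. x \<in> S \<Longrightarrow> f x \<in> carrier G"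
begin

lemma lin_spec: "lin G S f \<in> hom (free_Abelian_group S) (add_monoid G) \<and>
    (\<forall>x\<in>S. lin G S f (frag_of x) = f x)"
proof -
  have "f ` S \<subseteq> carrier (add_monoid G)"
    using f by auto
  from comm_group.free_Abelian_group_universal[OF a_comm_group this]
  have "\<exists>h. h \<in> hom (free_Abelian_group S) (add_monoid G) \<and> (\<forall>x\<in>S. h (frag_of x) = f x)"
    by metis
  then show ?thesis
    unfolding lin_def by (rule someI_ex)
qed

lemma lin_of [simp]: "x \<in> S \<Longrightarrow> lin G S f (frag_of x) = f x"
  using lin_spec by blast

lemma lin_closed: "Poly_Mapping.keys u \<subseteq> S \<Longrightarrow> lin G S f u \<in> carrier G"
  using hom_in_carrier[OF conjunct1[OF lin_spec], of u] by simp

lemma lin_add: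
  "\<lbrakk>Poly_Mapping.keys u \<subseteq> S; Poly_Mapping.keys v \<subseteq> S\<rbrakk> \<Longrightarrow>
    lin G S f (u + v) = lin G S f u \<oplus> lin G S f v"
  using hom_mult[OF conjunct1[OF lin_spec], of u v] by simp

lemma lin_zero [simp]: "lin G S f 0 = \<zero>"
  using hom_one[OF conjunct1[OF lin_spec] group_free_Abelian_group a_group] by simp

lemma lin_cmul:
  "Poly_Mapping.keys u \<subseteq> S \<Longrightarrow> lin G S f (frag_cmul k u) = [k] \<cdot> lin G S f u"
  using hom_int_pow[OF conjunct1[OF lin_spec] _ group_free_Abelian_group a_group, of u k]
  by (simp add: add_pow_def)

lemma lin_diff:
  assumes "Poly_Mapping.keys u \<subseteq> S" "Poly_Mapping.keys v \<subseteq> S"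
  shows "lin G S f (u - v) = lin G S f u \<ominus> lin G S f v"
proof -
  have "lin G S f (u + frag_cmul (-1) v) = lin G S f u \<oplus> [(-1::int)] \<cdot> lin G S f v"
    using lin_add[of u "frag_cmul (-1) v"] assms by (simp only: lin_cmul) (simp add: lin_cmul)
  then show ?thesis
    using lin_closed[OF assms(2)] by (simp add: a_minus_def)
qed

end

end

section \<open>The degree twist of a graded ring\<close>

lemma ksign_add: "ksign (i + j) = ksign i * ksign j"
  by (auto simp: ksign_def)

lemma ksign_0 [simp]: "ksign 0 = 1" and ksign_minus [simp]: "ksign (- i) = ksign i"
  by (auto simp: ksign_def)

lemma ksign_even [simp]: "even i \<Longrightarrow> ksign i = 1" and ksign_odd [simp]: "odd i \<Longrightarrow> ksign i = -1"
  by (auto simp: ksign_def)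

lemma ksign_square [simp]: "ksign i * ksign i = 1"
  by (auto simp: ksign_def)

text \<open>The Koszul sign for moving something of degree \<open>n\<close> past \<open>a\<close>,
  applied to each component separately. As an additive and multiplicative map it allows sign rules
  to be stated for inhomogeneous elements.\<close>

definition twist :: "('a, 'm) graded_ring_scheme \<Rightarrow> int \<Rightarrow> 'a \<Rightarrow> 'a" where
  "twist A n a = finsum A (\<lambda>i. [ksign (n * i)] \<cdot>\<^bsub>A\<^esub> hcomp A a i) (hsupp A a)"

context graded_ring
begin

lemma grd_closed: "a \<in> grd A i \<Longrightarrow> a \<in> carrier A"
  using subgroup.subset[OF grd_subgroup] by auto

lemma zero_grd [simp]: "\<zero> \<in> grd A i"
  using subgroup.one_closed[OF grd_subgroup] by simp

lemma add_grd: "\<lbrakk>a \<in> grd A i; b \<in> grd A i\<rbrakk> \<Longrightarrow> a \<oplus> b \<in> grd A i"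
  using subgroup.m_closed[OF grd_subgroup] by simp

lemma minus_grd: "a \<in> grd A i \<Longrightarrow> \<ominus> a \<in> grd A i"
  using a_inv_image_grd[OF grd_subgroup] .

lemma diff_mem_grd: "\<lbrakk>a \<in> grd A i; b \<in> grd A i\<rbrakk> \<Longrightarrow> a \<ominus> b \<in> grd A i"
  by (simp add: a_minus_def add_grd minus_grd)

lemma zmul_grd: "a \<in> grd A i \<Longrightarrow> [(k::int)] \<cdot> a \<in> grd A i"
  using zmul_mem[OF grd_subgroup] .

lemma homog_decomp_hcomp: "a \<in> carrier A \<Longrightarrow> homog_decomp A a (hcomp A a)"
  unfolding hcomp_def by (rule theI'[OF direct_sum])

lemma homog_decomp_closed:
  assumes "homog_decomp A a c"
  shows "a \<in> carrier A"
proof -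
  have "c i \<in> carrier A" for i
    using assms grd_closed unfolding homog_decomp_def by blast
  moreover have "a = finsum A c {i. c i \<noteq> \<zero>}"
    using assms unfolding homog_decomp_def by blast
  ultimately show ?thesis by (simp add: Pi_iff)
qed

lemma hcomp_eqI: "homog_decomp A a c \<Longrightarrow> hcomp A a = c"
  using direct_sum[of a] homog_decomp_hcomp[of a] homog_decomp_closed by blast

lemma hcomp_grd: "a \<in> carrier A \<Longrightarrow> hcomp A a i \<in> grd A i"
  using homog_decomp_hcomp unfolding homog_decomp_def by blast

lemma hcomp_closed: "a \<in> carrier A \<Longrightarrow> hcomp A a i \<in> carrier A"
  using hcomp_grd grd_closed by blast

lemma finite_hsupp: "a \<in> carrier A \<Longrightarrow> finite (hsupp A a)"
  using homog_decomp_hcomp unfolding homog_decomp_def hsupp_def by blast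

lemma finsum_hcomp: "a \<in> carrier A \<Longrightarrow> finsum A (hcomp A a) (hsupp A a) = a"
  using homog_decomp_hcomp unfolding homog_decomp_def hsupp_def by simp

lemma homog_decompI:
  assumes "finite I" "\<And>i. c i \<in> grd A i" "\<And>i. i \<notin> I \<Longrightarrow> c i = \<zero>" "a = finsum A c I"
  shows "homog_decomp A a c"
proof -
  have sub: "{i. c i \<noteq> \<zero>} \<subseteq> I" using assms(3) by blast
  have "finsum A c {i. c i \<noteq> \<zero>} = finsum A c I"
    using assms(1) sub assms(2) grd_closed
    by (intro add.finprod_mono_neutral_cong_left) auto
  with assms sub show ?thesis
    unfolding homog_decomp_def by (auto intro: finite_subset)
qed

lemma hcomp_homog:
  assumes "a \<in> grd A i"
  shows "hcomp A a = (\<lambda>k. if k = i then a else \<zero>)"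
  by (rule hcomp_eqI, rule homog_decompI[of "{i}"]) (use assms grd_closed in auto)

lemma hcomp_add:
  assumes a: "a \<in> carrier A" and b: "b \<in> carrier A"
  shows "hcomp A (a \<oplus> b) = (\<lambda>i. hcomp A a i \<oplus> hcomp A b i)"
proof (rule hcomp_eqI, rule homog_decompI[of "hsupp A a \<union> hsupp A b"])
  let ?I = "hsupp A a \<union> hsupp A b"
  have "finsum A (hcomp A a) ?I = a" "finsum A (hcomp A b) ?I = b"
    using finsum_hcomp[OF a] finsum_hcomp[OF b] finite_hsupp a b hcomp_closed
    by (subst add.finprod_mono_neutral_cong_right[where B = ?I]; auto simp: hsupp_def)+
  then show "a \<oplus> b = (\<Oplus>i\<in>?I. hcomp A a i \<oplus> hcomp A b i)"
    using a b hcomp_closed by (simp add: finsum_addf Pi_iff)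
  show "finite ?I" using a b by (simp add: finite_hsupp)
qed (use a b in \<open>auto simp: hcomp_grd hsupp_def add_grd\<close>)

lemma homog_induct [consumes 1, case_names zero add homog]:
  assumes "a \<in> carrier A" "P \<zero>"
    and "\<And>x y. \<lbrakk>x \<in> carrier A; y \<in> carrier A; P x; P y\<rbrakk> \<Longrightarrow> P (x \<oplus> y)"
    and "\<And>i x. x \<in> grd A i \<Longrightarrow> P x"
  shows "P a"
proof -
  have "P (finsum A (hcomp A a) I)" if "finite I" for I
    using that
  proof (induction I rule: finite_induct)
    case (insert i I)
    then show ?case
      using assms(1,3) assms(4)[OF hcomp_grd[OF assms(1)]] hcomp_closed
      by (subst finsum_insert) auto
  qed (simp add: assms)
  from this[OF finite_hsupp[OF assms(1)]] show ?thesis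
    using finsum_hcomp[OF assms(1)] by simp
qed

lemma twist_closed [simp]: "a \<in> carrier A \<Longrightarrow> twist A n a \<in> carrier A"
  unfolding twist_def using hcomp_closed by (intro finsum_closed) auto

lemma twist_superset:
  assumes "a \<in> carrier A" "finite I" "hsupp A a \<subseteq> I"
  shows "twist A n a = (\<Oplus>i\<in>I. [ksign (n * i)] \<cdot> hcomp A a i)"
  unfolding twist_def using assms hcomp_closed
  by (intro add.finprod_mono_neutral_cong_left) (auto simp: hsupp_def)

lemma twist_add:
  assumes a: "a \<in> carrier A" and b: "b \<in> carrier A"
  shows "twist A n (a \<oplus> b) = twist A n a \<oplus> twist A n b"
proof -
  let ?I = "hsupp A a \<union> hsupp A b"
  have "hsupp A (a \<oplus> b) \<subseteq> ?I"
    using a b by (auto simp: hsupp_def hcomp_add)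
  then have "twist A n (a \<oplus> b) = (\<Oplus>i\<in>?I. [ksign (n * i)] \<cdot> hcomp A (a \<oplus> b) i)"
    using a b finite_hsupp by (intro twist_superset) auto
  also have "\<dots> = (\<Oplus>i\<in>?I. [ksign (n * i)] \<cdot> hcomp A a i \<oplus> [ksign (n * i)] \<cdot> hcomp A b i)"
    using a b hcomp_closed by (simp add: hcomp_add zmul_add_right)
  also have "\<dots> = (\<Oplus>i\<in>?I. [ksign (n * i)] \<cdot> hcomp A a i) \<oplus> (\<Oplus>i\<in>?I. [ksign (n * i)] \<cdot> hcomp A b i)"
    using a b hcomp_closed by (intro finsum_addf) auto
  also have "\<dots> = twist A n a \<oplus> twist A n b"
    using a b finite_hsupp by (simp add: twist_superset[where I = ?I])
  finally show ?thesis .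
qed

lemma twist_homog: "a \<in> grd A i \<Longrightarrow> twist A n a = [ksign (n * i)] \<cdot> a"
  using grd_closed by (subst twist_superset[of _ "{i}"]) (auto simp: hcomp_homog hsupp_def)

lemma twist_zero [simp]: "twist A n \<zero> = \<zero>"
  using twist_homog[OF zero_grd] by simp

lemma twist_minus: "a \<in> carrier A \<Longrightarrow> twist A n (\<ominus> a) = \<ominus> twist A n a"
  using twist_add[of "\<ominus> a" a n] by (simp add: l_neg minus_equality)

lemma twist_one [simp]: "twist A n \<one> = \<one>"
  using twist_homog[OF one_grd, of n] by simp

lemma twist_grd: "a \<in> grd A i \<Longrightarrow> twist A n a \<in> grd A i"
  by (simp add: twist_homog zmul_grd)

lemma twist_twist: "a \<in> carrier A \<Longrightarrow> twist A m (twist A n a) = twist A (m + n) a"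
proof (induction rule: homog_induct)
  case (homog i x)
  then show ?case
    using twist_homog[OF zmul_grd[OF homog]] grd_closed
    by (simp add: twist_homog zmul_zmul ring_distribs ksign_add)
qed (auto simp: twist_add)

lemma twist_even: "a \<in> carrier A \<Longrightarrow> even n \<Longrightarrow> twist A n a = a"
proof (induction rule: homog_induct)
  case (homog i x)
  then show ?case using grd_closed by (simp add: twist_homog)
qed (auto simp: twist_add)

lemma twist_mult:
  assumes "a \<in> carrier A" "b \<in> carrier A"
  shows "twist A n (a \<otimes> b) = twist A n a \<otimes> twist A n b"
  using assms
proof (induction rule: homog_induct)
  case (homog i x)
  then have x: "x \<in> carrier A" using grd_closed by blast
  from \<open>b \<in> carrier A\<close> show ?case
  proof (induction rule: homog_induct)
    case (homog j y)
    then have "y \<in> carrier A" using grd_closed by blast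
    with x show ?case
      using twist_homog[OF mult_grd[OF \<open>x \<in> grd A i\<close> homog], of n]
      by (simp add: twist_homog[OF homog] twist_homog[OF \<open>x \<in> grd A i\<close>]
          add_pow_ldistr_int add_pow_rdistr_int zmul_zmul ring_distribs ksign_add mult.commute)
  qed (use x in \<open>auto simp: r_distr twist_add\<close>)
qed (auto simp: twist_add l_distr)

end

text \<open>The axioms of a DG ring other than the decomposition into homogeneous components, which the
  target of a lifting problem need not have.\<close>

locale predg_ring = ring A for A :: "('a, 'm) dg_ring_scheme" (structure) +
  assumes grd_subgroup: "subgroup (grd A i) (add_monoid A)"
    and one_grd: "\<one> \<in> grd A 0"
    and mult_grd: "\<lbrakk>a \<in> grd A i; b \<in> grd A j\<rbrakk> \<Longrightarrow> a \<otimes> b \<in> grd A (i + j)"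
    and diff_closed: "a \<in> carrier A \<Longrightarrow> differential A a \<in> carrier A"
    and diff_add: "\<lbrakk>a \<in> carrier A; b \<in> carrier A\<rbrakk> \<Longrightarrow>
      differential A (a \<oplus> b) = differential A a \<oplus> differential A b"
    and diff_grd: "a \<in> grd A i \<Longrightarrow> differential A a \<in> grd A (i + 1)"
    and diff_diff: "a \<in> carrier A \<Longrightarrow> differential A (differential A a) = \<zero>"
    and leibniz: "\<lbrakk>a \<in> grd A i; b \<in> carrier A\<rbrakk> \<Longrightarrow>
      differential A (a \<otimes> b) =
        (differential A a \<otimes> b) \<oplus> ([ksign i] \<cdot> (a \<otimes> differential A b))"

context predg_ring
begin

lemma grd_closed: "a \<in> grd A i \<Longrightarrow> a \<in> carrier A"
  using subgroup.subset[OF grd_subgroup] by auto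

lemma zero_grd [simp]: "\<zero> \<in> grd A i"
  using subgroup.one_closed[OF grd_subgroup] by simp

lemma diff_mem_grd: "\<lbrakk>a \<in> grd A i; b \<in> grd A i\<rbrakk> \<Longrightarrow> a \<ominus> b \<in> grd A i"
  using subgroup.m_closed[OF grd_subgroup] a_inv_image_grd[OF grd_subgroup] by (simp add: a_minus_def)

lemma diff_zero [simp]: "differential A \<zero> = \<zero>"
proof -
  have "differential A \<zero> \<oplus> differential A \<zero> = differential A \<zero>"
    using diff_add[of \<zero> \<zero>] by simp
  then show ?thesis
    using diff_closed[of \<zero>] by (metis add.r_cancel_one' zero_closed)
qed

lemma diff_minus: "a \<in> carrier A \<Longrightarrow> differential A (\<ominus> a) = \<ominus> differential A a"
  using diff_add[of "\<ominus> a" a] diff_closed by (simp add: l_neg minus_equality)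

lemma diff_diff_distrib:
  "\<lbrakk>a \<in> carrier A; b \<in> carrier A\<rbrakk> \<Longrightarrow> differential A (a \<ominus> b) = differential A a \<ominus> differential A b"
  by (simp add: a_minus_def diff_add diff_minus)

lemma diff_one: "differential A \<one> = \<zero>"
proof -
  have "differential A \<one> \<oplus> differential A \<one> = differential A \<one>"
    using leibniz[OF one_grd one_closed] diff_closed[OF one_closed] by simp
  then show ?thesis
    using diff_closed[OF one_closed] by (metis add.r_cancel_one')
qed

end

sublocale dg_ring \<subseteq> pre: predg_ring A
  by (intro predg_ring.intro predg_ring_axioms.intro ring_axioms)
    (simp_all add: grd_subgroup one_grd mult_grd diff_add diff_grd diff_diff leibniz diff_closed)

context dg_ring
begin

lemmas diff_zero [simp] = pre.diff_zero and diff_minus = pre.diff_minus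

lemma diff_zmul: "a \<in> carrier A \<Longrightarrow> differential A ([(k::int)] \<cdot> a) = [k] \<cdot> differential A a"
proof -
  assume a: "a \<in> carrier A"
  have "differential A \<in> hom (add_monoid A) (add_monoid A)"
    by (auto simp: hom_def diff_closed diff_add)
  from hom_int_pow[OF this _ a_group a_group, of a k] a show ?thesis
    by (simp add: add_pow_def)
qed

text \<open>The differential raises the degree by one, and \<open>(-1)^(n * (i + 1))\<close> differs
  from \<open>(-1)^(n * i)\<close> by \<open>(-1)^n\<close>.\<close>

lemma diff_twist: "a \<in> carrier A \<Longrightarrow> differential A (twist A n a) = [ksign n] \<cdot> twist A n (differential A a)"
proof (induction rule: homog_induct)
  case (homog i x)
  then show ?case
    using twist_homog[OF diff_grd[OF homog], of n] grd_closed diff_closed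
    by (simp add: twist_homog diff_zmul zmul_zmul ring_distribs ksign_add)
      (simp add: mult.left_commute[of "ksign n"])
qed (auto simp: twist_add diff_add diff_closed zmul_add_right)

text \<open>Both sides are additive in \<open>a\<close>, and on a homogeneous element
  \<open>twist A 1\<close> is exactly the sign of the Leibniz rule. In this form no degree has to be
  known.\<close>

lemma leibniz_twist:
  assumes "a \<in> carrier A" "b \<in> carrier A"
  shows "differential A (a \<otimes> b) = differential A a \<otimes> b \<oplus> twist A 1 a \<otimes> differential A b"
  using assms
proof (induction rule: homog_induct)
  case (homog i x)
  then show ?case
    using leibniz[OF homog] grd_closed diff_closed
    by (simp add: twist_homog add_pow_ldistr_int)
next
  case (add x y)
  then show ?case
    by (simp add: l_distr diff_add twist_add diff_closed a_ac)
qed (auto simp: diff_closed)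

end

section \<open>Cochains on words\<close>

text \<open>\<open>cup B P Q\<close> sends a word with \<open>n + 1\<close> letters to the sum over \<open>p\<close> of the \<open>(n - p)\<close>-fold
  twist of \<open>P\<close> at the front \<open>p\<close>-face times \<open>Q\<close> at the back \<open>(n - p)\<close>-face; the twist is the Koszul sign.
  \<open>cobd B P\<close> is the alternating sum over the faces plus \<open>(-1)\<^sup>n\<close> times the differential of \<open>B\<close>. Both are
  unrolled along the first letter.\<close>

fun cup :: "('b, 'm) graded_ring_scheme \<Rightarrow> ('v list \<Rightarrow> 'b) \<Rightarrow> ('v list \<Rightarrow> 'b) \<Rightarrow> 'v list \<Rightarrow> 'b" where
  "cup B P Q [] = \<zero>\<^bsub>B\<^esub>"
| "cup B P Q (a # w) =
    twist B (int (length w)) (P [a]) \<otimes>\<^bsub>B\<^esub> Q (a # w) \<oplus>\<^bsub>B\<^esub> cup B (\<lambda>u. P (a # u)) Q w"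

fun cobd :: "('b, 'm) dg_ring_scheme \<Rightarrow> ('v list \<Rightarrow> 'b) \<Rightarrow> 'v list \<Rightarrow> 'b" where
  "cobd B P [] = \<ominus>\<^bsub>B\<^esub> differential B (P [])"
| "cobd B P (a # w) = P w \<ominus>\<^bsub>B\<^esub> cobd B (\<lambda>u. P (a # u)) w"

text \<open>Front faces are prefixes and back faces are suffixes. Since the words of a simplex are
  closed under both, a factor may be truncated to those words without changing the product
  there.\<close>

lemma cup_cong:
  assumes "\<And>u. prefix u w \<Longrightarrow> u \<noteq> [] \<Longrightarrow> P u = P' u"
    and "\<And>u. suffix u w \<Longrightarrow> u \<noteq> [] \<Longrightarrow> Q u = Q' u"
  shows "cup B P Q w = cup B P' Q' w"
  using assms
proof (induction w arbitrary: P P')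
  case (Cons a w)
  have "cup B (\<lambda>u. P (a # u)) Q w = cup B (\<lambda>u. P' (a # u)) Q' w"
    using Cons.prems by (intro Cons.IH) (auto simp: suffix_Cons)
  with Cons.prems show ?case by (simp add: suffix_Cons)
qed simp

lemma cobd_cong:
  assumes "\<And>u. subseq u w \<Longrightarrow> P u = P' u"
  shows "cobd B P w = cobd B P' w"
  using assms
proof (induction w arbitrary: P P')
  case (Cons a w)
  have "cobd B (\<lambda>u. P (a # u)) w = cobd B (\<lambda>u. P' (a # u)) w"
    using Cons.prems by (intro Cons.IH) auto
  with Cons.prems[of w] show ?case by (simp add: list_emb_Cons)
qed simp

lemma cup_map: "cup B (\<lambda>u. P (map \<theta> u)) (\<lambda>u. Q (map \<theta> u)) w = cup B P Q (map \<theta> w)"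
proof (induction w arbitrary: P)
  case (Cons a w)
  from Cons[of "\<lambda>u. P (\<theta> a # u)"] show ?case by simp
qed simp

lemma cobd_map: "cobd B (\<lambda>u. P (map \<theta> u)) w = cobd B P (map \<theta> w)"
proof (induction w arbitrary: P)
  case (Cons a w)
  from Cons[of "\<lambda>u. P (\<theta> a # u)"] show ?case by simp
qed simp

section \<open>Cup product and coboundary for arbitrary functions on words\<close>

context dg_ring
begin

lemmas [simp] = diff_closed

lemma twist_plus_two: "a \<in> carrier A \<Longrightarrow> twist A (2 + n) a = twist A n a"
  using twist_twist[of a n 2] by (simp add: twist_even add.commute)

lemma cup_closed [simp]:
  assumes "\<And>w. P w \<in> carrier A" "\<And>w. Q w \<in> carrier A"
  shows "cup A P Q w \<in> carrier A"
  using assms by (induction w arbitrary: P) auto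

lemma cobd_closed [simp]:
  assumes "\<And>w. P w \<in> carrier A"
  shows "cobd A P w \<in> carrier A"
  using assms by (induction w arbitrary: P) auto

lemma cup_zero_left [simp]: "(\<And>w. Q w \<in> carrier A) \<Longrightarrow> cup A (\<lambda>u. \<zero>) Q w = \<zero>"
  by (induction w) auto

lemma cup_zero_right [simp]: "(\<And>w. P w \<in> carrier A) \<Longrightarrow> cup A P (\<lambda>u. \<zero>) w = \<zero>"
  by (induction w arbitrary: P) auto

lemma cobd_zero [simp]: "cobd A (\<lambda>u. \<zero>) w = \<zero>"
  by (induction w) (auto simp: a_minus_def)

lemma cup_add_left:
  assumes "\<And>w. P w \<in> carrier A" "\<And>w. P' w \<in> carrier A" "\<And>w. Q w \<in> carrier A"
  shows "cup A (\<lambda>u. P u \<oplus> P' u) Q w = cup A P Q w \<oplus> cup A P' Q w"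
  using assms
proof (induction w arbitrary: P P')
  case (Cons a w)
  show ?case
    using Cons.IH[of "\<lambda>u. P (a # u)" "\<lambda>u. P' (a # u)"] Cons.prems
    by (simp add: twist_add l_distr a_ac)
qed simp

lemma cup_add_right:
  assumes "\<And>w. P w \<in> carrier A" "\<And>w. Q w \<in> carrier A" "\<And>w. Q' w \<in> carrier A"
  shows "cup A P (\<lambda>u. Q u \<oplus> Q' u) w = cup A P Q w \<oplus> cup A P Q' w"
  using assms
proof (induction w arbitrary: P)
  case (Cons a w)
  show ?case
    using Cons.IH[of "\<lambda>u. P (a # u)"] Cons.prems
    by (simp add: r_distr a_ac)
qed simp

lemma cup_minus_left:
  assumes "\<And>w. P w \<in> carrier A" "\<And>w. Q w \<in> carrier A"
  shows "cup A (\<lambda>u. \<ominus> P u) Q w = \<ominus> cup A P Q w"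
  using assms
proof (induction w arbitrary: P)
  case (Cons a w)
  show ?case
    using Cons.IH[of "\<lambda>u. P (a # u)"] Cons.prems
    by (simp add: twist_minus l_minus minus_add)
qed simp

lemma cobd_add:
  assumes "\<And>w. P w \<in> carrier A" "\<And>w. P' w \<in> carrier A"
  shows "cobd A (\<lambda>u. P u \<oplus> P' u) w = cobd A P w \<oplus> cobd A P' w"
  using assms
proof (induction w arbitrary: P P')
  case (Cons a w)
  show ?case
    using Cons.IH[of "\<lambda>u. P (a # u)" "\<lambda>u. P' (a # u)"] Cons.prems
    by (simp add: a_minus_def minus_add a_ac)
qed (simp add: diff_add minus_add)

lemma cobd_minus:
  assumes "\<And>w. P w \<in> carrier A"
  shows "cobd A (\<lambda>u. \<ominus> P u) w = \<ominus> cobd A P w"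
  using assms
proof (induction w arbitrary: P)
  case (Cons a w)
  show ?case
    using Cons.IH[of "\<lambda>u. P (a # u)"] Cons.prems
    by (simp add: a_minus_def minus_add)
qed (simp add: diff_minus)

lemma cobd_diff:
  assumes "\<And>w. P w \<in> carrier A" "\<And>w. P' w \<in> carrier A"
  shows "cobd A (\<lambda>u. P u \<ominus> P' u) w = cobd A P w \<ominus> cobd A P' w"
  unfolding a_minus_def using assms by (simp add: cobd_add cobd_minus)

text \<open>The recursion subtracts from \<open>cobd A P w\<close> the coboundary of
  \<open>cobd A P\<close> restricted to words beginning with \<open>a\<close>. That restriction is
  \<open>P\<close> minus the coboundary of the restricted \<open>P\<close>; the induction hypothesis
  kills the latter, and \<open>cobd A P w\<close> remains to cancel.\<close>

lemma cobd_cobd: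
  assumes "\<And>w. P w \<in> carrier A"
  shows "cobd A (cobd A P) w = \<zero>"
  using assms
proof (induction w arbitrary: P)
  case Nil
  then show ?case by (simp add: diff_minus diff_diff)
next
  case (Cons a w)
  have "cobd A (\<lambda>u. cobd A P (a # u)) w = cobd A P w"
    using Cons.IH[of "\<lambda>u. P (a # u)"] Cons.prems by (simp add: cobd_diff) (simp add: a_minus_def)
  with Cons.prems show ?case by (simp add: a_minus_def r_neg)
qed

text \<open>The term of a cup product that splits off the first letter has the shape
  \<open>c\<close>, twisted by the length of the rest, times a value. Such a term passes through a
  further cup product because the two twists add up to the full length. This is the inductive
  content of associativity.\<close>

lemma cup_twist_left:
  assumes "c \<in> carrier A" "\<And>w. P w \<in> carrier A" "\<And>w. Q w \<in> carrier A"
  shows "cup A (\<lambda>u. twist A (int (length u)) c \<otimes> P u) Q w = twist A (int (length w)) c \<otimes> cup A P Q w"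
  using assms
proof (induction w arbitrary: P c)
  case (Cons a w)
  \<comment> \<open>The fixed letter lengthens every remaining word by one, which is absorbed by
    replacing \<open>c\<close> with \<open>twist A 1 c\<close>.\<close>
  have *: "cup A (\<lambda>u. twist A (int (length (a # u))) c \<otimes> P (a # u)) Q w
      = twist A (int (length w)) (twist A 1 c) \<otimes> cup A (\<lambda>u. P (a # u)) Q w"
    using Cons.IH[of "twist A 1 c" "\<lambda>u. P (a # u)"] Cons.prems by (simp add: twist_twist add.commute)
  show ?case
    using Cons.prems * by (simp add: twist_mult twist_twist add.commute m_assoc r_distr)
qed simp

lemma cup_assoc:
  assumes "\<And>w. P w \<in> carrier A" "\<And>w. Q w \<in> carrier A" "\<And>w. R w \<in> carrier A"
  shows "cup A (cup A P Q) R w = cup A P (cup A Q R) w"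
  using assms
proof (induction w arbitrary: P)
  case (Cons a w)
  let ?t = "\<lambda>u. twist A (int (length u)) (P [a])"
  have "cup A (\<lambda>u. cup A P Q (a # u)) R w
      = cup A (\<lambda>u. ?t u \<otimes> Q (a # u)) R w \<oplus> cup A (cup A (\<lambda>u. P (a # u)) Q) R w"
    using Cons.prems by (simp add: cup_add_left)
  also have "\<dots> = ?t w \<otimes> cup A (\<lambda>u. Q (a # u)) R w \<oplus> cup A (\<lambda>u. P (a # u)) (cup A Q R) w"
    using Cons.prems Cons.IH[of "\<lambda>u. P (a # u)"] by (simp add: cup_twist_left)
  finally show ?case
    using Cons.prems by (simp add: twist_even twist_mult r_distr m_assoc a_assoc)
qed simp

text \<open>The exception at \<open>[]\<close> comes from \<open>cup\<close> being zero there. The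
  unit law thus holds exactly for functions vanishing at the empty word, as elements of
  \<open>word_cochains\<close> do.\<close>

lemma cup_one_left:
  assumes "\<And>w. Q w \<in> carrier A"
  shows "cup A (\<lambda>u. if length u = 1 then \<one> else \<zero>) Q w = (if w = [] then \<zero> else Q w)"
proof (cases w)
  case (Cons a v)
  have "cup A (\<lambda>u. if u = [] then \<one> else \<zero>) Q v = cup A (\<lambda>u. \<zero>) Q v"
    by (rule cup_cong) auto
  with Cons assms show ?thesis by simp
qed simp

lemma cup_one_right:
  assumes "\<And>w. P w \<in> carrier A"
  shows "cup A P (\<lambda>u. if length u = 1 then \<one> else \<zero>) w = (if w = [] then \<zero> else P w)"
  using assms
proof (induction w arbitrary: P)
  case (Cons a w)
  from Cons.IH[of "\<lambda>u. P (a # u)"] Cons.prems show ?case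
    by (cases w) (auto simp: twist_even)
qed simp

text \<open>The coboundary of the term of a cup product in which the first letter is split off. Each
  further letter turns \<open>c\<close> into \<open>twist A 1 c\<close>; the differential
  anticommutes with this twist, and two twists by one cancel.\<close>

lemma cobd_twist:
  assumes "c \<in> carrier A" "\<And>w. P w \<in> carrier A"
  shows "cobd A (\<lambda>u. twist A (int (length u)) c \<otimes> P u) w =
    twist A (int (length w) + 1) c \<otimes> cobd A P w \<ominus> twist A (int (length w)) (differential A c) \<otimes> P w"
  using assms
proof (induction w arbitrary: P c)
  case Nil
  then show ?case
    by (simp add: twist_even leibniz_twist r_minus a_minus_def minus_add a_comm)
next
  case (Cons a w)
  let ?n = "int (length w)"
  have "cobd A (\<lambda>u. twist A (int (length (a # u))) c \<otimes> P (a # u)) w =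
     twist A (?n + 1) (twist A 1 c) \<otimes> cobd A (\<lambda>u. P (a # u)) w \<ominus>
     twist A ?n (differential A (twist A 1 c)) \<otimes> P (a # w)"
    using Cons.IH[of "twist A 1 c" "\<lambda>u. P (a # u)"] Cons.prems by (simp add: twist_twist add.commute)
  moreover have "twist A (?n + 1) (twist A 1 c) = twist A ?n c"
    using Cons.prems twist_plus_two[of c ?n] by (simp add: twist_twist add.commute)
  moreover have "twist A ?n (differential A (twist A 1 c)) = \<ominus> twist A (?n + 1) (differential A c)"
    using Cons.prems by (simp add: diff_twist twist_minus twist_twist)
  moreover have "twist A (?n + 1 + 1) c = twist A ?n c"
    using Cons.prems twist_plus_two[of c ?n] by (simp add: add.commute)
  ultimately show ?case
    using Cons.prems
    by (simp add: a_minus_def r_distr r_minus l_minus minus_add a_assoc add.commute)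
qed

text \<open>The correction term accounts for the value of \<open>P\<close> at the empty word, which is nonzero
  for the restriction of a cochain to the words beginning with a given letter.\<close>

lemma cobd_cup:
  assumes "\<And>w. P w \<in> carrier A" "\<And>w. Q w \<in> carrier A" "Q [] = \<zero>"
  shows "cobd A (cup A P Q) w =
    cup A (cobd A P) Q w \<oplus>
    cup A (\<lambda>u. [ksign (int (length u) + 1)] \<cdot> twist A 1 (P u)) (cobd A Q) w \<ominus>
    twist A (int (length w) + 1) (P []) \<otimes> Q w"
  using assms
proof (induction w arbitrary: P)
  case Nil
  then show ?case by (simp add: a_minus_def)
next
  case (Cons a w)
  let ?n = "int (length w)" and ?c = "P [a]" and ?P = "\<lambda>u. P (a # u)"
  \<comment> \<open>If \<open>P\<close> has total degree \<open>i\<close>, then \<open>P u\<close>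
    has degree \<open>i + 1 - length u\<close> and the two signs combine to \<open>ksign i\<close>,
    the sign of the Leibniz rule. Written with the word length it makes sense for inhomogeneous
    \<open>P\<close>.\<close>
  let ?S = "\<lambda>P u. [ksign (int (length u) + 1)] \<cdot> twist A 1 (P u)"
  note [simp] = Cons.prems
  define e where "e = twist A ?n (P []) \<otimes> Q (a # w)"
  define f where "f = twist A ?n (differential A ?c) \<otimes> Q (a # w)"
  define g where "g = twist A (?n + 1) ?c \<otimes> Q w"
  define h where "h = twist A (?n + 1) ?c \<otimes> cobd A (\<lambda>u. Q (a # u)) w"
  define p where "p = cup A P Q w"
  define q where "q = cup A (cobd A ?P) Q w"
  define r where "r = cup A (?S ?P) (cobd A Q) w"
  have cl: "e \<in> carrier A" "f \<in> carrier A" "g \<in> carrier A" "h \<in> carrier A"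
    "p \<in> carrier A" "q \<in> carrier A" "r \<in> carrier A"
    unfolding e_def f_def g_def h_def p_def q_def r_def by simp_all
  have "cobd A (cup A P Q) (a # w) = p \<ominus> cobd A (\<lambda>u. cup A P Q (a # u)) w"
    by (simp add: p_def)
  also have "cobd A (\<lambda>u. cup A P Q (a # u)) w =
      cobd A (\<lambda>u. twist A (int (length u)) ?c \<otimes> Q (a # u)) w \<oplus> cobd A (cup A ?P Q) w"
    by (simp add: cobd_add)
  also have "cobd A (\<lambda>u. twist A (int (length u)) ?c \<otimes> Q (a # u)) w = h \<ominus> f"
    by (simp add: cobd_twist h_def f_def)
  also have "cobd A (cup A ?P Q) w = q \<oplus> r \<ominus> g"
    using Cons.IH[of ?P] by (simp add: q_def r_def g_def)
  finally have lhs: "cobd A (cup A P Q) (a # w) = p \<ominus> (h \<ominus> f \<oplus> (q \<oplus> r \<ominus> g))" .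
  \<comment> \<open>On the one-letter word, \<open>cobd A P [a]\<close> is \<open>P []\<close> plus
    the differential of \<open>P [a]\<close>. The first part yields \<open>e\<close>, which the
    correction term of the claim removes again.\<close>
  have "cup A (cobd A P) Q (a # w) = e \<oplus> f \<oplus> cup A (\<lambda>u. cobd A P (a # u)) Q w"
    by (simp add: e_def f_def twist_add a_minus_def minus_minus l_distr)
  also have "cup A (\<lambda>u. cobd A P (a # u)) Q w = p \<ominus> q"
    by (simp add: p_def q_def a_minus_def cup_add_left cup_minus_left)
  finally have 1: "cup A (cobd A P) Q (a # w) = e \<oplus> f \<oplus> (p \<ominus> q)" .
  have "cup A (?S P) (cobd A Q) (a # w) =
      twist A ?n (twist A 1 ?c) \<otimes> cobd A Q (a # w) \<oplus> cup A (\<lambda>u. ?S P (a # u)) (cobd A Q) w"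
    by simp
  also have "twist A ?n (twist A 1 ?c) \<otimes> cobd A Q (a # w) = g \<ominus> h"
    by (simp add: g_def h_def twist_twist r_distr r_minus a_minus_def)
  also have "(\<lambda>u. ?S P (a # u)) = (\<lambda>u. \<ominus> ?S ?P u)"
    by (rule ext) (auto simp: ksign_def)
  also have "cup A (\<lambda>u. \<ominus> ?S ?P u) (cobd A Q) w = \<ominus> r"
    by (simp add: r_def cup_minus_left)
  finally have 2: "cup A (?S P) (cobd A Q) (a # w) = g \<ominus> h \<oplus> \<ominus> r" .
  have "twist A (?n + 2) (P []) = twist A ?n (P [])"
    using twist_plus_two[of "P []" ?n] by (simp add: add.commute)
  then have 3: "twist A (int (length (a # w)) + 1) (P []) \<otimes> Q (a # w) = e"
    by (simp add: e_def add.commute)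
  show ?case
    unfolding lhs 1 2 3 using cl by algebra
qed

end

text \<open>The nondegenerate simplices of \<open>\<Delta>\<^sup>q\<close>, as lists of vertices, together with the empty word.\<close>

definition simplex_words :: "nat \<Rightarrow> nat list set" where
  "simplex_words q = {w. sorted_wrt (<) w \<and> set w \<subseteq> {..q}}"

lemma simplex_words_simps [simp]:
  "[] \<in> simplex_words q"
  "a # w \<in> simplex_words q \<longleftrightarrow> a \<le> q \<and> (\<forall>b\<in>set w. a < b) \<and> w \<in> simplex_words q"
  by (auto simp: simplex_words_def)

lemma simplex_words_subseq: "subseq u w \<Longrightarrow> w \<in> simplex_words q \<Longrightarrow> u \<in> simplex_words q"
  by (induction u w rule: list_emb.induct) (auto dest: list_emb_set)

lemma finite_simplex_words: "finite (simplex_words q)"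
proof (rule finite_subset)
  show "simplex_words q \<subseteq> {w. set w \<subseteq> {..q} \<and> distinct w}"
    by (auto simp: simplex_words_def strict_sorted_iff)
qed (simp add: finite_subset_distinct)

text \<open>A cochain \<open>\<phi> \<otimes> b\<close> corresponds to
  \<open>w \<mapsto> \<phi> w \<cdot> b\<close>, which has degree \<open>|b|\<close> on a word that contributes degree \<open>length w - 1\<close>.\<close>

definition word_cochains :: "nat \<Rightarrow> ('b, 'm) dg_ring_scheme \<Rightarrow> (nat list \<Rightarrow> 'b) dg_ring" where
  "word_cochains q B =
    \<lparr>carrier = {P. (\<forall>w. P w \<in> carrier B) \<and> P [] = \<zero>\<^bsub>B\<^esub> \<and> (\<forall>w. w \<notin> simplex_words q \<longrightarrow> P w = \<zero>\<^bsub>B\<^esub>)},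
     monoid.mult = cup B,
     one = (\<lambda>w. if w \<in> simplex_words q \<and> length w = 1 then \<one>\<^bsub>B\<^esub> else \<zero>\<^bsub>B\<^esub>),
     zero = (\<lambda>w. \<zero>\<^bsub>B\<^esub>),
     add = (\<lambda>P Q w. P w \<oplus>\<^bsub>B\<^esub> Q w),
     grd = (\<lambda>i. {P. (\<forall>w. P w \<in> grd B (i + 1 - int (length w))) \<and>
                     P [] = \<zero>\<^bsub>B\<^esub> \<and> (\<forall>w. w \<notin> simplex_words q \<longrightarrow> P w = \<zero>\<^bsub>B\<^esub>)}),
     differential = (\<lambda>P w. if w \<in> simplex_words q then cobd B P w else \<zero>\<^bsub>B\<^esub>)\<rparr>"

text \<open>If \<open>\<theta>\<close> identifies letters of \<open>w\<close>, then
  \<open>map \<theta> w\<close> is not strictly increasing and a cochain vanishes there, so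
  collapsed words are covered by the same clause.\<close>

definition word_pull ::
    "('b, 'm) dg_ring_scheme \<Rightarrow> nat \<Rightarrow> (nat \<Rightarrow> nat) \<Rightarrow> (nat list \<Rightarrow> 'b) \<Rightarrow> nat list \<Rightarrow> 'b" where
  "word_pull B m \<theta> P = (\<lambda>w. if w \<in> simplex_words m then P (map \<theta> w) else \<zero>\<^bsub>B\<^esub>)"

lemmas word_cochains_sel [simp] =
  word_cochains_def[THEN arg_cong[of _ _ monoid.mult], simplified]
  word_cochains_def[THEN arg_cong[of _ _ one], simplified]
  word_cochains_def[THEN arg_cong[of _ _ zero], simplified]
  word_cochains_def[THEN arg_cong[of _ _ add], simplified]
  word_cochains_def[THEN arg_cong[of _ _ differential], simplified]

lemma word_cochains_carrier:
  "P \<in> carrier (word_cochains q B) \<longleftrightarrow>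
    (\<forall>w. P w \<in> carrier B) \<and> P [] = \<zero>\<^bsub>B\<^esub> \<and> (\<forall>w. w \<notin> simplex_words q \<longrightarrow> P w = \<zero>\<^bsub>B\<^esub>)"
  by (simp add: word_cochains_def)

lemma word_cochains_grd:
  "P \<in> grd (word_cochains q B) i \<longleftrightarrow>
    (\<forall>w. P w \<in> grd B (i + 1 - int (length w))) \<and> P [] = \<zero>\<^bsub>B\<^esub> \<and>
    (\<forall>w. w \<notin> simplex_words q \<longrightarrow> P w = \<zero>\<^bsub>B\<^esub>)"
  by (simp add: word_cochains_def)

section \<open>The DG ring structure of \<open>word_cochains\<close>\<close>

context dg_ring
begin

text \<open>The prefix and the suffix in a term share a letter. If both are strictly increasing with
  letters up to \<open>q\<close>, so is the whole word; hence for \<open>w\<close> outside the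
  simplex every term has a vanishing factor.\<close>

lemma cup_eq_zero:
  assumes "\<And>w. P w \<in> carrier A" "\<And>w. Q w \<in> carrier A"
    and P: "\<And>w. w \<notin> simplex_words q \<Longrightarrow> P w = \<zero>"
    and Q: "\<And>w. w \<notin> simplex_words q \<Longrightarrow> Q w = \<zero>"
    and "w \<notin> simplex_words q"
  shows "cup A P Q w = \<zero>"
  using assms(1,3,5)
proof (induction w arbitrary: P)
  case (Cons a m)
  note [simp] = Cons.prems(1) assms(2)
  have "cup A (\<lambda>u. P (a # u)) Q m = \<zero>"
  proof (cases "m \<in> simplex_words q")
    case False
    then show ?thesis
      using Cons.IH[of "\<lambda>u. P (a # u)"] Cons.prems(2) by auto
  next
    case True
    have "cup A (\<lambda>u. P (a # u)) Q m = cup A (\<lambda>u. \<zero>) Q m"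
    proof (rule cup_cong)
      fix u assume u: "prefix u m" "u \<noteq> []"
      then obtain b v v' where [simp]: "u = b # v" "m = b # v'"
        by (cases u; cases m) auto
      \<comment> \<open>As \<open>m\<close> is itself a word of the simplex, the failure of
        \<open>a # m\<close> lies between \<open>a\<close> and the first letter \<open>b\<close>,
        and \<open>u\<close> also begins with \<open>b\<close>.\<close>
      have "a # u \<notin> simplex_words q"
        using Cons.prems(3) True by force
      then show "P (a # u) = \<zero>" by (rule Cons.prems(2))
    qed simp
    then show ?thesis by simp
  qed
  then show ?case using Q[OF Cons.prems(3)] by simp
qed simp

text \<open>For two equal neighbouring letters, the faces omitting one or the other coincide and
  carry opposite signs. Every other term still contains both copies, including the one with the
  differential of \<open>A\<close>.\<close>

lemma cobd_degenerate:
  assumes "\<And>w. P w \<in> carrier A" "\<And>w. \<not> sorted_wrt (<) w \<Longrightarrow> P w = \<zero>"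
    and "sorted w" "\<not> sorted_wrt (<) (w :: nat list)"
  shows "cobd A P w = \<zero>"
  using assms
proof (induction w arbitrary: P)
  case (Cons a w)
  note [simp] = Cons.prems(1)
  from Cons.prems(4) obtain b m where w [simp]: "w = b # m" by (cases w) auto
  show ?case
  proof (cases "a = b")
    case True
    have "(\<lambda>u. P (a # a # u)) = (\<lambda>u. \<zero>)"
      by (rule ext) (simp add: Cons.prems(2))
    with True show ?thesis
      by (simp add: a_minus_def minus_add minus_minus r_neg)
  next
    case False
    with Cons.prems(3,4) have "\<not> sorted_wrt (<) w" by force
    then have "P w = \<zero>" "cobd A (\<lambda>u. P (a # u)) w = \<zero>"
      using Cons.prems(2,3) by (auto intro!: Cons.IH simp del: w)
    then show ?thesis by (simp add: a_minus_def)
  qed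
qed simp

lemma cup_grd:
  assumes "\<And>w. w \<noteq> [] \<Longrightarrow> P w \<in> grd A (i + 1 - int (length w))"
    and "\<And>w. Q w \<in> grd A (j + 1 - int (length w))"
  shows "cup A P Q w \<in> grd A (i + j + 1 - int (length w))"
  using assms
proof (induction w arbitrary: P i)
  case (Cons a w)
  \<comment> \<open>Fixing the first letter lowers the degree of \<open>P\<close> by one.\<close>
  have "cup A (\<lambda>u. P (a # u)) Q w \<in> grd A (i - 1 + j + 1 - int (length w))"
    using Cons.prems(1)[of "a # _"] Cons.prems(2) by (intro Cons.IH) (simp_all add: algebra_simps)
  moreover have "twist A (int (length w)) (P [a]) \<otimes> Q (a # w) \<in> grd A (i + (j - int (length w)))"
    using Cons.prems(1)[of "[a]"] Cons.prems(2)[of "a # w"] by (intro mult_grd twist_grd) simp_all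
  ultimately show ?case by (simp add: add_grd algebra_simps)
qed simp

lemma cobd_grd:
  assumes "\<And>w. P w \<in> grd A (i + 1 - int (length w))"
  shows "cobd A P w \<in> grd A (i + 2 - int (length w))"
  using assms
proof (induction w arbitrary: P i)
  case Nil
  then show ?case using minus_grd[OF diff_grd[OF Nil[of "[]"]]] by (simp add: add.commute)
next
  case (Cons a w)
  have "cobd A (\<lambda>u. P (a # u)) w \<in> grd A (i - 1 + 2 - int (length w))"
    using Cons.prems[of "a # _"] by (intro Cons.IH) (simp add: algebra_simps)
  then show ?case
    using Cons.prems[of w] by (simp add: diff_mem_grd algebra_simps)
qed

lemma ring_word_cochains: "ring (word_cochains q A)"
proof (rule ringI)
  show "abelian_group (word_cochains q A)"
  proof (rule abelian_groupI)
    fix P assume "P \<in> carrier (word_cochains q A)"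
    then show "\<exists>Q\<in>carrier (word_cochains q A). Q \<oplus>\<^bsub>word_cochains q A\<^esub> P = \<zero>\<^bsub>word_cochains q A\<^esub>"
      by (intro bexI[of _ "\<lambda>w. \<ominus> P w"]) (auto simp: word_cochains_carrier l_neg)
  qed (auto simp: word_cochains_carrier a_ac)
  show "monoid (word_cochains q A)"
  proof (rule monoidI)
    fix P assume P: "P \<in> carrier (word_cochains q A)"
    have "cup A (\<one>\<^bsub>word_cochains q A\<^esub>) P w = P w" for w
    proof (cases "w \<in> simplex_words q")
      case True
      have "cup A (\<one>\<^bsub>word_cochains q A\<^esub>) P w = cup A (\<lambda>u. if length u = 1 then \<one> else \<zero>) P w"
        by (rule cup_cong) (auto simp: simplex_words_subseq[OF prefix_imp_subseq True])
      with P cup_one_left[of P w] show ?thesis by (auto simp: word_cochains_carrier)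
    next
      case False
      with P show ?thesis by (auto simp: word_cochains_carrier intro!: cup_eq_zero[of _ _ q])
    qed
    then show "\<one>\<^bsub>word_cochains q A\<^esub> \<otimes>\<^bsub>word_cochains q A\<^esub> P = P" by auto
    have "cup A P (\<one>\<^bsub>word_cochains q A\<^esub>) w = P w" for w
    proof (cases "w \<in> simplex_words q")
      case True
      have "cup A P (\<one>\<^bsub>word_cochains q A\<^esub>) w = cup A P (\<lambda>u. if length u = 1 then \<one> else \<zero>) w"
        by (rule cup_cong) (auto simp: simplex_words_subseq[OF suffix_imp_subseq True])
      with P cup_one_right[of P w] show ?thesis by (auto simp: word_cochains_carrier)
    next
      case False
      with P show ?thesis by (auto simp: word_cochains_carrier intro!: cup_eq_zero[of _ _ q])
    qed
    then show "P \<otimes>\<^bsub>word_cochains q A\<^esub> \<one>\<^bsub>word_cochains q A\<^esub> = P" by auto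
  next
    fix P Q assume "P \<in> carrier (word_cochains q A)" "Q \<in> carrier (word_cochains q A)"
    then show "P \<otimes>\<^bsub>word_cochains q A\<^esub> Q \<in> carrier (word_cochains q A)"
      by (auto simp: word_cochains_carrier intro!: cup_eq_zero[of _ _ q])
  qed (auto simp: word_cochains_carrier cup_assoc)
qed (auto simp: word_cochains_carrier cup_add_left cup_add_right)

lemma word_cochains_zmul:
  assumes "P \<in> carrier (word_cochains q A)"
  shows "[(k::int)] \<cdot>\<^bsub>word_cochains q A\<^esub> P = (\<lambda>w. [k] \<cdot> P w)"
proof
  fix w
  interpret W: ring "word_cochains q A" by (rule ring_word_cochains)
  have "(\<lambda>P. P w) \<in> hom (add_monoid (word_cochains q A)) (add_monoid A)"
    by (auto simp: hom_def word_cochains_carrier)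
  from hom_int_pow[OF this _ W.a_group a_group, of P k] assms
  show "([k] \<cdot>\<^bsub>word_cochains q A\<^esub> P) w = [k] \<cdot> P w" by (simp add: add_pow_def)
qed

lemma word_cochains_grd_closed: "P \<in> grd (word_cochains q A) i \<Longrightarrow> P \<in> carrier (word_cochains q A)"
  unfolding word_cochains_grd word_cochains_carrier using grd_closed by blast

lemma word_cochains_grd_subgroup: "subgroup (grd (word_cochains q A) i) (add_monoid (word_cochains q A))"
proof -
  interpret W: ring "word_cochains q A" by (rule ring_word_cochains)
  have sub: "grd (word_cochains q A) i \<subseteq> carrier (word_cochains q A)"
    using word_cochains_grd_closed by blast
  have minus: "inv\<^bsub>add_monoid (word_cochains q A)\<^esub> P = (\<lambda>w. \<ominus> P w)"
    if P: "P \<in> carrier (word_cochains q A)" for P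
  proof -
    have "\<ominus>\<^bsub>word_cochains q A\<^esub> P = (\<lambda>w. \<ominus> P w)"
      using word_cochains_zmul[OF P, of "-1"] P by (simp add: word_cochains_carrier)
    then show ?thesis by (simp only: a_inv_def)
  qed
  show ?thesis
  proof (rule group.subgroupI[OF W.a_group])
    have "(\<lambda>w. \<zero>) \<in> grd (word_cochains q A) i" by (simp add: word_cochains_grd)
    then show "grd (word_cochains q A) i \<noteq> {}" by blast
  next
    fix P assume P: "P \<in> grd (word_cochains q A) i"
    with sub have "P \<in> carrier (word_cochains q A)" by blast
    with P show "inv\<^bsub>add_monoid (word_cochains q A)\<^esub> P \<in> grd (word_cochains q A) i"
      unfolding minus[OF \<open>P \<in> carrier (word_cochains q A)\<close>]
      by (auto simp: word_cochains_grd minus_grd)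
  qed (use sub in \<open>auto simp: word_cochains_grd add_grd\<close>)
qed

lemma predg_ring_word_cochains: "predg_ring (word_cochains q A)"
proof -
  let ?W = "word_cochains q A"
  interpret W: ring ?W by (rule ring_word_cochains)
  \<comment> \<open>Faces of a word of the simplex are again such words, so the truncation between
    the two coboundaries is invisible.\<close>
  have cut: "cobd A (\<lambda>w. if w \<in> simplex_words q then cobd A P w else \<zero>) w = \<zero>"
    if "P \<in> carrier ?W" "w \<in> simplex_words q" for P w
  proof -
    have "cobd A (\<lambda>w. if w \<in> simplex_words q then cobd A P w else \<zero>) w = cobd A (cobd A P) w"
      by (rule cobd_cong) (simp add: simplex_words_subseq[OF _ that(2)])
    with that show ?thesis by (simp add: cobd_cobd word_cochains_carrier)
  qed
  show ?thesis
  proof (intro predg_ring.intro predg_ring_axioms.intro)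
    show "ring ?W" by (rule W.ring_axioms)
    show "subgroup (grd ?W i) (add_monoid ?W)" for i by (rule word_cochains_grd_subgroup)
    show "\<one>\<^bsub>?W\<^esub> \<in> grd ?W 0" by (auto simp: word_cochains_grd one_grd)
  next
    fix P Q i j assume "P \<in> grd ?W i" "Q \<in> grd ?W j"
    then show "P \<otimes>\<^bsub>?W\<^esub> Q \<in> grd ?W (i + j)"
      using grd_closed
      by (auto simp: word_cochains_grd intro!: cup_grd cup_eq_zero[of _ _ q])
  next
    fix P Q assume P: "P \<in> carrier ?W" and Q: "Q \<in> carrier ?W"
    show "differential ?W P \<in> carrier ?W" "differential ?W (differential ?W P) = \<zero>\<^bsub>?W\<^esub>"
      using P cut by (auto simp: word_cochains_carrier)
    show "differential ?W (P \<oplus>\<^bsub>?W\<^esub> Q) = differential ?W P \<oplus>\<^bsub>?W\<^esub> differential ?W Q"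
      using P Q by (auto simp: word_cochains_carrier cobd_add)
  next
    fix P i assume P: "P \<in> grd ?W i"
    then show "differential ?W P \<in> grd ?W (i + 1)"
      using cobd_grd[of P i] by (auto simp: word_cochains_grd algebra_simps)
  next
    fix P Q i assume Pi: "P \<in> grd ?W i" and Q: "Q \<in> carrier ?W"
    have P: "P \<in> carrier ?W" using Pi by (rule word_cochains_grd_closed)
    have tw: "[ksign (int (length u) + 1)] \<cdot> twist A 1 (P u) = [ksign i] \<cdot> P u" for u
    proof -
      have "P u \<in> grd A (i + 1 - int (length u))" using Pi by (simp add: word_cochains_grd)
      then have "[ksign (int (length u) + 1)] \<cdot> twist A 1 (P u) =
          [(ksign (int (length u) + 1) * ksign (i + 1 - int (length u)))] \<cdot> P u"
        using grd_closed by (simp add: twist_homog zmul_zmul)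
      then show ?thesis by (simp flip: ksign_add) (simp add: ksign_def)
    qed
    let ?d = "\<lambda>P w. if w \<in> simplex_words q then cobd A P w else \<zero>"
    have "differential ?W (P \<otimes>\<^bsub>?W\<^esub> Q) w = cup A (?d P) Q w \<oplus> cup A (\<lambda>u. [ksign i] \<cdot> P u) (?d Q) w" for w
    proof (cases "w \<in> simplex_words q")
      case True
      have "cup A (?d P) Q w = cup A (cobd A P) Q w"
        by (rule cup_cong) (auto simp: simplex_words_subseq[OF prefix_imp_subseq True])
      moreover have "cup A (\<lambda>u. [ksign i] \<cdot> P u) (?d Q) w = cup A (\<lambda>u. [ksign i] \<cdot> P u) (cobd A Q) w"
        by (rule cup_cong) (auto simp: simplex_words_subseq[OF suffix_imp_subseq True])
      \<comment> \<open>The correction term of \<open>cobd_cup\<close> disappears because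
        \<open>P [] = \<zero>\<close>.\<close>
      ultimately show ?thesis
        using True P Q cobd_cup[of P Q w] by (simp add: tw word_cochains_carrier a_minus_def)
    next
      case False
      then have "cup A (?d P) Q w = \<zero>" "cup A (\<lambda>u. [ksign i] \<cdot> P u) (?d Q) w = \<zero>"
        using P Q by (auto simp: word_cochains_carrier intro!: cup_eq_zero[of _ _ q])
      with False show ?thesis by simp
    qed
    moreover have "cup A (\<lambda>u. [ksign i] \<cdot> P u) (?d Q) w = [ksign i] \<cdot> cup A P (?d Q) w" for w
      using P Q by (auto simp: word_cochains_carrier ksign_def cup_minus_left)
    moreover have "cup A P (?d Q) \<in> carrier ?W"
      using P Q by (auto simp: word_cochains_carrier intro!: cup_eq_zero[of _ _ q])
    ultimately show "differential ?W (P \<otimes>\<^bsub>?W\<^esub> Q) =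
        differential ?W P \<otimes>\<^bsub>?W\<^esub> Q \<oplus>\<^bsub>?W\<^esub> [ksign i] \<cdot>\<^bsub>?W\<^esub> (P \<otimes>\<^bsub>?W\<^esub> differential ?W Q)"
      by (auto simp: word_cochains_zmul)
  qed
qed

end

section \<open>Pullback of word cochains along monotone maps\<close>

lemma map_mem_simplex_words:
  assumes "\<theta> \<in> mono_maps m n" "w \<in> simplex_words m"
  shows "sorted (map \<theta> w)" "set (map \<theta> w) \<subseteq> {..n}"
    "map \<theta> w \<in> simplex_words n \<longleftrightarrow> sorted_wrt (<) (map \<theta> w)"
proof -
  have w: "sorted_wrt (<) w" "set w \<subseteq> {..m}" and \<theta>: "\<theta> \<in> {..m} \<rightarrow>\<^sub>E {..n}" "mono_on {..m} \<theta>"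
    using assms by (auto simp: simplex_words_def mono_maps_def)
  show "set (map \<theta> w) \<subseteq> {..n}" using w PiE_mem[OF \<theta>(1)] by auto
  then show "map \<theta> w \<in> simplex_words n \<longleftrightarrow> sorted_wrt (<) (map \<theta> w)"
    by (simp add: simplex_words_def)
  show "sorted (map \<theta> w)"
    unfolding sorted_wrt_map
    by (rule sorted_wrt_mono_rel[OF _ w(1)]) (use \<theta>(2) w(2) in \<open>auto intro: mono_onD\<close>)
qed

context dg_ring
begin

text \<open>Multiplicativity is formal, since \<open>map\<close> commutes with prefixes and
  suffixes. For the differential, \<open>map \<theta> w\<close> may have repeated letters; there the
  left side is zero by truncation and the right side by \<open>cobd_degenerate\<close>.\<close>

lemma word_pull_hom:
  assumes \<theta>: "\<theta> \<in> mono_maps m n"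
  shows "word_pull A m \<theta> \<in> ring_hom (word_cochains n A) (word_cochains m A)"
    and "P \<in> grd (word_cochains n A) i \<Longrightarrow> word_pull A m \<theta> P \<in> grd (word_cochains m A) i"
    and "P \<in> carrier (word_cochains n A) \<Longrightarrow>
      word_pull A m \<theta> (differential (word_cochains n A) P) =
      differential (word_cochains m A) (word_pull A m \<theta> P)"
proof -
  note map = map_mem_simplex_words[OF \<theta>]
  show "word_pull A m \<theta> \<in> ring_hom (word_cochains n A) (word_cochains m A)"
  proof (rule ring_hom_memI)
    fix P Q assume P: "P \<in> carrier (word_cochains n A)" and Q: "Q \<in> carrier (word_cochains n A)"
    show "word_pull A m \<theta> P \<in> carrier (word_cochains m A)"
      using P by (auto simp: word_cochains_carrier word_pull_def)
    have "word_pull A m \<theta> (cup A P Q) w = cup A (word_pull A m \<theta> P) (word_pull A m \<theta> Q) w" for w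
    proof (cases "w \<in> simplex_words m")
      case True
      have "cup A (word_pull A m \<theta> P) (word_pull A m \<theta> Q) w =
          cup A (\<lambda>u. P (map \<theta> u)) (\<lambda>u. Q (map \<theta> u)) w"
        by (rule cup_cong)
          (auto simp: word_pull_def simplex_words_subseq[OF suffix_imp_subseq True] simplex_words_subseq[OF prefix_imp_subseq True])
      with True show ?thesis by (simp add: cup_map word_pull_def)
    next
      case False
      with P Q show ?thesis
        by (subst cup_eq_zero[of _ _ m]) (auto simp: word_pull_def word_cochains_carrier)
    qed
    then show "word_pull A m \<theta> (P \<otimes>\<^bsub>word_cochains n A\<^esub> Q) =
        word_pull A m \<theta> P \<otimes>\<^bsub>word_cochains m A\<^esub> word_pull A m \<theta> Q" by auto
    show "word_pull A m \<theta> (P \<oplus>\<^bsub>word_cochains n A\<^esub> Q) =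
        word_pull A m \<theta> P \<oplus>\<^bsub>word_cochains m A\<^esub> word_pull A m \<theta> Q"
      by (auto simp: word_pull_def)
  next
    show "word_pull A m \<theta> \<one>\<^bsub>word_cochains n A\<^esub> = \<one>\<^bsub>word_cochains m A\<^esub>"
    proof
      fix w
      show "word_pull A m \<theta> \<one>\<^bsub>word_cochains n A\<^esub> w = \<one>\<^bsub>word_cochains m A\<^esub> w"
        using map(2)[of w] by (cases w) (auto simp: word_pull_def)
    qed
  qed
  show "word_pull A m \<theta> P \<in> grd (word_cochains m A) i" if "P \<in> grd (word_cochains n A) i"
  proof -
    have "P (map \<theta> w) \<in> grd A (i + 1 - int (length w))" for w
      using that[unfolded word_cochains_grd, THEN conjunct1, THEN spec, of "map \<theta> w"] by simp
    with that show ?thesis by (auto simp: word_cochains_grd word_pull_def)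
  qed
  assume P: "P \<in> carrier (word_cochains n A)"
  have "word_pull A m \<theta> (differential (word_cochains n A) P) w =
      differential (word_cochains m A) (word_pull A m \<theta> P) w" for w
  proof (cases "w \<in> simplex_words m")
    case True
    have "cobd A (word_pull A m \<theta> P) w = cobd A (\<lambda>u. P (map \<theta> u)) w"
      by (rule cobd_cong) (simp add: word_pull_def simplex_words_subseq[OF _ True])
    then have eq: "cobd A (word_pull A m \<theta> P) w = cobd A P (map \<theta> w)"
      by (simp add: cobd_map)
    show ?thesis
    proof (cases "map \<theta> w \<in> simplex_words n")
      case False
      then have "cobd A P (map \<theta> w) = \<zero>"
        using P map[OF True] by (intro cobd_degenerate) (auto simp: word_cochains_carrier simplex_words_def)
      with False True eq show ?thesis by (simp add: word_pull_def)
    qed (use True eq in \<open>simp add: word_pull_def\<close>)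
  qed (simp add: word_pull_def)
  then show "word_pull A m \<theta> (differential (word_cochains n A) P) =
      differential (word_cochains m A) (word_pull A m \<theta> P)" by blast
qed

lemma word_pull_id:
  "P \<in> carrier (word_cochains n A) \<Longrightarrow> word_pull A n (\<lambda>i\<in>{..n}. i) P = P"
proof
  fix w assume P: "P \<in> carrier (word_cochains n A)"
  have "map (\<lambda>i\<in>{..n}. i) w = w" if "w \<in> simplex_words n"
    using that by (intro map_idI) (auto simp: simplex_words_def)
  with P show "word_pull A n (\<lambda>i\<in>{..n}. i) P w = P w"
    by (auto simp: word_pull_def word_cochains_carrier)
qed

lemma word_pull_comp:
  assumes \<eta>: "\<eta> \<in> mono_maps l m" and \<theta>: "\<theta> \<in> mono_maps m n" and P: "P \<in> carrier (word_cochains n A)"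
  shows "word_pull A l (compose {..l} \<theta> \<eta>) P = word_pull A l \<eta> (word_pull A m \<theta> P)"
proof
  fix w
  show "word_pull A l (compose {..l} \<theta> \<eta>) P w = word_pull A l \<eta> (word_pull A m \<theta> P) w"
  proof (cases "w \<in> simplex_words l")
    case True
    then have eq: "map (compose {..l} \<theta> \<eta>) w = map \<theta> (map \<eta> w)"
      by (auto simp: simplex_words_def compose_def)
    \<comment> \<open>Only the right side truncates between the two maps. A word already collapsed
      by \<open>\<eta>\<close> stays collapsed under the monotone \<open>\<theta>\<close>, so
      \<open>P\<close> vanishes there anyway.\<close>
    have "P (map \<theta> (map \<eta> w)) = \<zero>" if "map \<eta> w \<notin> simplex_words m"
    proof -
      have "\<not> sorted_wrt (<) (map \<theta> (map \<eta> w))"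
      proof
        assume s: "sorted_wrt (<) (map \<theta> (map \<eta> w))"
        have "sorted_wrt (<) (map \<eta> w)"
          using s unfolding sorted_wrt_map[of _ \<theta>]
        proof (rule sorted_wrt_mono_rel[rotated])
          fix x y assume "x \<in> set (map \<eta> w)" "y \<in> set (map \<eta> w)" "\<theta> x < \<theta> y"
          moreover from this map_mem_simplex_words(2)[OF \<eta> True] have "x \<in> {..m}" "y \<in> {..m}"
            by blast+
          moreover have "mono_on {..m} \<theta>" using \<theta> by (simp add: mono_maps_def)
          ultimately show "x < y" by (meson leD mono_onD not_le_imp_less)
        qed
        with that map_mem_simplex_words(3)[OF \<eta> True] show False by simp
      qed
      then show ?thesis using P by (auto simp: word_cochains_carrier simplex_words_def)
    qed
    with True eq show ?thesis by (auto simp: word_pull_def simp del: map_map map_eq_conv)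
  qed (simp add: word_pull_def)
qed

end

section \<open>Lifting homomorphisms out of a semi-free DG ring\<close>

lemmas free_Abelian_induct [consumes 1, case_names zero diff of] = free_Abelian_group_induct

primrec word_prod :: "('r, 'm) ring_scheme \<Rightarrow> ('x \<Rightarrow> 'r) \<Rightarrow> 'x list \<Rightarrow> 'r" where
  "word_prod R \<gamma> [] = \<one>\<^bsub>R\<^esub>"
| "word_prod R \<gamma> (x # w) = \<gamma> x \<otimes>\<^bsub>R\<^esub> word_prod R \<gamma> w"

context ring
begin

lemma word_prod_closed: "(\<And>x. \<gamma> x \<in> carrier R) \<Longrightarrow> word_prod R \<gamma> w \<in> carrier R"
  by (induction w) auto

lemma word_prod_append:
  "(\<And>x. \<gamma> x \<in> carrier R) \<Longrightarrow> word_prod R \<gamma> (v @ w) = word_prod R \<gamma> v \<otimes> word_prod R \<gamma> w"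
  by (induction v) (auto simp: word_prod_closed m_assoc)

text \<open>Both sides are biadditive in \<open>u\<close> and \<open>v\<close>, which reduces the
  claim to single words, where it is \<open>word_prod_append\<close>.\<close>

lemma lin_word_prod_mult:
  assumes \<gamma>: "\<And>x. \<gamma> x \<in> carrier R"
  shows "lin R UNIV (word_prod R \<gamma>) (frag_extend (\<lambda>s. frag_extend (\<lambda>t. frag_of (s @ t)) v) u) =
    lin R UNIV (word_prod R \<gamma>) u \<otimes> lin R UNIV (word_prod R \<gamma>) v"
proof -
  let ?L = "lin R UNIV (word_prod R \<gamma>)"
  have wp: "word_prod R \<gamma> w \<in> carrier R" for w by (rule word_prod_closed) (rule \<gamma>)
  have L [simp]: "?L 0 = \<zero>" "\<And>w. ?L (frag_of w) = word_prod R \<gamma> w" "\<And>u. ?L u \<in> carrier R"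
      "\<And>u v. ?L (u - v) = ?L u \<ominus> ?L v"
    using wp by (auto simp: lin_of intro!: lin_closed lin_diff lin_zero)
  have *: "?L (frag_extend (\<lambda>t. frag_of (s @ t)) v) = word_prod R \<gamma> s \<otimes> ?L v" for s
    using subset_UNIV[of "Poly_Mapping.keys v"]
  proof (induction v rule: frag_induction)
    case (diff a b)
    then show ?case
      by (simp add: frag_extend_diff a_minus_def r_distr r_minus wp)
  qed (simp_all add: word_prod_append \<gamma> wp)
  show ?thesis
    using subset_UNIV[of "Poly_Mapping.keys u"]
  proof (induction u rule: frag_induction)
    case (diff a b)
    then show ?case
      by (simp add: frag_extend_diff a_minus_def l_distr l_minus)
  qed (simp_all add: *)
qed

end

lemma ring_hom_diff:
  assumes "f \<in> ring_hom R S" "ring R" "ring S" "x \<in> carrier R" "y \<in> carrier R"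
  shows "f (x \<ominus>\<^bsub>R\<^esub> y) = f x \<ominus>\<^bsub>S\<^esub> f y"
proof -
  interpret ring_hom_ring R S f using assms by (intro ring_hom_ringI2)
  show ?thesis using assms(4,5) by (simp add: a_minus_def)
qed

context predg_ring
begin

lemma word_prod_grd:
  "(\<And>x. \<gamma> x \<in> grd A (deg x)) \<Longrightarrow> word_prod A \<gamma> w \<in> grd A (sum_list (map deg w))"
  by (induction w) (auto simp: one_grd intro: mult_grd)

end

section \<open>Extending assignments on free generators\<close>

locale free_presentation = dg_ring A for A :: "('a, 'm) dg_ring_scheme" (structure) +
  fixes X :: "'x set" and deg :: "'x \<Rightarrow> int" and h :: "('x list \<Rightarrow>\<^sub>0 int) \<Rightarrow> 'a"
  assumes h_iso: "h \<in> graded_ring_iso (free_graded_ring X deg) A"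
begin

text \<open>For \<open>Y \<subseteq> X\<close> this is the subring generated by the generators in
  \<open>Y\<close>; the filtration steps of a semi-free DG ring have this form.\<close>

abbreviation "span Y \<equiv> h ` carrier (free_Abelian_group (lists Y))"

lemma h_bij: "bij_betw h (carrier (free_Abelian_group (lists X))) (carrier A)"
  using h_iso by (auto simp: graded_ring_iso_def ring_iso_def free_graded_ring_def)

lemma h_add: "\<lbrakk>Poly_Mapping.keys u \<subseteq> lists X; Poly_Mapping.keys v \<subseteq> lists X\<rbrakk> \<Longrightarrow> h (u + v) = h u \<oplus> h v"
  and h_mult: "\<lbrakk>Poly_Mapping.keys u \<subseteq> lists X; Poly_Mapping.keys v \<subseteq> lists X\<rbrakk> \<Longrightarrow>
    h (frag_extend (\<lambda>s. frag_extend (\<lambda>t. frag_of (s @ t)) v) u) = h u \<otimes> h v"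
  and h_Nil: "h (frag_of []) = \<one>"
  using h_iso by (auto simp: graded_ring_iso_def ring_iso_def ring_hom_def free_graded_ring_def)

lemma h_closed: "Poly_Mapping.keys u \<subseteq> lists X \<Longrightarrow> h u \<in> carrier A"
  using bij_betwE[OF h_bij] by auto

lemma h_zero: "h 0 = \<zero>"
  using h_add[of 0 0] h_closed[of 0] by (metis add.r_cancel_one' add_0 empty_subsetI keys_zero zero_closed)

lemma h_diff:
  assumes "Poly_Mapping.keys u \<subseteq> lists X" "Poly_Mapping.keys v \<subseteq> lists X"
  shows "h (u - v) = h u \<ominus> h v"
proof -
  have uv: "Poly_Mapping.keys (u - v) \<subseteq> lists X" using assms keys_diff[of u v] by blast
  have "h u = h (u - v) \<oplus> h v" using h_add[OF uv assms(2)] by simp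
  then show ?thesis using h_closed assms uv by (metis minus_eq_iff)
qed

lemma h_Cons: "x \<in> X \<Longrightarrow> w \<in> lists X \<Longrightarrow> h (frag_of (x # w)) = h (frag_of [x]) \<otimes> h (frag_of w)"
  using h_mult[of "frag_of [x]" "frag_of w"] by simp

lemma h_gen_grd: "x \<in> X \<Longrightarrow> h (frag_of [x]) \<in> grd A (deg x)"
  using h_iso by (force simp: graded_ring_iso_def free_graded_ring_def)

lemma span_X: "span X = carrier A"
  using h_bij by (simp add: bij_betw_def)

text \<open>Words are built by prepending letters, so left multiplication by a single generator is
  enough, and closure under differences yields all integer combinations.\<close>

lemma span_induct [consumes 2, case_names zero diff one mult]:
  assumes "a \<in> span Y" "Y \<subseteq> X" "P \<zero>"
    and "\<And>a b. \<lbrakk>a \<in> carrier A; b \<in> carrier A; P a; P b\<rbrakk> \<Longrightarrow> P (a \<ominus> b)"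
    and "P \<one>"
    and "\<And>x b. \<lbrakk>x \<in> Y; b \<in> carrier A; P b\<rbrakk> \<Longrightarrow> P (h (frag_of [x]) \<otimes> b)"
  shows "P a"
proof -
  from assms(1) obtain u where u: "Poly_Mapping.keys u \<subseteq> lists Y" "a = h u" by auto
  have sub: "lists Y \<subseteq> lists X" using \<open>Y \<subseteq> X\<close> by (rule lists_mono)
  have "P (h u)"
    using u(1)
  proof (induction u rule: free_Abelian_induct)
    case zero
    then show ?case using assms(3) by (simp add: h_zero)
  next
    case (diff u v)
    then show ?case
      using assms(4)[of "h u" "h v"] sub by (simp add: h_diff h_closed)
  next
    case (of w)
    then show ?case
    proof (induction w)
      case Nil
      then show ?case using assms(5) by (simp add: h_Nil)
    next
      case (Cons x w)
      then have "x \<in> Y" "P (h (frag_of w))" by auto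
      moreover have "x \<in> X" "w \<in> lists X" using Cons sub \<open>Y \<subseteq> X\<close> by auto
      ultimately show ?case
        using assms(6)[of x "h (frag_of w)"] h_Cons[of x w] h_closed[of "frag_of w"] by simp
    qed
  qed
  with u show ?thesis by simp
qed

lemma ring_homs_agree:
  assumes f: "f \<in> ring_hom A S" and g: "g \<in> ring_hom A S" and S: "ring S" and Y: "Y \<subseteq> X"
    and gens: "\<And>x. x \<in> Y \<Longrightarrow> f (h (frag_of [x])) = g (h (frag_of [x]))"
    and a: "a \<in> span Y"
  shows "f a = g a"
  using a Y
proof (induction rule: span_induct)
  case zero
  show ?case
    using ring_hom_zero[OF f ring_axioms S] ring_hom_zero[OF g ring_axioms S] by simp
next
  case (mult x b)
  then have "h (frag_of [x]) \<in> carrier A" using Y by (intro h_closed) auto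
  with mult show ?case using gens by (simp add: ring_hom_mult[OF f] ring_hom_mult[OF g])
qed (simp_all add: ring_hom_diff[OF f ring_axioms S] ring_hom_diff[OF g ring_axioms S]
      ring_hom_one[OF f] ring_hom_one[OF g])

text \<open>Assignments \<open>\<gamma>\<close> will be total with all values in \<open>R\<close>,
  also outside \<open>X\<close>. Extending linearly over all words then makes the support conditions
  of \<open>lin\<close> trivial.\<close>

definition gen_ext :: "('r, 'k) ring_scheme \<Rightarrow> ('x \<Rightarrow> 'r) \<Rightarrow> 'a \<Rightarrow> 'r" where
  "gen_ext R \<gamma> a = lin R UNIV (word_prod R \<gamma>) (inv_into (carrier (free_Abelian_group (lists X))) h a)"

lemma gen_ext_h:
  "Poly_Mapping.keys u \<subseteq> lists X \<Longrightarrow> gen_ext R \<gamma> (h u) = lin R UNIV (word_prod R \<gamma>) u"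
  unfolding gen_ext_def using bij_betw_imp_inj_on[OF h_bij] by (simp add: inv_into_f_f)

lemma gen_ext_ring_hom:
  assumes R: "ring R" and \<gamma>: "\<And>x. \<gamma> x \<in> carrier R"
  shows "gen_ext R \<gamma> \<in> ring_hom A R"
proof -
  interpret R: ring R by fact
  have wp: "word_prod R \<gamma> w \<in> carrier R" for w by (rule R.word_prod_closed) (rule \<gamma>)
  have ex: "\<exists>u. Poly_Mapping.keys u \<subseteq> lists X \<and> a = h u" if "a \<in> carrier A" for a
    using that by (metis carrier_free_Abelian_group_iff imageE span_X)
  show ?thesis
  proof (rule ring_hom_memI)
    fix a assume "a \<in> carrier A"
    with ex obtain u where u: "Poly_Mapping.keys u \<subseteq> lists X" "a = h u" by blast
    then show "gen_ext R \<gamma> a \<in> carrier R" using wp by (auto simp: gen_ext_h intro!: R.lin_closed)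
    fix b assume "b \<in> carrier A"
    with ex obtain v where v: "Poly_Mapping.keys v \<subseteq> lists X" "b = h v" by blast
    have k: "Poly_Mapping.keys (u + v) \<subseteq> lists X"
      using u v keys_add[of u v] by blast
    have k': "Poly_Mapping.keys (frag_extend (\<lambda>s. frag_extend (\<lambda>t. frag_of (s @ t)) v) u) \<subseteq> lists X"
    proof
      fix w assume "w \<in> Poly_Mapping.keys (frag_extend (\<lambda>s. frag_extend (\<lambda>t. frag_of (s @ t)) v) u)"
      then obtain s where "s \<in> Poly_Mapping.keys u"
          "w \<in> Poly_Mapping.keys (frag_extend (\<lambda>t. frag_of (s @ t)) v)"
        using keys_frag_extend by fast
      moreover from this obtain t where "t \<in> Poly_Mapping.keys v" "w = s @ t"
        using keys_frag_extend[of "\<lambda>t. frag_of (s @ t)" v] by auto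
      ultimately show "w \<in> lists X" using u v by auto
    qed
    have "gen_ext R \<gamma> (a \<oplus> b) = gen_ext R \<gamma> (h (u + v))" using u v by (simp add: h_add)
    then show "gen_ext R \<gamma> (a \<oplus> b) = gen_ext R \<gamma> a \<oplus>\<^bsub>R\<^esub> gen_ext R \<gamma> b"
      using u v wp k by (simp add: gen_ext_h R.lin_add)
    show "gen_ext R \<gamma> (a \<otimes> b) = gen_ext R \<gamma> a \<otimes>\<^bsub>R\<^esub> gen_ext R \<gamma> b"
      using gen_ext_h[OF k', of R \<gamma>] u v
      by (simp add: h_mult gen_ext_h R.lin_word_prod_mult[OF \<gamma>])
  next
    show "gen_ext R \<gamma> \<one> = \<one>\<^bsub>R\<^esub>"
      using gen_ext_h[of "frag_of []" R \<gamma>] wp by (simp add: h_Nil R.lin_of)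
  qed
qed

lemma gen_ext_gen:
  assumes R: "ring R" and \<gamma>: "\<And>x. \<gamma> x \<in> carrier R" and x: "x \<in> X"
  shows "gen_ext R \<gamma> (h (frag_of [x])) = \<gamma> x"
proof -
  interpret R: ring R by fact
  have wp: "word_prod R \<gamma> w \<in> carrier R" for w by (rule R.word_prod_closed) (rule \<gamma>)
  have "gen_ext R \<gamma> (h (frag_of [x])) = lin R UNIV (word_prod R \<gamma>) (frag_of [x])"
    using x by (intro gen_ext_h) simp
  also have "\<dots> = word_prod R \<gamma> [x]"
    by (rule R.lin_of) (simp_all add: wp)
  also have "\<dots> = \<gamma> x" using \<gamma> by simp
  finally show ?thesis .
qed

lemma gen_ext_grd:
  assumes "predg_ring R" "\<And>x. \<gamma> x \<in> grd R (deg x)" "a \<in> grd A i"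
  shows "gen_ext R \<gamma> a \<in> grd R i"
proof -
  interpret R: predg_ring R by fact
  have \<gamma>: "\<And>x. \<gamma> x \<in> carrier R" by (rule R.grd_closed[OF assms(2)])
  have wp: "word_prod R \<gamma> w \<in> carrier R" for w by (rule R.word_prod_closed) (rule \<gamma>)
  let ?S = "{w \<in> lists X. sum_list (map deg w) = i}"
  have "h ` grd (free_graded_ring X deg) i = grd A i"
    using h_iso by (auto simp: graded_ring_iso_def)
  with assms(3) obtain u where "u \<in> grd (free_graded_ring X deg) i" and a: "a = h u" by blast
  then have u: "Poly_Mapping.keys u \<subseteq> ?S" by (auto simp: free_graded_ring_def)
  have "lin R UNIV (word_prod R \<gamma>) u \<in> grd R i"
    using u
  proof (induction u rule: free_Abelian_induct)
    case zero
    show ?case using R.lin_zero[of UNIV "word_prod R \<gamma>"] wp by simp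
  next
    case (diff u v)
    then show ?case
      using R.lin_diff[of UNIV "word_prod R \<gamma>" u v] wp by (simp add: R.diff_mem_grd)
  next
    case (of w)
    then show ?case
      using R.word_prod_grd[of \<gamma> deg w] R.lin_of[of UNIV "word_prod R \<gamma>" w] assms(2) wp by simp
  qed
  moreover have "Poly_Mapping.keys u \<subseteq> lists X" using u by blast
  ultimately show ?thesis unfolding a by (simp add: gen_ext_h)
qed

text \<open>With \<open>g = gen_ext R \<gamma>\<close>, both composites of \<open>g\<close> with the
  differentials are derivations along \<open>g\<close>. Agreement on the generators in
  \<open>Y\<close> therefore spreads to the subring they generate, even when \<open>g\<close> is not
  yet compatible on the rest of \<open>A\<close>.\<close>

lemma gen_ext_differential:
  assumes "predg_ring R" "\<And>x. \<gamma> x \<in> grd R (deg x)" "Y \<subseteq> X"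
    and gens: "\<And>x. x \<in> Y \<Longrightarrow>
      differential R (\<gamma> x) = gen_ext R \<gamma> (differential A (h (frag_of [x])))"
    and a: "a \<in> span Y"
  shows "differential R (gen_ext R \<gamma> a) = gen_ext R \<gamma> (differential A a)"
proof -
  interpret R: predg_ring R by fact
  have \<gamma>: "\<And>x. \<gamma> x \<in> carrier R" by (rule R.grd_closed[OF assms(2)])
  note hom = gen_ext_ring_hom[OF R.ring_axioms \<gamma>]
  note [simp] = ring_hom_closed[OF hom] ring_hom_zero[OF hom ring_axioms R.ring_axioms]
  from a \<open>Y \<subseteq> X\<close> show ?thesis
  proof (induction rule: span_induct)
    case zero
    show ?case by simp
  next
    case (diff a b)
    then show ?case
      by (simp add: ring_hom_diff[OF hom ring_axioms R.ring_axioms] R.diff_diff_distrib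
          pre.diff_diff_distrib)
  next
    case one
    show ?case by (simp add: ring_hom_one[OF hom] R.diff_one pre.diff_one)
  next
    case (mult x b)
    let ?x = "h (frag_of [x])"
    have x: "x \<in> X" using mult \<open>Y \<subseteq> X\<close> by auto
    have xg: "?x \<in> grd A (deg x)" using x by (rule h_gen_grd)
    have xc: "?x \<in> carrier A" using xg by (rule grd_closed)
    have \<gamma>x: "gen_ext R \<gamma> ?x = \<gamma> x" using gen_ext_gen[OF R.ring_axioms \<gamma> x] .
    have zm: "gen_ext R \<gamma> ([ksign k] \<cdot> c) = [ksign k] \<cdot>\<^bsub>R\<^esub> gen_ext R \<gamma> c" if "c \<in> carrier A" for k c
    proof -
      interpret ring_hom_ring A R "gen_ext R \<gamma>" using hom ring_axioms R.ring_axioms by (intro ring_hom_ringI2)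
      show ?thesis using that by (auto simp: ksign_def)
    qed
    have "differential R (gen_ext R \<gamma> (?x \<otimes> b)) = differential R (\<gamma> x \<otimes>\<^bsub>R\<^esub> gen_ext R \<gamma> b)"
      using mult xc by (simp add: ring_hom_mult[OF hom] \<gamma>x)
    also have "\<dots> = differential R (\<gamma> x) \<otimes>\<^bsub>R\<^esub> gen_ext R \<gamma> b \<oplus>\<^bsub>R\<^esub>
        [ksign (deg x)] \<cdot>\<^bsub>R\<^esub> (\<gamma> x \<otimes>\<^bsub>R\<^esub> differential R (gen_ext R \<gamma> b))"
      using mult assms(2) by (intro R.leibniz) auto
    also have "\<dots> = gen_ext R \<gamma> (differential A ?x \<otimes> b \<oplus> [ksign (deg x)] \<cdot> (?x \<otimes> differential A b))"
      using mult xc by (simp add: ring_hom_mult[OF hom] ring_hom_add[OF hom] zm gens \<gamma>x)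
    also have "differential A ?x \<otimes> b \<oplus> [ksign (deg x)] \<cdot> (?x \<otimes> differential A b) = differential A (?x \<otimes> b)"
      using leibniz[OF xg] mult by simp
    finally show ?case .
  qed
qed

end

text \<open>The boundary of a new generator lies in the part of \<open>A\<close> where the lift is
  already constructed, so \<open>ext\<close> is applied with \<open>r\<close> the image of that
  boundary. The maps \<open>\<pi> i\<close> and \<open>f i\<close> are only ring homomorphisms: all
  compatibility between them and the differentials is packed into \<open>ext\<close>.\<close>

theorem semi_free_lift:
  fixes A :: "('a, 'm) dg_ring_scheme" and R :: "('r, 'n) dg_ring_scheme"
    and S :: "'i \<Rightarrow> ('s, 'k) dg_ring_scheme"
  assumes A: "dg_ring A" and sf: "semi_free TYPE('x) A" and R: "predg_ring R"
    and S: "\<And>i. i \<in> I \<Longrightarrow> ring (S i)"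
    and \<pi>: "\<And>i. i \<in> I \<Longrightarrow> \<pi> i \<in> ring_hom R (S i)"
    and f: "\<And>i. i \<in> I \<Longrightarrow> f i \<in> ring_hom A (S i)"
    and ext: "\<And>t a r. \<lbrakk>a \<in> grd A t; r \<in> grd R (t + 1); differential R r = \<zero>\<^bsub>R\<^esub>;
        \<And>i. i \<in> I \<Longrightarrow> \<pi> i r = f i (differential A a)\<rbrakk> \<Longrightarrow>
        \<exists>y\<in>grd R t. differential R y = r \<and> (\<forall>i\<in>I. \<pi> i y = f i a)"
  shows "\<exists>g\<in>dg_hom A R. \<forall>i\<in>I. \<forall>a\<in>carrier A. \<pi> i (g a) = f i a"
proof -
  interpret A: dg_ring A by fact
  interpret R: predg_ring R by fact
  from sf obtain X :: "'x set" and deg F h where filt: "filtration X F"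
      and iso: "h \<in> graded_ring_iso (free_graded_ring X deg) A"
      and dF: "\<And>j x. j \<ge> 0 \<Longrightarrow> x \<in> F j \<Longrightarrow>
          differential A (h (frag_of [x])) \<in> h ` free_filtration F deg (j - 1)"
    unfolding semi_free_def by blast
  interpret free_presentation A X deg h by unfold_locales fact
  have FX: "F j \<subseteq> X" if "j \<ge> -1" for j using filt that by (auto simp: filtration_def)
  have F0: "F (-1) = {}" using filt by (simp add: filtration_def)
  have Fmono: "F i \<subseteq> F j" if "-1 \<le> i" "i \<le> j" for i j using filt that by (simp add: filtration_def)
  have dspan: "differential A (h (frag_of [x])) \<in> span (F (j - 1))" if "j \<ge> 0" "x \<in> F j" for j x
  proof -
    have "free_filtration F deg (j - 1) \<subseteq> carrier (free_Abelian_group (lists (F (j - 1))))"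
      by (auto simp: free_filtration_def free_graded_ring_def)
    with dF[OF that] show ?thesis by blast
  qed
  let ?g = "\<lambda>x. h (frag_of [x])"
  \<comment> \<open>Outside \<open>Y\<close> only the degree is prescribed; this keeps
    \<open>gen_ext\<close> a graded ring homomorphism on all of \<open>A\<close> at every
    stage.\<close>
  define good where "good Y \<gamma> \<longleftrightarrow> (\<forall>x. \<gamma> x \<in> grd R (deg x)) \<and>
      (\<forall>x\<in>Y. differential R (\<gamma> x) = gen_ext R \<gamma> (differential A (?g x)) \<and>
             (\<forall>i\<in>I. \<pi> i (\<gamma> x) = f i (?g x)))" for Y \<gamma>
  have good_closed: "\<gamma> x \<in> carrier R" if "good Y \<gamma>" for Y \<gamma> x
    using that R.grd_closed by (auto simp: good_def)
  have lift: "\<pi> i (gen_ext R \<gamma> a) = f i a"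
    if "good Y \<gamma>" "Y \<subseteq> X" "a \<in> span Y" "i \<in> I" for Y \<gamma> a i
  proof -
    note hom = gen_ext_ring_hom[OF R.ring_axioms good_closed[OF that(1)]]
    have "(\<pi> i \<circ> gen_ext R \<gamma>) a = f i a"
    proof (rule ring_homs_agree[OF _ f S])
      show "\<pi> i \<circ> gen_ext R \<gamma> \<in> ring_hom A (S i)"
        using ring_hom_trans[OF hom \<pi>[OF \<open>i \<in> I\<close>]] .
      show "(\<pi> i \<circ> gen_ext R \<gamma>) (?g x) = f i (?g x)" if "x \<in> Y" for x
      proof -
        have "x \<in> X" using that \<open>Y \<subseteq> X\<close> by blast
        then show ?thesis
          using gen_ext_gen[OF R.ring_axioms good_closed[OF \<open>good Y \<gamma>\<close>], of x] that \<open>good Y \<gamma>\<close> \<open>i \<in> I\<close>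
          by (simp add: good_def)
      qed
    qed fact+
    then show ?thesis by simp
  qed
  \<comment> \<open>On the subring generated by \<open>Y\<close> the extension depends only on the
    values on \<open>Y\<close>, so choosing values for later generators cannot spoil equations
    already achieved.\<close>
  have local: "gen_ext R \<gamma> a = gen_ext R \<gamma>' a"
    if \<gamma>: "\<And>x. \<gamma> x \<in> carrier R" and \<gamma>': "\<And>x. \<gamma>' x \<in> carrier R"
      and eq: "\<And>x. x \<in> Y \<Longrightarrow> \<gamma> x = \<gamma>' x" and "Y \<subseteq> X" "a \<in> span Y" for Y \<gamma> \<gamma>' a
  proof (rule ring_homs_agree[OF _ _ R.ring_axioms])
    show "gen_ext R \<gamma> \<in> ring_hom A R" "gen_ext R \<gamma>' \<in> ring_hom A R"
      using gen_ext_ring_hom[OF R.ring_axioms] \<gamma> \<gamma>' by auto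
    show "gen_ext R \<gamma> (?g x) = gen_ext R \<gamma>' (?g x)" if "x \<in> Y" for x
    proof -
      have "x \<in> X" using that \<open>Y \<subseteq> X\<close> by blast
      then show ?thesis
        using gen_ext_gen[OF R.ring_axioms \<gamma>, of x] gen_ext_gen[OF R.ring_axioms \<gamma>', of x] eq[OF that] by simp
    qed
  qed fact+
  have step: "\<exists>\<gamma>'. good (F (j + 1)) \<gamma>' \<and> (\<forall>x\<in>F j. \<gamma>' x = \<gamma> x)" if good: "good (F j) \<gamma>" and j: "j \<ge> -1" for j \<gamma>
  proof -
    have "\<exists>y. y \<in> grd R (deg x) \<and> differential R y = gen_ext R \<gamma> (differential A (?g x)) \<and>
        (\<forall>i\<in>I. \<pi> i y = f i (?g x))" if x: "x \<in> F (j + 1)" for x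
    proof -
      have xX: "x \<in> X" using x FX[of "j + 1"] j by auto
      have gx: "?g x \<in> grd A (deg x)" by (rule h_gen_grd[OF xX])
      have sp: "differential A (?g x) \<in> span (F j)" using dspan[of "j + 1" x] j x by simp
      have "\<exists>y\<in>grd R (deg x). differential R y = gen_ext R \<gamma> (differential A (?g x)) \<and>
        (\<forall>i\<in>I. \<pi> i y = f i (?g x))"
      proof (rule ext[OF gx])
        show "gen_ext R \<gamma> (differential A (?g x)) \<in> grd R (deg x + 1)"
          using good A.diff_grd[OF gx] by (intro gen_ext_grd[OF R]) (auto simp: good_def)
        \<comment> \<open>The prescribed boundary is a cocycle: on the earlier filtration step the
          extension commutes with the differentials, so its differential is the image of
          \<open>d (d x) = 0\<close>.\<close>
        have "differential R (gen_ext R \<gamma> (differential A (?g x))) =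
            gen_ext R \<gamma> (differential A (differential A (?g x)))"
          by (rule gen_ext_differential[OF R _ FX[OF j] _ sp]) (use good in \<open>auto simp: good_def\<close>)
        also have "\<dots> = \<zero>\<^bsub>R\<^esub>"
          using A.diff_diff[OF A.grd_closed[OF gx]]
            ring_hom_zero[OF gen_ext_ring_hom[OF R.ring_axioms good_closed[OF good]] A.ring_axioms R.ring_axioms]
          by simp
        finally show "differential R (gen_ext R \<gamma> (differential A (?g x))) = \<zero>\<^bsub>R\<^esub>" .
        show "\<pi> i (gen_ext R \<gamma> (differential A (?g x))) = f i (differential A (?g x))" if "i \<in> I" for i
          by (rule lift[OF good FX[OF j] sp that])
      qed
      then show ?thesis by blast
    qed
    then obtain c where c: "\<And>x. x \<in> F (j + 1) \<Longrightarrow> c x \<in> grd R (deg x) \<and>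
        differential R (c x) = gen_ext R \<gamma> (differential A (?g x)) \<and> (\<forall>i\<in>I. \<pi> i (c x) = f i (?g x))"
      by metis
    \<comment> \<open>Old values are kept although \<open>c\<close> would also serve on
      \<open>F j\<close>: otherwise the boundaries of new generators would change, and the stages
      would have no limit.\<close>
    define \<gamma>' where "\<gamma>' x = (if x \<in> F (j + 1) \<and> x \<notin> F j then c x else \<gamma> x)" for x
    have \<gamma>'_grd: "\<gamma>' x \<in> grd R (deg x)" for x
      using c good by (auto simp: \<gamma>'_def good_def)
    have eq: "gen_ext R \<gamma>' a = gen_ext R \<gamma> a" if "a \<in> span (F j)" for a
      by (rule local[OF _ good_closed[OF good] _ FX[OF j] that])
        (use R.grd_closed[OF \<gamma>'_grd] in \<open>auto simp: \<gamma>'_def\<close>)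
    have "good (F (j + 1)) \<gamma>'"
      unfolding good_def
    proof (intro conjI allI ballI)
      fix x assume x: "x \<in> F (j + 1)"
      have sp: "differential A (?g x) \<in> span (F j)" using dspan[of "j + 1" x] j x by simp
      show "differential R (\<gamma>' x) = gen_ext R \<gamma>' (differential A (?g x))"
      proof (cases "x \<in> F j")
        case True
        then show ?thesis using good eq[OF sp] by (simp add: \<gamma>'_def good_def)
      next
        case False
        then show ?thesis using x c[OF x] eq[OF sp] by (simp add: \<gamma>'_def)
      qed
      show "\<pi> i (\<gamma>' x) = f i (?g x)" if "i \<in> I" for i
      proof (cases "x \<in> F j")
        case True
        then show ?thesis using good that by (simp add: \<gamma>'_def good_def)
      next
        case False
        then show ?thesis using x c[OF x] that by (simp add: \<gamma>'_def)
      qed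
    qed (rule \<gamma>'_grd)
    moreover have "\<forall>x\<in>F j. \<gamma>' x = \<gamma> x" by (simp add: \<gamma>'_def)
    ultimately show ?thesis by blast
  qed
  \<comment> \<open>Stage \<open>n\<close> treats \<open>F (n - 1)\<close>, so the construction
    starts at the empty set \<open>F (-1)\<close>, where the zero assignment is good.\<close>
  have "\<exists>\<gamma>. \<forall>n. good (F (int n - 1)) (\<gamma> n) \<and> (\<forall>x\<in>F (int n - 1). \<gamma> (Suc n) x = \<gamma> n x)"
  proof (rule dependent_nat_choice)
    show "\<exists>\<gamma>. good (F (int 0 - 1)) \<gamma>"
      by (intro exI[of _ "\<lambda>x. \<zero>\<^bsub>R\<^esub>"]) (simp add: good_def F0)
    show "\<exists>\<gamma>'. good (F (int (Suc n) - 1)) \<gamma>' \<and> (\<forall>x\<in>F (int n - 1). \<gamma>' x = \<gamma> x)"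
      if "good (F (int n - 1)) \<gamma>" for \<gamma> n
      using step[OF that] by simp
  qed
  then obtain \<gamma> where good: "\<And>n. good (F (int n - 1)) (\<gamma> n)"
    and succ: "\<And>n x. x \<in> F (int n - 1) \<Longrightarrow> \<gamma> (Suc n) x = \<gamma> n x" by blast
  have stable: "\<gamma> m x = \<gamma> n x" if "x \<in> F (int n - 1)" "n \<le> m" for m n x
    using that(2)
  proof (induction m rule: dec_induct)
    case (step m)
    have "x \<in> F (int m - 1)" using Fmono[of "int n - 1" "int m - 1"] step.hyps that(1) by auto
    with step succ show ?case by simp
  qed simp
  \<comment> \<open>The limit takes each generator's value from the first stage at which it occurs;
    by stability any later stage gives the same value.\<close>
  define \<delta> where "\<delta> x = (if x \<in> X then \<gamma> (LEAST n. x \<in> F (int n - 1)) x else \<zero>\<^bsub>R\<^esub>)" for x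
  have \<delta>: "\<delta> x = \<gamma> n x" if x: "x \<in> F (int n - 1)" for n x
  proof -
    let ?l = "LEAST n. x \<in> F (int n - 1)"
    have "?l \<le> n" using x by (rule Least_le)
    moreover have "x \<in> F (int ?l - 1)" using x by (rule LeastI)
    ultimately have "\<gamma> n x = \<gamma> ?l x" by (rule stable[rotated])
    moreover have "x \<in> X" using x FX[of "int n - 1"] by auto
    ultimately show ?thesis unfolding \<delta>_def by presburger
  qed
  have \<delta>_grd: "\<delta> x \<in> grd R (deg x)" for x
    using good by (auto simp: \<delta>_def good_def)
  have "good X \<delta>"
    unfolding good_def
  proof (intro conjI allI ballI)
    fix x assume "x \<in> X"
    then obtain j where j: "j \<ge> -1" "x \<in> F j" using filt by (auto simp: filtration_def)
    with F0 have "j \<noteq> -1" by auto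
    with j obtain n where n: "j = int n" using nonneg_int_cases[of j] by auto
    have x: "x \<in> F (int (Suc n) - 1)" using j n by simp
    have sp: "differential A (?g x) \<in> span (F (int n - 1))" using dspan[of j x] j n by simp
    \<comment> \<open>The boundary of \<open>x\<close> lives one filtration step lower, and there
      \<open>\<delta>\<close> coincides with the assignment of a single stage.\<close>
    have "gen_ext R \<delta> (differential A (?g x)) = gen_ext R (\<gamma> (Suc n)) (differential A (?g x))"
    proof (rule local[OF _ good_closed[OF good] _ _ sp])
      show "\<delta> y = \<gamma> (Suc n) y" if "y \<in> F (int n - 1)" for y
        using \<delta>[OF that] succ[OF that] by simp
    qed (use R.grd_closed[OF \<delta>_grd] FX[of "int n - 1"] in auto)
    then show "differential R (\<delta> x) = gen_ext R \<delta> (differential A (?g x))"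
      using good[of "Suc n"] x \<delta>[OF x] by (simp add: good_def)
    show "\<pi> i (\<delta> x) = f i (?g x)" if "i \<in> I" for i
      using good[of "Suc n"] x \<delta>[OF x] that by (simp add: good_def)
  qed (rule \<delta>_grd)
  define G where "G = restrict (gen_ext R \<delta>) (carrier A)"
  note hom = gen_ext_ring_hom[OF R.ring_axioms good_closed[OF \<open>good X \<delta>\<close>]]
  have "G \<in> dg_hom A R"
    unfolding dg_hom_def
  proof (intro CollectI conjI allI ballI)
    show "G \<in> ring_hom A R"
      by (rule ring_hom_memI)
        (simp_all add: G_def ring_hom_closed[OF hom] ring_hom_mult[OF hom] ring_hom_add[OF hom]
          ring_hom_one[OF hom])
    show "G ` grd A i \<subseteq> grd R i" for i
      using gen_ext_grd[OF R \<delta>_grd] A.grd_closed by (auto simp: G_def)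
    show "G (differential A a) = differential R (G a)" if "a \<in> carrier A" for a
    proof -
      have "differential R (gen_ext R \<delta> a) = gen_ext R \<delta> (differential A a)"
        by (rule gen_ext_differential[OF R \<delta>_grd subset_refl])
          (use \<open>good X \<delta>\<close> that in \<open>auto simp: good_def span_X\<close>)
      with that show ?thesis by (simp add: G_def)
    qed
  qed (simp add: G_def)
  moreover have "\<pi> i (G a) = f i a" if "i \<in> I" "a \<in> carrier A" for i a
    using lift[OF \<open>good X \<delta>\<close> subset_refl _ that(1)] that by (simp add: G_def span_X)
  ultimately show ?thesis by blast
qed

section \<open>Filling horns\<close>

definition word_SHom ::
    "('a, 'm) dg_ring_scheme \<Rightarrow> ('b, 'n) dg_ring_scheme \<Rightarrow> ('a \<Rightarrow> nat list \<Rightarrow> 'b) simp_set" where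
  "word_SHom A B =
    \<lparr>simplices = (\<lambda>q. dg_hom A (word_cochains q B)),
     act = (\<lambda>m n \<theta> f. compose (carrier A) (word_pull B m \<theta>) f)\<rparr>"

lemma dg_hom_ring_hom: "f \<in> dg_hom A B \<Longrightarrow> f \<in> ring_hom A B"
  and dg_hom_grd: "f \<in> dg_hom A B \<Longrightarrow> a \<in> grd A i \<Longrightarrow> f a \<in> grd B i"
  and dg_hom_diff: "f \<in> dg_hom A B \<Longrightarrow> a \<in> carrier A \<Longrightarrow> f (differential A a) = differential B (f a)"
  and dg_hom_extensional: "f \<in> dg_hom A B \<Longrightarrow> f \<in> extensional (carrier A)"
  by (auto simp: dg_hom_def)

lemma dg_hom_closed: "f \<in> dg_hom A B \<Longrightarrow> a \<in> carrier A \<Longrightarrow> f a \<in> carrier B"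
  by (rule ring_hom_closed[OF dg_hom_ring_hom])

lemma dg_hom_compose:
  assumes A: "predg_ring A" and f: "f \<in> dg_hom A B" and g: "g \<in> ring_hom B C"
    and g_grd: "\<And>i b. b \<in> grd B i \<Longrightarrow> g b \<in> grd C i"
    and g_diff: "\<And>b. b \<in> carrier B \<Longrightarrow> g (differential B b) = differential C (g b)"
  shows "compose (carrier A) g f \<in> dg_hom A C"
proof -
  interpret A: predg_ring A by fact
  note f' = dg_hom_ring_hom[OF f]
  show ?thesis
    unfolding dg_hom_def
  proof (intro CollectI conjI allI ballI)
    show "compose (carrier A) g f \<in> ring_hom A C"
      by (rule ring_hom_memI)
        (simp_all add: compose_def ring_hom_closed[OF f'] ring_hom_closed[OF g] ring_hom_mult[OF f']
          ring_hom_mult[OF g] ring_hom_add[OF f'] ring_hom_add[OF g] ring_hom_one[OF f'] ring_hom_one[OF g])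
    show "compose (carrier A) g f ` grd A i \<subseteq> grd C i" for i
      using dg_hom_grd[OF f] g_grd A.grd_closed by (auto simp: compose_def)
    show "compose (carrier A) g f (differential A a) = differential C (compose (carrier A) g f a)"
      if "a \<in> carrier A" for a
      using that A.diff_closed g_diff[OF dg_hom_closed[OF f that]] dg_hom_diff[OF f that]
      by (simp add: compose_def)
  qed simp
qed

section \<open>Simplices of the standard simplex as words\<close>

lemma compose_mono_maps:
  assumes "\<eta> \<in> mono_maps l m" "\<theta> \<in> mono_maps m n"
  shows "compose {..l} \<theta> \<eta> \<in> mono_maps l n"
proof -
  have \<eta>: "\<eta> i \<le> m" if "i \<le> l" for i
    using assms(1) that by (auto simp: mono_maps_def dest: PiE_mem)
  moreover have "\<theta> i \<le> n" if "i \<le> m" for i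
    using assms(2) that by (auto simp: mono_maps_def dest: PiE_mem)
  moreover have "\<theta> (\<eta> i) \<le> \<theta> (\<eta> j)" if "i \<le> j" "j \<le> l" for i j
    using assms that \<eta>[of i] \<eta>[of j] by (auto simp: mono_maps_def intro!: mono_onD[of _ \<theta>] mono_onD[of _ \<eta>])
  ultimately show ?thesis
    by (auto simp: mono_maps_def compose_def intro!: mono_onI)
qed

lemma sorted_adjacent_eq:
  fixes w :: "'a::linorder list"
  assumes "sorted w" "\<not> sorted_wrt (<) w"
  obtains i where "Suc i < length w" "w ! i = w ! Suc i"
proof -
  from assms(2) obtain i where i: "Suc i < length w" "\<not> w ! i < w ! Suc i"
    by (auto simp: sorted_wrt_iff_nth_Suc_transp[OF transp_on_less])
  moreover have "w ! i \<le> w ! Suc i" using assms(1) i(1) by (intro sorted_nth_mono) auto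
  ultimately show thesis using that by force
qed

text \<open>Inverse to listing the vertices by \<open>map x [0..<Suc p]\<close>. A word of length
  \<open>p + 1\<close> is a \<open>p\<close>-simplex; the value at \<open>[]\<close> has no
  meaning.\<close>

definition word_simplex :: "nat list \<Rightarrow> nat \<Rightarrow> nat" where
  "word_simplex w = (\<lambda>i\<in>{..length w - 1}. w ! i)"

lemma word_simplex_mono_maps:
  assumes "sorted w" "set w \<subseteq> {..n}" "w \<noteq> []"
  shows "word_simplex w \<in> mono_maps (length w - 1) n"
proof -
  have lt: "i < length w" if "i \<le> length w - 1" for i using that assms(3) by (cases w) auto
  have "w ! i \<le> w ! j" if "i \<le> j" "j \<le> length w - 1" for i j
    using that lt assms(1) by (intro sorted_nth_mono) auto
  moreover have "w ! i \<le> n" if "i \<le> length w - 1" for i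
  proof -
    have "w ! i \<in> set w" using lt[OF that] by (rule nth_mem)
    with assms(2) have "w ! i \<in> {..n}" by blast
    then show ?thesis by simp
  qed
  ultimately show ?thesis
    by (auto simp: mono_maps_def word_simplex_def intro!: mono_onI)
qed

lemma codegen_mono_maps: "i \<le> n \<Longrightarrow> codegen n i \<in> mono_maps (Suc n) n"
  and coface_mono_maps: "coface n i \<in> mono_maps n (Suc n)"
  by (auto simp: codegen_def coface_def mono_maps_def intro!: mono_onI)

text \<open>The coface skipping \<open>Suc i\<close> is a section of the codegeneracy, and skipping
  that vertex loses nothing when \<open>x\<close> agrees at \<open>i\<close> and
  \<open>Suc i\<close>.\<close>

lemma mono_maps_factor_codegen:
  assumes "x \<in> mono_maps (Suc n) q" "i \<le> n" "x i = x (Suc i)"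
  shows "x = compose {..Suc n} (compose {..n} x (coface n (Suc i))) (codegen n i)"
proof
  fix j show "x j = compose {..Suc n} (compose {..n} x (coface n (Suc i))) (codegen n i) j"
  proof (cases "j \<le> Suc n")
    case True
    consider "j \<le> i" | "j = Suc i" | "j > Suc i" by linarith
    then show ?thesis
      using True assms(2,3) by cases (auto simp: compose_def codegen_def coface_def)
  qed (use assms(1) in \<open>auto simp: compose_def mono_maps_def PiE_def extensional_def\<close>)
qed

lemma simplex_word_mono_maps:
  "\<lbrakk>w \<in> simplex_words n; w \<noteq> []\<rbrakk> \<Longrightarrow> word_simplex w \<in> mono_maps (length w - 1) n"
  by (rule word_simplex_mono_maps) (auto simp: simplex_words_def strict_sorted_imp_sorted)

lemma map_word_simplex: "w \<noteq> [] \<Longrightarrow> map (word_simplex w) [0..<length w] = w"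
  by (rule nth_equalityI) (auto simp: word_simplex_def)

lemma map_word_simplex': "w \<noteq> [] \<Longrightarrow> map (word_simplex w) [0..<Suc (length w - 1)] = w"
  using map_word_simplex[of w] by (cases w) (auto simp del: upt_Suc)

lemma upt_simplex_words: "m \<le> Suc n \<Longrightarrow> [0..<m] \<in> simplex_words n"
  by (auto simp: simplex_words_def)

lemma word_simplex_map:
  assumes "w \<noteq> []"
  shows "word_simplex (map \<theta> w) = compose {..length w - 1} \<theta> (word_simplex w)"
proof
  fix i show "word_simplex (map \<theta> w) i = compose {..length w - 1} \<theta> (word_simplex w) i"
  proof (cases "i \<le> length w - 1")
    case True
    with assms have "i < length w" by (cases w) auto
    with True show ?thesis by (simp add: word_simplex_def compose_def)
  qed (simp add: word_simplex_def compose_def)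
qed

text \<open>A strictly increasing word is determined by its letters, and here these are all of
  \<open>{..n}\<close> or all except \<open>k\<close>. These two words are what the horn
  misses.\<close>

lemma simplex_words_superset:
  assumes w: "w \<in> simplex_words n" and "\<And>i. i \<le> n \<Longrightarrow> i \<noteq> k \<Longrightarrow> i \<in> set w" and "k \<le> n"
  shows "w = [0..<Suc n] \<or> w = [0..<k] @ [Suc k..<Suc n]"
proof -
  have s: "sorted_wrt (<) w" "set w \<subseteq> {..n}" using w by (auto simp: simplex_words_def)
  have eqI: "w = v" if "sorted_wrt (<) v" "set w = set v" for v
    using strict_sorted_equal[OF s(1) that(1)] that(2) by simp
  show ?thesis
  proof (cases "k \<in> set w")
    case True
    then have "{..n} \<subseteq> set w" using assms(2) by (metis atMost_iff subsetI)
    with s(2) have "set w = set [0..<Suc n]" by (auto simp: atMost_upto)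
    then show ?thesis using eqI[of "[0..<Suc n]"] by (simp del: upt_Suc)
  next
    case False
    then have "set w = {..n} - {k}" using s(2) assms(2) by auto
    also have "\<dots> = set ([0..<k] @ [Suc k..<Suc n])" using \<open>k \<le> n\<close> by auto
    finally show ?thesis
      using eqI[of "[0..<k] @ [Suc k..<Suc n]"] by (simp add: sorted_wrt_append del: upt_Suc)
  qed
qed

lemma horn_simplicesI:
  "\<lbrakk>x \<in> mono_maps p n; i \<le> n; i \<noteq> k; i \<notin> x ` {..p}\<rbrakk> \<Longrightarrow> x \<in> simplices (horn n k) p"
  by (auto simp: horn_def)

lemma horn_simplices_mono_maps: "x \<in> simplices (horn n k) p \<Longrightarrow> x \<in> mono_maps p n"
  by (auto simp: horn_def)

lemma horn_act: "act (horn n k) m p \<theta> x = compose {..m} x \<theta>"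
  by (simp add: horn_def std_simplex_def)

context dg_ring
begin

text \<open>The letters being distinct, the only face equal to \<open>v @ v'\<close> is the one
  omitting \<open>a\<close>, which has index \<open>length v\<close>.\<close>

lemma cobd_delta:
  assumes "c \<in> carrier A" "distinct (v @ a # v')"
  shows "cobd A (\<lambda>w. if w = v @ v' then c else \<zero>) (v @ a # v') = [ksign (int (length v))] \<cdot> c"
  using assms(2)
proof (induction v)
  case Nil
  have "cobd A (\<lambda>u. if a # u = v' then c else \<zero>) v' = cobd A (\<lambda>u. \<zero>) v'"
    using Nil by (intro cobd_cong) auto
  then show ?case using assms(1) by (simp add: a_minus_def)
next
  case (Cons b v)
  then have "v @ a # v' \<noteq> b # v @ v'" by (cases v) auto
  with Cons assms(1) show ?case by (simp add: a_minus_def ksign_add ksign_def)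
qed

lemma word_SHom_act_closed:
  assumes "predg_ring R" "\<theta> \<in> mono_maps m n" "f \<in> dg_hom R (word_cochains n A)"
  shows "compose (carrier R) (word_pull A m \<theta>) f \<in> dg_hom R (word_cochains m A)"
  by (rule dg_hom_compose[OF assms(1,3)]) (rule word_pull_hom[OF assms(2)], assumption?)+

end

section \<open>Nondegenerate simplices of the horn\<close>

definition horn_word :: "nat \<Rightarrow> nat \<Rightarrow> nat list \<Rightarrow> bool" where
  "horn_word n k w \<longleftrightarrow> w \<in> simplex_words n \<and> w \<noteq> [] \<and> (\<exists>i\<le>n. i \<noteq> k \<and> i \<notin> set w)"

lemma horn_word_simplex:
  assumes "horn_word n k w"
  shows "word_simplex w \<in> simplices (horn n k) (length w - 1)"
proof -
  obtain i where i: "i \<le> n" "i \<noteq> k" "i \<notin> set w" and w: "w \<in> simplex_words n" "w \<noteq> []"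
    using assms unfolding horn_word_def by blast
  have "i \<notin> word_simplex w ` {..length w - 1}"
  proof
    assume "i \<in> word_simplex w ` {..length w - 1}"
    then obtain j where j: "j \<le> length w - 1" "i = w ! j" by (auto simp: word_simplex_def)
    with w(2) have "j < length w" by (cases w) auto
    then have "w ! j \<in> set w" by (rule nth_mem)
    with i(3) j(2) show False by blast
  qed
  then show ?thesis
    using i simplex_word_mono_maps[OF w] by (intro horn_simplicesI)
qed

lemma horn_word_map:
  assumes "x \<in> simplices (horn n k) p" "w \<in> simplex_words p" "w \<noteq> []" "map x w \<in> simplex_words n"
  shows "horn_word n k (map x w)"
proof -
  obtain i where i: "i \<le> n" "i \<noteq> k" "i \<notin> x ` {..p}" using assms(1) by (auto simp: horn_def)
  have "i \<notin> set (map x w)" using i(3) assms(2) by (auto simp: simplex_words_def)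
  with i assms show ?thesis by (auto simp: horn_word_def)
qed

lemma horn_word_cases:
  assumes "w \<in> simplex_words n" "k \<le> n"
  shows "w = [] \<or> horn_word n k w \<or> w = [0..<Suc n] \<or> w = [0..<k] @ [Suc k..<Suc n]"
  using simplex_words_superset[OF assms(1) _ assms(2)] assms(1) unfolding horn_word_def by blast

lemma horn_word_nontrivial:
  "horn_word n k w \<Longrightarrow> w \<noteq> [0..<Suc n] \<and> w \<noteq> [0..<k] @ [Suc k..<Suc n]"
  by (auto simp: horn_word_def simp del: upt_Suc)

lemma compose_horn:
  assumes \<theta>: "\<theta> \<in> mono_maps m p" and x: "x \<in> simplices (horn n k) p"
  shows "compose {..m} x \<theta> \<in> simplices (horn n k) m"
proof -
  obtain i where i: "i \<le> n" "i \<noteq> k" "i \<notin> x ` {..p}" using x by (auto simp: horn_def)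
  have "compose {..m} x \<theta> ` {..m} \<subseteq> x ` {..p}"
    using \<theta> by (auto simp: compose_def mono_maps_def dest: PiE_mem)
  with i show ?thesis
    using compose_mono_maps[OF \<theta> horn_simplices_mono_maps[OF x]] by (intro horn_simplicesI[of _ _ _ i]) auto
qed

context dg_ring
begin

text \<open>A nondegenerate simplex of the horn is determined by its word; where a simplex of the horn maps
  a word to a degenerate one, naturality forces the family to vanish.\<close>

lemma horn_family_extend:
  assumes F: "\<And>p x. x \<in> simplices (horn n k) p \<Longrightarrow> F p x \<in> grd (word_cochains p A) t"
    and nat: "\<And>m p \<theta> x. \<lbrakk>\<theta> \<in> mono_maps m p; x \<in> simplices (horn n k) p\<rbrakk> \<Longrightarrow>
      F m (compose {..m} x \<theta>) = word_pull A m \<theta> (F p x)"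
  shows "\<exists>y\<in>grd (word_cochains n A) t. \<forall>p. \<forall>x\<in>simplices (horn n k) p. word_pull A p x y = F p x"
proof -
  let ?H = "simplices (horn n k)"
  have Fc: "F p x \<in> carrier (word_cochains p A)" if "x \<in> ?H p" for p x
    using F[OF that] by (rule word_cochains_grd_closed)
  \<comment> \<open>Naturality along the word \<open>w\<close>, read as a monotone map into
    \<open>[p]\<close>, expresses every value of the family by the value of some member at its full
    word.\<close>
  have key: "F p x w = F (length w - 1) (word_simplex (map x w)) [0..<length w]"
    if x: "x \<in> ?H p" and w: "w \<in> simplex_words p" "w \<noteq> []" for p x w
  proof -
    have "[0..<length w] \<in> simplex_words (length w - 1)"
      using w(2) by (intro upt_simplex_words) auto
    then show ?thesis
      using nat[OF simplex_word_mono_maps[OF w] x] map_word_simplex[OF w(2)]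
      by (simp add: word_simplex_map[OF w(2)] word_pull_def)
  qed
  \<comment> \<open>The collapsed simplex factors through a codegeneracy over a smaller simplex
    \<open>z\<close> of the horn. By naturality the value equals one of \<open>F q z\<close> at a
    word with a repetition, which is zero.\<close>
  have degen: "F p x w = \<zero>"
    if x: "x \<in> ?H p" and w: "w \<in> simplex_words p" "w \<noteq> []" and nd: "map x w \<notin> simplex_words n" for p x w
  proof -
    have "sorted (map x w)" "\<not> sorted_wrt (<) (map x w)"
      using map_mem_simplex_words[OF horn_simplices_mono_maps[OF x] w(1)] nd by auto
    then obtain i where i: "Suc i < length w" "x (w ! i) = x (w ! Suc i)"
      using sorted_adjacent_eq[of "map x w"] by auto
    define q where "q = length w - 2"
    have q: "length w = Suc (Suc q)" using i(1) by (simp add: q_def)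
    let ?x' = "word_simplex (map x w)" and ?w = "map (codegen q i) [0..<length w]"
    have x': "?x' \<in> ?H (Suc q)"
      using compose_horn[OF simplex_word_mono_maps[OF w] x] by (simp add: word_simplex_map[OF w(2)] q)
    have s: "codegen q i \<in> mono_maps (Suc q) q" using i(1) q by (intro codegen_mono_maps) simp
    define z where "z = compose {..q} ?x' (coface q (Suc i))"
    have z: "z \<in> ?H q" unfolding z_def by (rule compose_horn[OF coface_mono_maps x'])
    have "?x' i = ?x' (Suc i)" using i q by (simp add: word_simplex_def)
    then have "?x' = compose {..Suc q} z (codegen q i)"
      unfolding z_def using i(1) q
      by (intro mono_maps_factor_codegen[OF horn_simplices_mono_maps[OF x']]) simp_all
    then have "F p x w = word_pull A (Suc q) (codegen q i) (F q z) [0..<length w]"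
      using key[OF x w] nat[OF s z] q by simp
    also have "\<dots> = F q z ?w"
      using q by (simp add: word_pull_def upt_simplex_words del: upt_Suc)
    also have "?w ! i = ?w ! Suc i"
      using i(1) q by (simp add: codegen_def del: upt_Suc)
    then have "\<not> sorted_wrt (<) ?w"
      using sorted_wrt_nth_less[of "(<)" ?w i "Suc i"] i(1) by auto
    then have "F q z ?w = \<zero>"
      using Fc[OF z] unfolding word_cochains_carrier simplex_words_def by blast
    finally show ?thesis .
  qed
  define y where "y w = (if horn_word n k w then F (length w - 1) (word_simplex w) [0..<length w] else \<zero>)" for w
  have "y w \<in> grd A (t + 1 - int (length w))" for w
  proof (cases "horn_word n k w")
    case True
    have "F (length w - 1) (word_simplex w) [0..<length w] \<in> grd A (t + 1 - int (length [0..<length w]))"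
      using F[OF horn_word_simplex[OF True]] unfolding word_cochains_grd by blast
    with True show ?thesis by (simp add: y_def)
  qed (simp add: y_def)
  then have "y \<in> grd (word_cochains n A) t"
    by (auto simp: word_cochains_grd y_def horn_word_def)
  moreover have "word_pull A p x y = F p x" if x: "x \<in> ?H p" for p x
  proof
    fix w
    consider "w \<notin> simplex_words p \<or> w = []" | "w \<in> simplex_words p" "w \<noteq> []" "map x w \<notin> simplex_words n"
      | "w \<in> simplex_words p" "w \<noteq> []" "map x w \<in> simplex_words n" by blast
    then show "word_pull A p x y w = F p x w"
    proof cases
      case 1
      then show ?thesis
        using Fc[OF x] by (auto simp: word_pull_def word_cochains_carrier y_def horn_word_def)
    next
      case 2
      then show ?thesis using degen[OF x] by (simp add: word_pull_def y_def horn_word_def)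
    next
      case 3
      then show ?thesis
        using key[OF x 3(1,2)] horn_word_map[OF x 3] by (simp add: word_pull_def y_def)
    qed
  qed
  ultimately show ?thesis by blast
qed

text \<open>The cochains of the simplex that vanish on the horn are acyclic: they live on the top word and
  on the word omitting \<open>k\<close>. The value on the latter is used to solve the equation at the top word;
  the equation at the omitted face then holds because the defect is a cocycle supported there.\<close>

lemma horn_correction:
  assumes n: "1 \<le> n" and k: "k \<le> n"
    and y0: "y0 \<in> grd (word_cochains n A) t" and r: "r \<in> grd (word_cochains n A) (t + 1)"
    and dr: "differential (word_cochains n A) r = \<zero>\<^bsub>word_cochains n A\<^esub>"
    and eq: "\<And>w. horn_word n k w \<Longrightarrow> cobd A y0 w = r w"
  shows "\<exists>y\<in>grd (word_cochains n A) t. differential (word_cochains n A) y = r \<and>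
    (\<forall>w. horn_word n k w \<longrightarrow> y w = y0 w)"
proof -
  let ?W = "word_cochains n A"
  interpret W: predg_ring ?W by (rule predg_ring_word_cochains)
  define T where "T = [0..<Suc n]"
  define T' where "T' = [0..<k] @ [Suc k..<Suc n]"
  have T_split: "T = [0..<k] @ k # [Suc k..<Suc n]"
    using k upt_add_eq_append[of 0 k "Suc n - k"] by (simp add: T_def upt_conv_Cons)
  have T: "T \<in> simplex_words n" "length T = Suc n" "distinct T"
    by (auto simp: T_def upt_simplex_words simp del: upt_Suc)
  have "subseq T' T" unfolding T'_def T_split by (intro list_emb_append_mono) auto
  then have T': "T' \<in> simplex_words n" using T(1) by (rule simplex_words_subseq)
  have T'_len: "length T' = n" using k by (simp add: T'_def)
  have rc: "r \<in> carrier ?W" using r by (rule word_cochains_grd_closed)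
  have y0_grd: "y0 w \<in> grd A (t + 1 - int (length w))" for w using y0 by (simp add: word_cochains_grd)
  have y0c: "y0 w \<in> carrier A" for w using y0_grd by (rule grd_closed)
  have rv: "r w \<in> carrier A" for w using rc by (simp add: word_cochains_carrier)
  have y0d: "cobd A y0 T \<in> carrier A" by (intro cobd_closed y0c)
  \<comment> \<open>Placing \<open>c\<close> on \<open>T'\<close> changes the coboundary at
    \<open>T\<close> by \<open>(-1)^k\<close> times \<open>c\<close>, as \<open>T'\<close> is the
    \<open>k\<close>-th face of \<open>T\<close>. So \<open>c\<close> is the defect at
    \<open>T\<close> with that sign undone.\<close>
  define c where "c = [ksign (int k)] \<cdot> (r T \<ominus> cobd A y0 T)"
  have c_grd: "c \<in> grd A (t + 1 - int n)"
  proof -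
    have "r T \<in> grd A (t + 1 + 1 - int (length T))" using r unfolding word_cochains_grd by blast
    moreover have "cobd A y0 T \<in> grd A (t + 2 - int (length T))" by (rule cobd_grd) (rule y0_grd)
    moreover have "t + 1 + 1 - int (length T) = t + 1 - int n" "t + 2 - int (length T) = t + 1 - int n"
      by (simp_all add: T(2))
    ultimately show ?thesis unfolding c_def by (intro zmul_grd diff_mem_grd) (simp_all only:)
  qed
  have cc: "c \<in> carrier A" using c_grd by (rule grd_closed)
  define \<delta> where "\<delta> c w = (if w = T' then c else \<zero>)" for c w
  have \<delta>c: "\<delta> c w \<in> carrier A" if "c \<in> carrier A" for c w using that by (simp add: \<delta>_def)
  have cobd_\<delta>: "cobd A (\<delta> c) T = [ksign (int k)] \<cdot> c" if "c \<in> carrier A" for c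
    using cobd_delta[OF that, of "[0..<k]" k "[Suc k..<Suc n]"] T(3)
    unfolding \<delta>_def T'_def T_split by simp
  define y where "y = (\<lambda>w. y0 w \<oplus> \<delta> c w)"
  have y_horn: "y w = y0 w" if "horn_word n k w" for w
    using horn_word_nontrivial[OF that] y0c[of w] by (simp add: y_def \<delta>_def T'_def del: upt_Suc)
  have "y w \<in> grd A (t + 1 - int (length w))" for w
    unfolding y_def using y0_grd c_grd T'_len by (intro add_grd) (auto simp: \<delta>_def)
  moreover have "y w = \<zero>" if "w \<notin> simplex_words n \<or> w = []" for w
  proof -
    \<comment> \<open>Here \<open>1 \<le> n\<close> enters: it keeps \<open>T'\<close> nonempty, and
      cochains must vanish at the empty word.\<close>
    have "w \<noteq> T'" using that T' T'_len n by auto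
    moreover have "y0 w = \<zero>" using that y0 unfolding word_cochains_grd by blast
    ultimately show ?thesis by (simp add: y_def \<delta>_def)
  qed
  ultimately have y_grd: "y \<in> grd ?W t" by (simp add: word_cochains_grd)
  have yc: "y \<in> carrier ?W" using y_grd by (rule word_cochains_grd_closed)
  have d_horn: "differential ?W y w = r w" if w: "horn_word n k w" for w
  proof -
    \<comment> \<open>A nonempty face of a horn word misses the same vertex, so the correction is
      not seen by coboundaries on the horn.\<close>
    have "y u = y0 u" if u: "subseq u w" for u
    proof (cases "u = []")
      case True
      then show ?thesis using yc y0 by (simp add: word_cochains_carrier word_cochains_grd)
    next
      case False
      then have "horn_word n k u"
        using w simplex_words_subseq[OF u] list_emb_set[OF u] unfolding horn_word_def by metis
      then show ?thesis by (rule y_horn)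
    qed
    then have "cobd A y w = cobd A y0 w" by (rule cobd_cong)
    with w eq[OF w] show ?thesis by (simp add: horn_word_def)
  qed
  have dT: "differential ?W y T = r T"
  proof -
    have "cobd A y T = cobd A y0 T \<oplus> [ksign (int k)] \<cdot> c"
      unfolding y_def using cobd_add[of y0 "\<delta> c" T, OF y0c \<delta>c[OF cc]] cobd_\<delta>[OF cc] by simp
    also have "[ksign (int k)] \<cdot> c = r T \<ominus> cobd A y0 T"
      unfolding c_def using rv y0d by (simp add: zmul_zmul)
    also have "cobd A y0 T \<oplus> (r T \<ominus> cobd A y0 T) = r T"
      using minus_eq_iff[OF rv[of T] y0d, of "r T \<ominus> cobd A y0 T"] rv[of T] y0d by (simp add: a_comm)
    finally show ?thesis using T(1) by simp
  qed
  \<comment> \<open>The remaining defect: it vanishes on the horn and at \<open>T\<close>, so it can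
    live only on \<open>T'\<close>, where its value is read off from the cocycle condition evaluated
    at \<open>T\<close>.\<close>
  define e where "e = differential ?W y \<ominus>\<^bsub>?W\<^esub> r"
  have dyc: "differential ?W y \<in> carrier ?W" using yc by (rule W.diff_closed)
  have ec: "e \<in> carrier ?W" unfolding e_def using dyc rc by (rule W.minus_closed)
  have dy: "differential ?W y = e \<oplus>\<^bsub>?W\<^esub> r"
    using W.minus_eq_iff[OF dyc rc ec] unfolding e_def by blast
  have ev: "e w \<in> carrier A" for w using ec by (simp add: word_cochains_carrier)
  have e_zero: "e w = \<zero>" if "differential ?W y w = r w" for w
  proof -
    have "e w \<oplus> r w = r w" using fun_cong[OF dy, of w] that by simp
    then show ?thesis using add.r_cancel_one[OF rv ev] by blast
  qed
  have e_delta: "e = \<delta> (e T')"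
  proof
    fix w
    have "e w = \<zero>" if "w \<noteq> T'"
    proof (cases "w \<in> simplex_words n \<and> w \<noteq> []")
      case True
      with that horn_word_cases[of w n k] k e_zero[OF d_horn, of w] e_zero[OF dT] show ?thesis
        unfolding T_def T'_def by blast
    next
      case False
      with ec show ?thesis unfolding word_cochains_carrier by blast
    qed
    then show "e w = \<delta> (e T') w" by (simp add: \<delta>_def)
  qed
  have "differential ?W e = \<zero>\<^bsub>?W\<^esub>"
    unfolding e_def W.diff_diff_distrib[OF dyc rc] W.diff_diff[OF yc] dr
    by (simp only: W.minus_eq W.r_neg W.zero_closed)
  from fun_cong[OF this, of T] have "cobd A e T = \<zero>" using T(1) by simp
  moreover have "cobd A e T = cobd A (\<delta> (e T')) T"
    using e_delta by (rule arg_cong[of _ _ "\<lambda>P. cobd A P T"])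
  ultimately have "[ksign (int k)] \<cdot> e T' = \<zero>"
    using cobd_\<delta>[OF ev] by simp
  then have "[ksign (int k)] \<cdot> ([ksign (int k)] \<cdot> e T') = \<zero>" by simp
  then have "e T' = \<zero>" using ev by (simp add: zmul_zmul)
  then have "e w = \<zero>" for w
    using fun_cong[OF e_delta, of w] by (simp add: \<delta>_def)
  then have "differential ?W y = r" using dy rv by (auto simp del: word_cochains_sel(5))
  with y_grd y_horn show ?thesis by blast
qed

text \<open>The family is first extended by zero off the horn, then corrected there. Pullbacks to
  simplices of the horn read only horn words, so the correction leaves them unchanged.\<close>

lemma horn_cochain_lift:
  assumes n: "1 \<le> n" and k: "k \<le> n"
    and F: "\<And>p x. x \<in> simplices (horn n k) p \<Longrightarrow> F p x \<in> grd (word_cochains p A) t"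
    and nat: "\<And>m p \<theta> x. \<lbrakk>\<theta> \<in> mono_maps m p; x \<in> simplices (horn n k) p\<rbrakk> \<Longrightarrow>
      F m (compose {..m} x \<theta>) = word_pull A m \<theta> (F p x)"
    and r: "r \<in> grd (word_cochains n A) (t + 1)"
    and dr: "differential (word_cochains n A) r = \<zero>\<^bsub>word_cochains n A\<^esub>"
    and rF: "\<And>p x. x \<in> simplices (horn n k) p \<Longrightarrow>
      word_pull A p x r = differential (word_cochains p A) (F p x)"
  shows "\<exists>y\<in>grd (word_cochains n A) t. differential (word_cochains n A) y = r \<and>
    (\<forall>p. \<forall>x\<in>simplices (horn n k) p. word_pull A p x y = F p x)"
proof -
  let ?W = "\<lambda>n. word_cochains n A" and ?H = "simplices (horn n k)"
  obtain y0 where y0: "y0 \<in> grd (?W n) t" and pull: "\<And>p x. x \<in> ?H p \<Longrightarrow> word_pull A p x y0 = F p x"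
    using horn_family_extend[of n k F t, OF F nat] by blast
  have "cobd A y0 w = r w" if w: "horn_word n k w" for w
  proof -
    let ?p = "length w - 1" and ?x = "word_simplex w"
    note x = horn_word_simplex[OF w]
    have w0: "w \<noteq> []" "w \<in> simplex_words n" using w by (auto simp: horn_word_def)
    \<comment> \<open>Pulling back along the simplex of \<open>w\<close> and evaluating at its full
      word gives evaluation at \<open>w\<close>; the equation thus descends from the one assumed on
      that simplex.\<close>
    have "word_pull A ?p ?x (differential (?W n) y0) = word_pull A ?p ?x r"
      unfolding word_pull_hom(3)[OF horn_simplices_mono_maps[OF x] word_cochains_grd_closed[OF y0]]
        pull[OF x] rF[OF x] ..
    then have "word_pull A ?p ?x (differential (?W n) y0) [0..<length w] = word_pull A ?p ?x r [0..<length w]"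
      by (rule fun_cong)
    moreover have "[0..<length w] \<in> simplex_words ?p" using w0 by (intro upt_simplex_words) auto
    ultimately have "differential (?W n) y0 w = r w"
      unfolding word_pull_def by (simp only: if_True map_word_simplex[OF w0(1)])
    with w0(2) show ?thesis by simp
  qed
  from horn_correction[OF n k y0 r dr this] obtain y where y: "y \<in> grd (?W n) t" "differential (?W n) y = r"
    and eq: "\<And>w. horn_word n k w \<Longrightarrow> y w = y0 w" by blast
  have zero: "y w = \<zero> \<and> y0 w = \<zero>" if "w \<notin> simplex_words n \<or> w = []" for w
    using y(1) y0 that unfolding word_cochains_grd by blast
  have "word_pull A p x y w = word_pull A p x y0 w" if "x \<in> ?H p" for p x w
  proof (cases "map x w \<in> simplex_words n \<and> w \<noteq> []")
    case True
    then show ?thesis using eq[OF horn_word_map[OF that, of w]] by (simp add: word_pull_def)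
  next
    case False
    then have "map x w \<notin> simplex_words n \<or> map x w = []" by simp
    from zero[OF this] show ?thesis by (simp add: word_pull_def)
  qed
  then have "word_pull A p x y = F p x" if "x \<in> ?H p" for p x
    using pull[OF that] that by auto
  with y show ?thesis by blast
qed

end

text \<open>\<open>semi_free_lift\<close> is applied with the set of all simplices of the horn as
  index set and the pullbacks along them as the maps to be lifted through; its extension hypothesis
  is \<open>horn_cochain_lift\<close>.\<close>

lemma word_SHom_kan_complex:
  fixes A :: "('a, 'm) dg_ring_scheme" and B :: "('b, 'n) dg_ring_scheme"
  assumes A: "dg_ring A" and sf: "semi_free TYPE('x) A" and B: "dg_ring B"
  shows "kan_complex (word_SHom A B)"
proof -
  interpret A: dg_ring A by fact
  interpret B: dg_ring B by fact
  let ?W = "\<lambda>q. word_cochains q B"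
  have sel: "simplices (word_SHom A B) q = dg_hom A (?W q)"
    "act (word_SHom A B) m n \<theta> f = compose (carrier A) (word_pull B m \<theta>) f" for q m n \<theta> f
    by (simp_all add: word_SHom_def)
  note act_closed = B.word_SHom_act_closed[OF A.pre.predg_ring_axioms]
  have act_comp: "compose (carrier A) (word_pull B l (compose {..l} \<theta> \<eta>)) f =
      compose (carrier A) (word_pull B l \<eta>) (compose (carrier A) (word_pull B m \<theta>) f)"
    if "\<eta> \<in> mono_maps l m" "\<theta> \<in> mono_maps m n" "f \<in> dg_hom A (?W n)" for l m n \<eta> \<theta> f
    using B.word_pull_comp[OF that(1,2) dg_hom_closed[OF that(3)]] by (auto simp: compose_def)
  show ?thesis
  proof
    show "act (word_SHom A B) m n \<theta> x \<in> simplices (word_SHom A B) m"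
      if "\<theta> \<in> mono_maps m n" "x \<in> simplices (word_SHom A B) n" for \<theta> m n x
      using act_closed that by (simp add: sel)
    show "act (word_SHom A B) n n (\<lambda>i\<in>{..n}. i) x = x" if "x \<in> simplices (word_SHom A B) n" for n x
    proof
      fix a show "act (word_SHom A B) n n (\<lambda>i\<in>{..n}. i) x a = x a"
        using that B.word_pull_id[OF dg_hom_closed, of x A n a] dg_hom_extensional[of x A "?W n"]
        by (auto simp: sel compose_def extensional_def)
    qed
    show "act (word_SHom A B) l n (compose {..l} \<theta> \<eta>) x =
        act (word_SHom A B) l m \<eta> (act (word_SHom A B) m n \<theta> x)"
      if "\<eta> \<in> mono_maps l m" "\<theta> \<in> mono_maps m n" "x \<in> simplices (word_SHom A B) n" for \<eta> l m \<theta> n x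
      using act_comp that by (simp add: sel)
  next
    fix n k f
    assume n: "1 \<le> (n::nat)" and k: "k \<le> n" and f_map: "simplicial_map (horn n k) (word_SHom A B) f"
    let ?H = "simplices (horn n k)"
    have f: "f p x \<in> dg_hom A (?W p)" if "x \<in> ?H p" for p x
      using f_map that by (auto simp: simplicial_map_def sel)
    have f_nat: "f m (compose {..m} x \<theta>) a = word_pull B m \<theta> (f p x a)"
      if "\<theta> \<in> mono_maps m p" "x \<in> ?H p" "a \<in> carrier A" for m p \<theta> x a
      using f_map that by (auto simp: simplicial_map_def sel horn_act compose_def)
    let ?I = "{(p, x). x \<in> ?H p}"
    have "\<exists>g\<in>dg_hom A (?W n). \<forall>i\<in>?I. \<forall>a\<in>carrier A.
        (case i of (p, x) \<Rightarrow> word_pull B p x) (g a) = (case i of (p, x) \<Rightarrow> f p x) a"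
    proof (rule semi_free_lift[OF A sf B.predg_ring_word_cochains,
          where S = "\<lambda>i. case i of (p, x) \<Rightarrow> ?W p"])
      fix t a r
      assume a: "a \<in> grd A t" and r: "r \<in> grd (?W n) (t + 1)"
        and dr: "differential (?W n) r = \<zero>\<^bsub>?W n\<^esub>"
        and H: "\<And>i. i \<in> ?I \<Longrightarrow> (case i of (p, x) \<Rightarrow> word_pull B p x) r =
            (case i of (p, x) \<Rightarrow> f p x) (differential A a)"
      have ac: "a \<in> carrier A" using a by (rule A.grd_closed)
      have "\<exists>y\<in>grd (?W n) t. differential (?W n) y = r \<and> (\<forall>p. \<forall>x\<in>?H p. word_pull B p x y = f p x a)"
      proof (rule B.horn_cochain_lift[OF n k dg_hom_grd[OF f a] f_nat[OF _ _ ac] r dr])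
        show "word_pull B p x r = differential (?W p) (f p x a)" if "x \<in> ?H p" for p x
          using H[of "(p, x)"] dg_hom_diff[OF f[OF that] ac] that by simp
      qed
      then show "\<exists>y\<in>grd (?W n) t. differential (?W n) y = r \<and>
          (\<forall>i\<in>?I. (case i of (p, x) \<Rightarrow> word_pull B p x) y = (case i of (p, x) \<Rightarrow> f p x) a)"
        by auto
    qed (auto simp: B.ring_word_cochains B.word_pull_hom(1) horn_simplices_mono_maps dg_hom_ring_hom f)
    then obtain g where g: "g \<in> dg_hom A (?W n)"
      and g_horn: "\<And>p x a. x \<in> ?H p \<Longrightarrow> a \<in> carrier A \<Longrightarrow> word_pull B p x (g a) = f p x a" by fastforce
    \<comment> \<open>By the Yoneda correspondence the \<open>n\<close>-simplex \<open>g\<close>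
      determines a map from the standard simplex, sending \<open>x\<close> to the pullback of
      \<open>g\<close> along \<open>x\<close>.\<close>
    let ?G = "\<lambda>p x. compose (carrier A) (word_pull B p x) g"
    have "simplicial_map (std_simplex n) (word_SHom A B) ?G"
      unfolding simplicial_map_def
    proof (intro conjI allI ballI)
      show "?G p \<in> simplices (std_simplex n) p \<rightarrow> simplices (word_SHom A B) p" for p
        using act_closed g by (auto simp: sel std_simplex_def)
      show "?G m (act (std_simplex n) m p \<theta> x) = act (word_SHom A B) m p \<theta> (?G p x)"
        if "\<theta> \<in> mono_maps m p" "x \<in> simplices (std_simplex n) p" for m p \<theta> x
        using act_comp[OF that(1) _ g] that(2) by (simp add: sel std_simplex_def)
    qed
    moreover have "?G p x = f p x" if "x \<in> ?H p" for p x
    proof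
      fix a show "?G p x a = f p x a"
        using g_horn[OF that] dg_hom_extensional[OF f[OF that]] by (auto simp: compose_def extensional_def)
    qed
    ultimately show "\<exists>g. simplicial_map (std_simplex n) (word_SHom A B) g \<and>
        (\<forall>p. \<forall>x\<in>simplices (horn n k) p. g p x = f p x)"
      by blast
  qed
qed

section \<open>Normalized cochains of a simplex as functions on words\<close>

text \<open>The integral parts of \<open>cup\<close> and \<open>cobd\<close>, without Koszul twist
  and without the differential of \<open>B\<close>, unrolled along the first letter in the same way
  so that the two can be compared by induction.\<close>

fun int_cup :: "('v list \<Rightarrow> int) \<Rightarrow> ('v list \<Rightarrow> int) \<Rightarrow> 'v list \<Rightarrow> int" where
  "int_cup f g [] = 0"
| "int_cup f g (a # w) = f [a] * g (a # w) + int_cup (\<lambda>u. f (a # u)) g w"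

fun int_cobd :: "('v list \<Rightarrow> int) \<Rightarrow> 'v list \<Rightarrow> int" where
  "int_cobd f [] = 0"
| "int_cobd f (a # w) = f w - int_cobd (\<lambda>u. f (a # u)) w"

text \<open>The closed forms correspond to the sums in \<open>cochains\<close>, just as the
  recursions correspond to \<open>cup\<close> and \<open>cobd\<close>.\<close>

lemma int_cup_sum: "int_cup f g w = (\<Sum>p<length w. f (take (Suc p) w) * g (drop p w))"
  by (induction w arbitrary: f) (simp_all add: sum.lessThan_Suc_shift del: sum.lessThan_Suc)

lemma int_cobd_sum: "int_cobd f w = (\<Sum>i<length w. (-1) ^ i * f (take i w @ drop (Suc i) w))"
  by (induction w arbitrary: f)
    (simp_all add: sum.lessThan_Suc_shift sum_negf del: sum.lessThan_Suc)

lemma int_cobd_zero: "(\<And>u. f u = 0) \<Longrightarrow> int_cobd f w = 0"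
  by (induction w arbitrary: f) auto

text \<open>Of two equal neighbouring letters at positions \<open>i\<close> and
  \<open>Suc i\<close>, both lie in the front face if \<open>i < p\<close> and both in the back face
  otherwise, so one factor always vanishes.\<close>

lemma int_cup_degenerate:
  assumes "\<And>w. \<not> sorted_wrt (<) w \<Longrightarrow> f w = 0" "\<And>w. \<not> sorted_wrt (<) w \<Longrightarrow> g w = 0"
    and "sorted w" "\<not> sorted_wrt (<) (w :: nat list)"
  shows "int_cup f g w = 0"
proof -
  obtain i where i: "Suc i < length w" "w ! i = w ! Suc i"
    using sorted_adjacent_eq[OF assms(3,4)] .
  have "f (take (Suc p) w) * g (drop p w) = 0" for p
  proof (cases "i < p")
    case True
    then have "\<not> sorted_wrt (<) (take (Suc p) w)"
      using i sorted_wrt_nth_less[of "(<)" "take (Suc p) w" i "Suc i"] by auto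
    then show ?thesis using assms(1) by simp
  next
    case False
    then have "i - p < Suc i - p" "Suc i - p < length (drop p w)" using i(1) by auto
    with False i have "\<not> sorted_wrt (<) (drop p w)"
      using sorted_wrt_nth_less[of "(<)" "drop p w" "i - p" "Suc i - p"] by auto
    then show ?thesis using assms(2) by simp
  qed
  then show ?thesis unfolding int_cup_sum by (intro sum.neutral) blast
qed

lemma int_cobd_degenerate:
  assumes "\<And>w. \<not> sorted_wrt (<) w \<Longrightarrow> f w = 0"
    and "sorted w" "\<not> sorted_wrt (<) (w :: nat list)"
  shows "int_cobd f w = 0"
  using assms
proof (induction w arbitrary: f)
  case (Cons a w)
  from Cons.prems(3) obtain b m where w [simp]: "w = b # m" by (cases w) auto
  show ?case
  proof (cases "a = b")
    case True
    have "int_cobd (\<lambda>u. f (a # a # u)) m = 0"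
      by (rule int_cobd_zero) (simp add: Cons.prems(1))
    with True show ?thesis by simp
  next
    case False
    with Cons.prems(2,3) have nw: "\<not> sorted_wrt (<) w" by force
    have "int_cobd (\<lambda>u. f (a # u)) w = 0"
      by (rule Cons.IH) (use Cons.prems(1,2) nw in auto)
    then show ?thesis using Cons.prems(1)[OF nw] by (simp del: w)
  qed
qed simp

text \<open>The empty word is no simplex; the value zero there agrees with the condition in
  \<open>word_cochains\<close>.\<close>

definition cochain_val :: "(nat \<Rightarrow> (nat \<Rightarrow> nat) \<Rightarrow> int) \<Rightarrow> nat list \<Rightarrow> int" where
  "cochain_val \<phi> w = (if w = [] then 0 else \<phi> (length w - 1) (word_simplex w))"

definition word_cochain :: "nat \<Rightarrow> (nat list \<Rightarrow> int) \<Rightarrow> nat \<Rightarrow> (nat \<Rightarrow> nat) \<Rightarrow> int" where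
  "word_cochain q g p x = (if x \<in> mono_maps p q then g (map x [0..<Suc p]) else 0)"

lemma std_simplex_sel [simp]:
  "simplices (std_simplex q) p = mono_maps p q"
  "act (std_simplex q) m n \<theta> x = compose {..m} x \<theta>"
  by (simp_all add: std_simplex_def)

lemma word_simplex_map_upt: "x \<in> mono_maps p q \<Longrightarrow> word_simplex (map x [0..<Suc p]) = x"
  by (rule ext) (auto simp: word_simplex_def mono_maps_def PiE_def extensional_def simp del: upt_Suc)

lemma mono_maps_word: 
  assumes "x \<in> mono_maps p q"
  shows "sorted (map x [0..<Suc p])" "set (map x [0..<Suc p]) \<subseteq> {..q}"
proof -
  show "sorted (map x [0..<Suc p])"
    by (rule map_mem_simplex_words(1)[OF assms]) (simp add: upt_simplex_words del: upt_Suc)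
  show "set (map x [0..<Suc p]) \<subseteq> {..q}"
    by (rule map_mem_simplex_words(2)[OF assms]) (simp add: upt_simplex_words del: upt_Suc)
qed

lemma word_simplex_mono_maps_iff:
  assumes "w \<noteq> []"
  shows "word_simplex w \<in> mono_maps (length w - 1) n \<longleftrightarrow> sorted w \<and> set w \<subseteq> {..n}"
proof
  assume x: "word_simplex w \<in> mono_maps (length w - 1) n"
  from mono_maps_word[OF x] map_word_simplex'[OF assms] show "sorted w \<and> set w \<subseteq> {..n}" by (simp only: simp_thms)
qed (use word_simplex_mono_maps assms in blast)

lemma degenerate_std_simplex_iff:
  assumes x: "x \<in> mono_maps p q"
  shows "x \<in> degenerate (std_simplex q) p \<longleftrightarrow> \<not> sorted_wrt (<) (map x [0..<Suc p])"
proof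
  assume "x \<in> degenerate (std_simplex q) p"
  then obtain n i y where n: "p = Suc n" "i \<le> n" and "x = compose {..Suc n} y (codegen n i)"
    by (auto simp: degenerate_def)
  then have "x i = x (Suc i)" by (simp add: compose_def codegen_def)
  then show "\<not> sorted_wrt (<) (map x [0..<Suc p])"
    using sorted_wrt_nth_less[of "(<)" "map x [0..<Suc p]" i "Suc i"] n by (auto simp del: upt_Suc)
next
  assume "\<not> sorted_wrt (<) (map x [0..<Suc p])"
  with mono_maps_word(1)[OF x] obtain i where
    "Suc i < length (map x [0..<Suc p])" "map x [0..<Suc p] ! i = map x [0..<Suc p] ! Suc i"
    using sorted_adjacent_eq by blast
  then have i: "Suc i < Suc p" "x i = x (Suc i)" by (auto simp del: upt_Suc)
  then obtain n where n: "p = Suc n" "i \<le> n" by (cases p) auto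
  let ?y = "compose {..n} x (coface n (Suc i))"
  have "?y \<in> mono_maps n q" using compose_mono_maps[OF coface_mono_maps] x n by simp
  moreover have "x = act (std_simplex q) (Suc n) n (codegen n i) ?y"
    using mono_maps_factor_codegen[of x n q i] x i n by simp
  ultimately show "x \<in> degenerate (std_simplex q) p"
    using n unfolding degenerate_def by (auto intro!: exI[of _ n] exI[of _ i] exI[of _ ?y])
qed

lemma cochain_val_word_simplex:
  "x \<in> mono_maps p q \<Longrightarrow> cochain_val \<phi> (map x [0..<Suc p]) = \<phi> p x"
  by (simp add: cochain_val_def word_simplex_map_upt del: upt_Suc)

lemma cochain_val_eq_zero:
  assumes "\<phi> \<in> cochain_carrier (std_simplex q)" "w \<notin> simplex_words q"
  shows "cochain_val \<phi> w = 0"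
proof (cases "w = []")
  case False
  note w = map_word_simplex'[OF False]
  have "word_simplex w \<notin> mono_maps (length w - 1) q \<or> word_simplex w \<in> degenerate (std_simplex q) (length w - 1)"
    using degenerate_std_simplex_iff[of "word_simplex w" "length w - 1" q] assms(2)
      word_simplex_mono_maps_iff[OF False, of q] unfolding w simplex_words_def by blast
  with assms(1) False show ?thesis by (auto simp: cochain_val_def cochain_carrier_def)
qed (simp add: cochain_val_def)

lemma cochain_val_Nil [simp]: "cochain_val \<phi> [] = 0"
  by (simp add: cochain_val_def)

lemma simplex_words_length:
  assumes "w \<in> simplex_words q"
  shows "length w \<le> Suc q"
proof -
  have "distinct w" "set w \<subseteq> {..q}" using assms by (auto simp: simplex_words_def strict_sorted_iff)
  then have "card (set w) \<le> card {..q}" by (intro card_mono) auto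
  with \<open>distinct w\<close> show ?thesis by (simp add: distinct_card)
qed

text \<open>Finite support comes for free: a strictly increasing word in \<open>0, ..., q\<close>
  has at most \<open>q + 1\<close> letters.\<close>

lemma cochain_carrierI:
  assumes "\<And>p x. x \<notin> mono_maps p q \<Longrightarrow> \<phi> p x = 0"
    and "\<And>w. \<lbrakk>w \<noteq> []; sorted w; set w \<subseteq> {..q}; \<not> sorted_wrt (<) w\<rbrakk> \<Longrightarrow> cochain_val \<phi> w = 0"
  shows "\<phi> \<in> cochain_carrier (std_simplex q)"
proof -
  have deg: "\<phi> p x = 0" if "x \<in> mono_maps p q" "\<not> sorted_wrt (<) (map x [0..<Suc p])" for p x
    using assms(2)[of "map x [0..<Suc p]"] mono_maps_word[OF that(1)] that
      cochain_val_word_simplex[OF that(1), of \<phi>] by (simp del: upt_Suc)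
  have "p \<le> q" if "\<phi> p x \<noteq> 0" for p x
  proof -
    have x: "x \<in> mono_maps p q" using that assms(1) by blast
    then have "map x [0..<Suc p] \<in> simplex_words q"
      using that deg mono_maps_word(2)[OF x] unfolding simplex_words_def by blast
    from simplex_words_length[OF this] show ?thesis by simp
  qed
  then have "{p. \<exists>x. \<phi> p x \<noteq> 0} \<subseteq> {..q}" by blast
  then have "finite {p. \<exists>x. \<phi> p x \<noteq> 0}" by (rule finite_subset) simp
  moreover have "\<phi> p x = 0" if "x \<in> degenerate (std_simplex q) p" for p x
    using that degenerate_std_simplex_iff[of x p q] deg[of x p] assms(1)[of x p] by blast
  ultimately show ?thesis using assms(1) by (auto simp: cochain_carrier_def)
qed

lemma word_cochain_carrier:
  assumes "\<And>w. w \<notin> simplex_words q \<Longrightarrow> g w = 0"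
  shows "word_cochain q g \<in> cochain_carrier (std_simplex q)"
proof (rule cochain_carrierI)
  fix w :: "nat list"
  assume w: "w \<noteq> []" "sorted w" "set w \<subseteq> {..q}" "\<not> sorted_wrt (<) w"
  have "g w = 0" using w(4) assms by (simp add: simplex_words_def)
  then show "cochain_val (word_cochain q g) w = 0"
    by (simp add: cochain_val_def word_cochain_def map_word_simplex del: upt_Suc)
qed (simp add: word_cochain_def)

lemma cochain_val_word_cochain:
  assumes "\<And>w. w \<notin> simplex_words q \<Longrightarrow> g w = 0" "g [] = 0"
  shows "cochain_val (word_cochain q g) w = g w"
proof (cases "w = []")
  case False
  with map_word_simplex'[OF False] show ?thesis
    using assms(1)[of w] word_simplex_mono_maps_iff[OF False, of q]
    by (auto simp: cochain_val_def word_cochain_def simplex_words_def strict_sorted_imp_sorted simp del: upt_Suc)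
qed (simp add: assms)

lemma cochain_eqI:
  assumes "\<phi> \<in> cochain_carrier (std_simplex q)" "\<psi> \<in> cochain_carrier (std_simplex q)"
    and "\<And>w. w \<in> simplex_words q \<Longrightarrow> w \<noteq> [] \<Longrightarrow> cochain_val \<phi> w = cochain_val \<psi> w"
  shows "\<phi> = \<psi>"
proof (intro ext)
  fix p x
  have eq: "cochain_val \<phi> w = cochain_val \<psi> w" for w
    using assms(3)[of w] cochain_val_eq_zero[OF assms(1), of w] cochain_val_eq_zero[OF assms(2), of w]
    by (cases "w = []"; cases "w \<in> simplex_words q") auto
  show "\<phi> p x = \<psi> p x"
  proof (cases "x \<in> mono_maps p q")
    case True
    then show ?thesis using eq[of "map x [0..<Suc p]"] by (simp only: cochain_val_word_simplex)
  next
    case False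
    then show ?thesis using assms(1,2) by (simp add: cochain_carrier_def)
  qed
qed

section \<open>Operations on normalized cochains in terms of values at words\<close>

lemma cochains_sel [simp]:
  "carrier (cochains X) = cochain_carrier X"
  "\<zero>\<^bsub>cochains X\<^esub> = (\<lambda>n x. 0)"
  "\<phi> \<oplus>\<^bsub>cochains X\<^esub> \<psi> = (\<lambda>n x. \<phi> n x + \<psi> n x)"
  "\<one>\<^bsub>cochains X\<^esub> = (\<lambda>n x. if n = 0 \<and> x \<in> simplices X 0 then 1 else 0)"
  "grd (cochains X) i = {\<phi> \<in> cochain_carrier X. \<forall>p x. int p \<noteq> i \<longrightarrow> \<phi> p x = 0}"
  by (simp_all add: cochains_def)

lemma cochain_carrier_zero [simp]: "(\<lambda>n x. 0) \<in> cochain_carrier X"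
  by (simp add: cochain_carrier_def)

lemma cochain_carrier_add:
  assumes "\<phi> \<in> cochain_carrier X" "\<psi> \<in> cochain_carrier X"
  shows "(\<lambda>n x. \<phi> n x + \<psi> n x) \<in> cochain_carrier X"
proof -
  have "{p. \<exists>x. \<phi> p x + \<psi> p x \<noteq> 0} \<subseteq> {p. \<exists>x. \<phi> p x \<noteq> 0} \<union> {p. \<exists>x. \<psi> p x \<noteq> 0}"
    by auto
  with assms show ?thesis
    by (auto simp: cochain_carrier_def intro: finite_subset)
qed

lemma cochain_carrier_support:
  assumes "\<phi> \<in> cochain_carrier X" "\<And>p x. \<psi> p x \<noteq> 0 \<Longrightarrow> \<phi> p x \<noteq> 0"
  shows "\<psi> \<in> cochain_carrier X"
proof -
  have "{p. \<exists>x. \<psi> p x \<noteq> 0} \<subseteq> {p. \<exists>x. \<phi> p x \<noteq> 0}" using assms(2) by blast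
  moreover have "finite {p. \<exists>x. \<phi> p x \<noteq> 0}" using assms(1) by (simp add: cochain_carrier_def)
  ultimately have "finite {p. \<exists>x. \<psi> p x \<noteq> 0}" by (rule finite_subset)
  moreover have "\<psi> p x = 0" if "x \<notin> simplices X p \<or> x \<in> degenerate X p" for p x
    using assms(1) assms(2)[of p x] that unfolding cochain_carrier_def by blast
  ultimately show ?thesis unfolding cochain_carrier_def by blast
qed

lemma cochain_carrier_scale:
  "\<phi> \<in> cochain_carrier X \<Longrightarrow> (\<lambda>n x. k * \<phi> n x) \<in> cochain_carrier X"
  by (rule cochain_carrier_support) auto

lemma cochain_val_scale: "cochain_val (\<lambda>n x. k * \<phi> n x) w = k * cochain_val \<phi> w"
  and cochain_val_add: "cochain_val (\<lambda>n x. \<phi> n x + \<psi> n x) w = cochain_val \<phi> w + cochain_val \<psi> w"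
  by (simp_all add: cochain_val_def)

lemma cochains_finsum:
  assumes "finite I" "\<And>i. i \<in> I \<Longrightarrow> c i \<in> cochain_carrier X"
  shows "finsum (cochains X) c I = (\<lambda>p x. \<Sum>i\<in>I. c i p x)"
proof -
  interpret abelian_monoid "cochains X"
    by (rule abelian_monoidI) (auto simp: algebra_simps intro: cochain_carrier_add)
  show ?thesis using assms
  proof (induction I rule: finite_induct)
    case (insert i I)
    then show ?case by (subst finsum_insert) auto
  qed simp
qed

text \<open>\<open>hcomp\<close> is a definite description, so existence and uniqueness of the
  decomposition are both verified. Uniqueness follows by evaluating at a \<open>p\<close>-simplex,
  where only the component of degree \<open>p\<close> can contribute.\<close>

lemma cochains_hcomp:
  assumes \<phi>: "\<phi> \<in> cochain_carrier X"
  shows "hcomp (cochains X) \<phi> i = (\<lambda>p x. if int p = i then \<phi> p x else 0)"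
proof -
  let ?c = "\<lambda>i p x. if int p = i then \<phi> p x else 0"
  have c: "?c i \<in> cochain_carrier X" for i
    by (rule cochain_carrier_support[OF \<phi>]) (auto split: if_splits)
  have "{i. ?c i \<noteq> (\<lambda>p x. 0)} \<subseteq> int ` {p. \<exists>x. \<phi> p x \<noteq> 0}" by (auto simp: fun_eq_iff)
  then have fin: "finite {i. ?c i \<noteq> (\<lambda>p x. 0)}"
    using \<phi> by (auto simp: cochain_carrier_def intro: finite_subset)
  have dec: "homog_decomp (cochains X) \<phi> ?c"
    unfolding homog_decomp_def
  proof (intro conjI allI)
    have "(\<Sum>i\<in>{i. ?c i \<noteq> (\<lambda>p x. 0)}. ?c i p x) = \<phi> p x" for p x
    proof (cases "\<phi> p x = 0")
      case True
      then show ?thesis by (auto intro!: sum.neutral)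
    next
      case False
      then have "int p \<in> {i. ?c i \<noteq> (\<lambda>p x. 0)}" by (auto simp: fun_eq_iff)
      then have "(\<Sum>i\<in>{i. ?c i \<noteq> (\<lambda>p x. 0)}. ?c i p x) = (\<Sum>i\<in>{int p}. ?c i p x)"
        using fin by (intro sum.mono_neutral_right) auto
      then show ?thesis by simp
    qed
    then show "\<phi> = finsum (cochains X) ?c {i. ?c i \<noteq> \<zero>\<^bsub>cochains X\<^esub>}"
      using fin c by (subst cochains_finsum) (auto simp: fun_eq_iff)
    show "finite {i. ?c i \<noteq> \<zero>\<^bsub>cochains X\<^esub>}" using fin by simp
  qed (use c in auto)
  have unique: "d = ?c" if d: "homog_decomp (cochains X) \<phi> d" for d
  proof (intro ext)
    fix i p x
    let ?I = "{i. d i \<noteq> \<zero>\<^bsub>cochains X\<^esub>}"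
    have dg: "d i \<in> grd (cochains X) i" for i
      using d unfolding homog_decomp_def by blast
    have fin: "finite ?I"
      and \<phi>_eq: "\<phi> = finsum (cochains X) d ?I"
      using d unfolding homog_decomp_def by blast+
    have "\<phi> p x = (\<Sum>i\<in>?I. d i p x)"
      using dg by (subst \<phi>_eq, subst cochains_finsum[OF fin]) auto
    also have "\<dots> = (\<Sum>i\<in>insert (int p) ?I. d i p x)"
      using fin by (intro sum.mono_neutral_left) auto
    also have "\<dots> = (\<Sum>i\<in>{int p}. d i p x)"
      using fin dg by (intro sum.mono_neutral_right) auto
    finally show "d i p x = ?c i p x" using dg[of i] by auto
  qed
  have "hcomp (cochains X) \<phi> = ?c"
    unfolding hcomp_def using dec unique by (rule the_equality)
  then show ?thesis by simp
qed

lemma cochains_hcomp_carrier: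
  assumes "\<phi> \<in> cochain_carrier X"
  shows "hcomp (cochains X) \<phi> i \<in> cochain_carrier X"
  unfolding cochains_hcomp[OF assms]
  by (rule cochain_carrier_support[OF assms]) (auto split: if_splits)

lemma finite_cochains_hsupp:
  assumes "\<phi> \<in> cochain_carrier X"
  shows "finite (hsupp (cochains X) \<phi>)"
proof (rule finite_subset)
  show "hsupp (cochains X) \<phi> \<subseteq> int ` {p. \<exists>x. \<phi> p x \<noteq> 0}"
    unfolding hsupp_def cochains_hcomp[OF assms] by (auto simp: fun_eq_iff)
  show "finite (int ` {p. \<exists>x. \<phi> p x \<noteq> 0})" using assms by (auto simp: cochain_carrier_def)
qed

lemma cochain_val_hcomp:
  assumes "\<phi> \<in> cochain_carrier X"
  shows "cochain_val (hcomp (cochains X) \<phi> i) w = (if int (length w) = i + 1 then cochain_val \<phi> w else 0)"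
  unfolding cochains_hcomp[OF assms] by (cases w) (auto simp: cochain_val_def)

lemma cochain_val_nonzero_hsupp:
  assumes "\<phi> \<in> cochain_carrier X" "cochain_val \<phi> w \<noteq> 0"
  shows "int (length w) - 1 \<in> hsupp (cochains X) \<phi>"
proof -
  have "w \<noteq> []" using assms(2) by auto
  then have "\<phi> (length w - 1) (word_simplex w) \<noteq> 0" "int (length w - 1) = int (length w) - 1"
    using assms(2) by (auto simp: cochain_val_def Suc_le_eq of_nat_diff)
  then show ?thesis
    unfolding hsupp_def cochains_hcomp[OF assms(1)] by (auto simp: fun_eq_iff)
qed

context
  fixes q :: nat and w :: "nat list"
  assumes w: "w \<noteq> []" "sorted w" "set w \<subseteq> {..q}"
begin

private lemma wm: "word_simplex w \<in> mono_maps (length w - 1) q"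
  by (rule word_simplex_mono_maps) (rule w)+

text \<open>Repeated letters in \<open>w\<close> are allowed, because the formula also serves to
  show that products vanish on degenerate simplices.\<close>

lemma cochain_val_mult:
  "cochain_val (\<phi> \<otimes>\<^bsub>cochains (std_simplex q)\<^esub> \<psi>) w = int_cup (cochain_val \<phi>) (cochain_val \<psi>) w"
proof -
  obtain n where n: "length w = Suc n" using w(1) by (cases w) auto
  have "front_face (std_simplex q) p (n - p) (word_simplex w) = word_simplex (take (Suc p) w)"
    "back_face (std_simplex q) p (n - p) (word_simplex w) = word_simplex (drop p w)"
    if "p \<le> n" for p
    using that n by (auto simp: front_face_def back_face_def compose_def word_simplex_def fun_eq_iff min_def)
  moreover have "length (take (Suc p) w) - 1 = p" "length (drop p w) - 1 = n - p"
      "take (Suc p) w \<noteq> []" "drop p w \<noteq> []" if "p \<le> n" for p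
    using that n w(1) by auto
  ultimately have "cochain_val (\<phi> \<otimes>\<^bsub>cochains (std_simplex q)\<^esub> \<psi>) w =
      (\<Sum>p\<le>n. cochain_val \<phi> (take (Suc p) w) * cochain_val \<psi> (drop p w))"
    using w(1) wm n by (auto simp: cochain_val_def cochains_def intro!: sum.cong)
  also have "{..n} = {..<length w}" using n by auto
  finally show ?thesis by (simp add: int_cup_sum)
qed

lemma cochain_val_differential:
  "cochain_val (differential (cochains (std_simplex q)) \<phi>) w = int_cobd (cochain_val \<phi>) w"
proof (cases "length w - 1")
  case 0
  with w(1) obtain a where "w = [a]" by (cases w) auto
  then show ?thesis by (simp add: cochain_val_def cochains_def)
next
  case (Suc p)
  then have n: "length w = Suc (Suc p)" by simp
  have "face (std_simplex q) p i (word_simplex w) = word_simplex (take i w @ drop (Suc i) w)"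
    if "i \<le> Suc p" for i
    using that n by (auto simp: face_def compose_def coface_def word_simplex_def fun_eq_iff nth_append min_def)
  moreover have "length (take i w @ drop (Suc i) w) - 1 = p" "take i w @ drop (Suc i) w \<noteq> []"
    if "i \<le> Suc p" for i
    using that n by auto
  ultimately have "cochain_val (differential (cochains (std_simplex q)) \<phi>) w =
      (\<Sum>i\<le>Suc p. (-1) ^ i * cochain_val \<phi> (take i w @ drop (Suc i) w))"
    using w(1) wm Suc by (auto simp: cochain_val_def cochains_def intro!: sum.cong)
  also have "{..Suc p} = {..<length w}" using n by auto
  finally show ?thesis by (simp add: int_cobd_sum)
qed

end

lemma cochain_val_one:
  "cochain_val \<one>\<^bsub>cochains (std_simplex q)\<^esub> w = (if w \<in> simplex_words q \<and> length w = 1 then 1 else 0)"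
proof (cases "length w = 1")
  case True
  then obtain a where "w = [a]" by (cases w) auto
  then show ?thesis
    using word_simplex_mono_maps_iff[of w q] by (simp add: cochain_val_def)
next
  case False
  then show ?thesis by (cases w) (auto simp: cochain_val_def)
qed

lemma cochain_one_carrier: "\<one>\<^bsub>cochains (std_simplex q)\<^esub> \<in> cochain_carrier (std_simplex q)"
proof (rule cochain_carrierI)
  fix w :: "nat list"
  assume "\<not> sorted_wrt (<) w"
  then show "cochain_val \<one>\<^bsub>cochains (std_simplex q)\<^esub> w = 0"
    unfolding cochain_val_one by (simp add: simplex_words_def)
qed auto

lemma cochain_mult_carrier:
  assumes "\<phi> \<in> cochain_carrier (std_simplex q)" "\<psi> \<in> cochain_carrier (std_simplex q)"
  shows "\<phi> \<otimes>\<^bsub>cochains (std_simplex q)\<^esub> \<psi> \<in> cochain_carrier (std_simplex q)"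
proof (rule cochain_carrierI)
  fix w :: "nat list"
  assume w: "w \<noteq> []" "sorted w" "set w \<subseteq> {..q}" "\<not> sorted_wrt (<) w"
  show "cochain_val (\<phi> \<otimes>\<^bsub>cochains (std_simplex q)\<^esub> \<psi>) w = 0"
    unfolding cochain_val_mult[OF w(1-3)]
    by (rule int_cup_degenerate[OF _ _ w(2,4)]; rule cochain_val_eq_zero)
      (use assms in \<open>auto simp: simplex_words_def\<close>)
qed (simp add: cochains_def)

lemma cochain_differential_carrier:
  assumes "\<phi> \<in> cochain_carrier (std_simplex q)"
  shows "differential (cochains (std_simplex q)) \<phi> \<in> cochain_carrier (std_simplex q)"
proof (rule cochain_carrierI)
  fix w :: "nat list"
  assume w: "w \<noteq> []" "sorted w" "set w \<subseteq> {..q}" "\<not> sorted_wrt (<) w"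
  show "cochain_val (differential (cochains (std_simplex q)) \<phi>) w = 0"
    unfolding cochain_val_differential[OF w(1-3)]
    by (rule int_cobd_degenerate[OF _ w(2,4)]; rule cochain_val_eq_zero)
      (use assms in \<open>auto simp: simplex_words_def\<close>)
qed (auto simp: cochains_def split: nat.split)

lemma cochain_val_map:
  assumes "w \<noteq> []" "sorted w" "set w \<subseteq> {..m}"
  shows "cochain_val (cochain_map (std_simplex m) (std_simplex_map \<theta>) \<phi>) w = cochain_val \<phi> (map \<theta> w)"
  using assms word_simplex_mono_maps[of w m] word_simplex_map[of w \<theta>]
  by (simp add: cochain_val_def cochain_map_def std_simplex_map_def)

lemma cochain_map_carrier:
  assumes \<theta>: "\<theta> \<in> mono_maps m n" and \<phi>: "\<phi> \<in> cochain_carrier (std_simplex n)"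
  shows "cochain_map (std_simplex m) (std_simplex_map \<theta>) \<phi> \<in> cochain_carrier (std_simplex m)"
proof (rule cochain_carrierI)
  fix w :: "nat list"
  assume w: "w \<noteq> []" "sorted w" "set w \<subseteq> {..m}" "\<not> sorted_wrt (<) w"
  then obtain i where i: "Suc i < length w" "w ! i = w ! Suc i" using sorted_adjacent_eq by blast
  then have "\<not> sorted_wrt (<) (map \<theta> w)"
    using sorted_wrt_nth_less[of "(<)" "map \<theta> w" i "Suc i"] by auto
  then show "cochain_val (cochain_map (std_simplex m) (std_simplex_map \<theta>) \<phi>) w = 0"
    unfolding cochain_val_map[OF w(1-3)]
    by (intro cochain_val_eq_zero[OF \<phi>]) (simp add: simplex_words_def)
qed (simp add: cochain_map_def)

section \<open>Cylinders as rings of cochains on words\<close>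

lemma keys_frag_extend_subset:
  assumes "Poly_Mapping.keys u \<subseteq> S" "\<And>x. x \<in> S \<Longrightarrow> Poly_Mapping.keys (f x) \<subseteq> T"
  shows "Poly_Mapping.keys (frag_extend f u) \<subseteq> T"
  using keys_frag_extend[of f u] assms by blast

lemma keys_sum_subset:
  "(\<And>i. i \<in> I \<Longrightarrow> Poly_Mapping.keys (f i) \<subseteq> T) \<Longrightarrow> Poly_Mapping.keys (sum f I) \<subseteq> T"
  using keys_sum[of f I] by blast

lemma keys_frag_cmul_subset:
  "Poly_Mapping.keys u \<subseteq> T \<Longrightarrow> Poly_Mapping.keys (frag_cmul k u) \<subseteq> T"
  using keys_cmul[of k u] by blast

lemma keys_diff_subset:
  "\<lbrakk>Poly_Mapping.keys u \<subseteq> T; Poly_Mapping.keys v \<subseteq> T\<rbrakk> \<Longrightarrow> Poly_Mapping.keys (u - v) \<subseteq> T"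
  using keys_diff[of u v] by blast

lemma keys_add_subset:
  "\<lbrakk>Poly_Mapping.keys u \<subseteq> T; Poly_Mapping.keys v \<subseteq> T\<rbrakk> \<Longrightarrow> Poly_Mapping.keys (u + v) \<subseteq> T"
  using keys_add[of u v] by blast

section \<open>Evaluating tensors at words\<close>

definition pair_word :: "('b, 'm) ring_scheme \<Rightarrow> (nat \<Rightarrow> (nat \<Rightarrow> nat) \<Rightarrow> int) \<times> 'b \<Rightarrow> nat list \<Rightarrow> 'b" where
  "pair_word B = (\<lambda>(\<phi>, b) w. [cochain_val \<phi> w] \<cdot>\<^bsub>B\<^esub> b)"

abbreviation cyl_pairs :: "nat \<Rightarrow> ('b, 'm) ring_scheme \<Rightarrow> ((nat \<Rightarrow> (nat \<Rightarrow> nat) \<Rightarrow> int) \<times> 'b) set" where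
  "cyl_pairs q B \<equiv> cochain_carrier (std_simplex q) \<times> carrier B"

definition cyl_word ::
    "nat \<Rightarrow> ('b, 'm) dg_ring_scheme \<Rightarrow> (((nat \<Rightarrow> (nat \<Rightarrow> nat) \<Rightarrow> int) \<times> 'b) \<Rightarrow>\<^sub>0 int) \<Rightarrow> nat list \<Rightarrow> 'b" where
  "cyl_word q B = lin (word_cochains q B) (cyl_pairs q B) (pair_word B)"

text \<open>An arbitrary representative is evaluated; \<open>cyl_eval_class\<close> shows that the
  choice does not matter.\<close>

definition cyl_eval :: "nat \<Rightarrow> ('b, 'm) dg_ring_scheme \<Rightarrow> 'b cyl \<Rightarrow> nat list \<Rightarrow> 'b" where
  "cyl_eval q B U = cyl_word q B (SOME u. u \<in> U)"

definition delta_cochain :: "nat \<Rightarrow> nat list \<Rightarrow> nat \<Rightarrow> (nat \<Rightarrow> nat) \<Rightarrow> int" where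
  "delta_cochain q w = word_cochain q (\<lambda>v. if v = w then 1 else 0)"

definition cyl_words :: "nat \<Rightarrow> nat list set" where
  "cyl_words q = simplex_words q - {[]}"

lemma finite_cyl_words: "finite (cyl_words q)"
  by (simp add: cyl_words_def finite_simplex_words)

lemma delta_cochain_carrier: "w \<in> cyl_words q \<Longrightarrow> delta_cochain q w \<in> cochain_carrier (std_simplex q)"
  unfolding delta_cochain_def by (rule word_cochain_carrier) (auto simp: cyl_words_def)

lemma delta_cochain_val: "w \<in> cyl_words q \<Longrightarrow> cochain_val (delta_cochain q w) v = (if v = w then 1 else 0)"
  unfolding delta_cochain_def by (rule cochain_val_word_cochain) (auto simp: cyl_words_def)

text \<open>A cochain is determined by its values at the finitely many nonempty words, and the
  \<open>delta_cochain\<close>s form the basis dual to these words.\<close>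

lemma cochain_delta_expansion:
  assumes \<phi>: "\<phi> \<in> cochain_carrier (std_simplex q)"
  shows "\<phi> = (\<lambda>p x. \<Sum>w\<in>cyl_words q. cochain_val \<phi> w * delta_cochain q w p x)"
proof (rule cochain_eqI[OF \<phi>])
  have *: "(\<lambda>p x. \<Sum>w\<in>I. cochain_val \<phi> w * delta_cochain q w p x) \<in> cochain_carrier (std_simplex q) \<and>
      (\<forall>v. cochain_val (\<lambda>p x. \<Sum>w\<in>I. cochain_val \<phi> w * delta_cochain q w p x) v =
        (\<Sum>w\<in>I. cochain_val \<phi> w * (if v = w then 1 else 0)))" if "finite I" "I \<subseteq> cyl_words q" for I
    using that
  proof (induction I rule: finite_induct)
    case (insert w I)
    then show ?case
      by (simp add: cochain_carrier_add cochain_carrier_scale delta_cochain_carrier cochain_val_add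
          cochain_val_scale delta_cochain_val)
  qed (simp add: cochain_val_def)
  note * = *[OF finite_cyl_words subset_refl]
  then show "(\<lambda>p x. \<Sum>w\<in>cyl_words q. cochain_val \<phi> w * delta_cochain q w p x) \<in> cochain_carrier (std_simplex q)"
    by blast
  fix v assume "v \<in> simplex_words q" "v \<noteq> []"
  then have "v \<in> cyl_words q" by (simp add: cyl_words_def)
  then show "cochain_val \<phi> v = cochain_val (\<lambda>p x. \<Sum>w\<in>cyl_words q. cochain_val \<phi> w * delta_cochain q w p x) v"
    using * finite_cyl_words by (simp add: if_distrib[of "\<lambda>x. _ * x"] cong: if_cong)
qed

lemma (in ring) add_minus_minus: "\<lbrakk>x \<in> carrier R; y \<in> carrier R\<rbrakk> \<Longrightarrow> x \<oplus> y \<ominus> x \<ominus> y = \<zero>"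
  by algebra

context dg_ring
begin

lemma pair_word_carrier: "x \<in> cyl_pairs q A \<Longrightarrow> pair_word A x \<in> carrier (word_cochains q A)"
  by (auto simp: pair_word_def word_cochains_carrier cochain_val_eq_zero)

lemma twist_zmul: "a \<in> carrier A \<Longrightarrow> twist A n ([(k::int)] \<cdot> a) = [k] \<cdot> twist A n a"
proof -
  assume a: "a \<in> carrier A"
  have "twist A n \<in> hom (add_monoid A) (add_monoid A)"
    by (auto simp: hom_def twist_add)
  from hom_int_pow[OF this _ a_group a_group, of a k] a show ?thesis
    by (simp add: add_pow_def)
qed

text \<open>The sum runs over the degrees \<open>i\<close> of the second cochain. In each splitting
  of \<open>w\<close> only the \<open>i\<close> equal to the dimension of the back face survives,
  which turns \<open>twist A i b\<close> into the twist that \<open>cup\<close> prescribes.\<close>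

lemma cup_zmul:
  assumes "finite I" "b \<in> carrier A" "c \<in> carrier A" "\<And>w. g w \<noteq> 0 \<Longrightarrow> int (length w) - 1 \<in> I"
  shows "(\<Oplus>i\<in>I. [(int_cup f (\<lambda>w. if int (length w) = i + 1 then g w else 0) w)] \<cdot> (twist A i b \<otimes> c)) =
    cup A (\<lambda>w. [(f w)] \<cdot> b) (\<lambda>w. [(g w)] \<cdot> c) w"
proof (induction w arbitrary: f)
  case Nil
  then show ?case by simp
next
  case (Cons a m)
  let ?g = "\<lambda>i w. if int (length w) = i + 1 then g w else 0" and ?X = "\<lambda>i. twist A i b \<otimes> c"
  let ?n = "int (length m)"
  have X [simp]: "?X i \<in> carrier A" for i using assms by simp
  have "(\<Oplus>i\<in>I. [(int_cup f (?g i) (a # m))] \<cdot> ?X i) =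
      (\<Oplus>i\<in>I. (if ?n = i then [(f [a] * g (a # m))] \<cdot> ?X i else \<zero>) \<oplus> [(int_cup (\<lambda>u. f (a # u)) (?g i) m)] \<cdot> ?X i)"
    by (rule finsum_cong') (auto simp: zmul_add_left)
  also have "\<dots> = (\<Oplus>i\<in>I. if ?n = i then [(f [a] * g (a # m))] \<cdot> ?X i else \<zero>) \<oplus>
      (\<Oplus>i\<in>I. [(int_cup (\<lambda>u. f (a # u)) (?g i) m)] \<cdot> ?X i)"
    by (rule finsum_addf) auto
  \<comment> \<open>If \<open>?n\<close> is not in \<open>I\<close>, the coefficient is zero by the
    assumption on \<open>I\<close>, so both sides vanish.\<close>
  also have "(\<Oplus>i\<in>I. if ?n = i then [(f [a] * g (a # m))] \<cdot> ?X i else \<zero>) = [(f [a] * g (a # m))] \<cdot> ?X ?n"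
  proof (cases "?n \<in> I")
    case True
    then show ?thesis by (intro finsum_singleton assms(1)) auto
  next
    case False
    then have "g (a # m) = 0" using assms(4)[of "a # m"] by auto
    then have "(\<Oplus>i\<in>I. if ?n = i then [(f [a] * g (a # m))] \<cdot> ?X i else \<zero>) = (\<Oplus>i\<in>I. \<zero>)"
      by (intro finsum_cong') auto
    with \<open>g (a # m) = 0\<close> show ?thesis by simp
  qed
  also have "[(f [a] * g (a # m))] \<cdot> ?X ?n = twist A ?n ([(f [a])] \<cdot> b) \<otimes> [(g (a # m))] \<cdot> c"
    using assms by (simp add: twist_zmul add_pow_ldistr_int add_pow_rdistr_int zmul_zmul mult.commute)
  finally show ?case using Cons.IH[of "\<lambda>u. f (a # u)"] by simp
qed

text \<open>The differential of \<open>b\<close> occurs once, at the end of the recursion, after as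
  many sign changes as \<open>w\<close> has letters; with the sign at \<open>[]\<close> this gives
  \<open>ksign (length w + 1)\<close>.\<close>

lemma cobd_zmul:
  assumes b: "b \<in> carrier A"
  shows "cobd A (\<lambda>w. [(f w)] \<cdot> b) w =
    [(int_cobd f w)] \<cdot> b \<oplus> [(ksign (int (length w) + 1) * f w)] \<cdot> differential A b"
proof (induction w arbitrary: f)
  case Nil
  then show ?case using b by (simp add: diff_zmul)
next
  case (Cons a w)
  have s: "ksign (int (length (a # w)) + 1) * f (a # w) = - (ksign (int (length w) + 1) * f (a # w))"
    by (auto simp: ksign_def)
  have "[(f w - int_cobd (\<lambda>u. f (a # u)) w)] \<cdot> b = [(f w)] \<cdot> b \<ominus> [(int_cobd (\<lambda>u. f (a # u)) w)] \<cdot> b"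
    using zmul_add_left[OF b, of "f w" "- int_cobd (\<lambda>u. f (a # u)) w"] b by (simp add: a_minus_def)
  then show ?case
    unfolding s using b Cons.IH[of "\<lambda>u. f (a # u)"] by (simp add: a_minus_def minus_add a_assoc)
qed

context
  fixes q :: nat
begin

interpretation W: predg_ring "word_cochains q A" by (rule predg_ring_word_cochains)

lemma cyl_word_of: "x \<in> cyl_pairs q A \<Longrightarrow> cyl_word q A (frag_of x) = pair_word A x"
  unfolding cyl_word_def by (rule W.lin_of[OF pair_word_carrier])

lemma cyl_word_closed: "Poly_Mapping.keys u \<subseteq> cyl_pairs q A \<Longrightarrow> cyl_word q A u \<in> carrier (word_cochains q A)"
  unfolding cyl_word_def by (rule W.lin_closed[OF pair_word_carrier])

lemma cyl_word_zero: "cyl_word q A 0 = (\<lambda>w. \<zero>)"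
  unfolding cyl_word_def using W.lin_zero[OF pair_word_carrier] by simp

lemma cyl_word_add:
  "\<lbrakk>Poly_Mapping.keys u \<subseteq> cyl_pairs q A; Poly_Mapping.keys v \<subseteq> cyl_pairs q A\<rbrakk> \<Longrightarrow> cyl_word q A (u + v) = (\<lambda>w. cyl_word q A u w \<oplus> cyl_word q A v w)"
  unfolding cyl_word_def by (simp add: W.lin_add[OF pair_word_carrier])

lemma cyl_word_diff:
  assumes "Poly_Mapping.keys u \<subseteq> cyl_pairs q A" "Poly_Mapping.keys v \<subseteq> cyl_pairs q A"
  shows "cyl_word q A (u - v) = cyl_word q A u \<ominus>\<^bsub>word_cochains q A\<^esub> cyl_word q A v"
  unfolding cyl_word_def by (rule W.lin_diff[OF pair_word_carrier assms])

end

text \<open>An additive operation on representatives that matches an additive \<open>T\<close> on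
  generators matches it everywhere. It is used for products, one factor at a time, for differentials
  and for pullbacks.\<close>

lemma cyl_word_frag_extend:
  assumes u: "Poly_Mapping.keys u \<subseteq> cyl_pairs n A"
    and g: "\<And>x. x \<in> cyl_pairs n A \<Longrightarrow> Poly_Mapping.keys (g x) \<subseteq> cyl_pairs m A"
      "\<And>x. x \<in> cyl_pairs n A \<Longrightarrow> cyl_word m A (g x) = T (pair_word A x)"
    and T: "\<And>P Q. \<lbrakk>P \<in> carrier (word_cochains n A); Q \<in> carrier (word_cochains n A)\<rbrakk> \<Longrightarrow>
      T (P \<ominus>\<^bsub>word_cochains n A\<^esub> Q) = T P \<ominus>\<^bsub>word_cochains m A\<^esub> T Q"
    and T0: "T \<zero>\<^bsub>word_cochains n A\<^esub> = \<zero>\<^bsub>word_cochains m A\<^esub>"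
  shows "Poly_Mapping.keys (frag_extend g u) \<subseteq> cyl_pairs m A"
    and "cyl_word m A (frag_extend g u) = T (cyl_word n A u)"
proof -
  show "Poly_Mapping.keys (frag_extend g u) \<subseteq> cyl_pairs m A"
    by (rule keys_frag_extend_subset[OF u g(1)])
  show "cyl_word m A (frag_extend g u) = T (cyl_word n A u)"
    using u
  proof (induction u rule: free_Abelian_induct)
    case zero
    then show ?case using T0 by (simp add: cyl_word_zero)
  next
    case (diff u v)
    have "cyl_word m A (frag_extend g (u - v)) =
        cyl_word m A (frag_extend g u) \<ominus>\<^bsub>word_cochains m A\<^esub> cyl_word m A (frag_extend g v)"
      unfolding frag_extend_diff using diff(1,2) by (intro cyl_word_diff keys_frag_extend_subset[OF _ g(1)])
    also have "\<dots> = T (cyl_word n A u \<ominus>\<^bsub>word_cochains n A\<^esub> cyl_word n A v)"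
      unfolding diff by (intro T[symmetric] cyl_word_closed diff)
    finally show ?case by (simp only: cyl_word_diff[OF diff(1,2)])
  next
    case (of x)
    then show ?case unfolding frag_extend_of cyl_word_of[OF of] by (rule g(2))
  qed
qed

context
  fixes q :: nat
begin

interpretation W: predg_ring "word_cochains q A" by (rule predg_ring_word_cochains)

private abbreviation "S \<equiv> cyl_pairs q A"
private abbreviation "E \<equiv> cyl_word q A"
private abbreviation "W \<equiv> word_cochains q A"
private abbreviation "C \<equiv> cochains (std_simplex q)"

lemma word_cochains_minus:
  assumes "P \<in> carrier W" "Q \<in> carrier W"
  shows "P \<ominus>\<^bsub>W\<^esub> Q = (\<lambda>w. P w \<ominus> Q w)"
  using word_cochains_zmul[OF assms(2), of "-1"] assms
  by (simp add: a_minus_def word_cochains_carrier)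

lemma cyl_word_diff_val:
  assumes "Poly_Mapping.keys u \<subseteq> S" "Poly_Mapping.keys v \<subseteq> S"
  shows "E (u - v) w = E u w \<ominus> E v w"
  using cyl_word_diff[OF assms] word_cochains_minus[OF cyl_word_closed cyl_word_closed, OF assms] by simp

lemma cyl_word_cmul:
  assumes "Poly_Mapping.keys u \<subseteq> S"
  shows "E (frag_cmul k u) = (\<lambda>w. [k] \<cdot> E u w)"
  using W.lin_cmul[OF pair_word_carrier assms] word_cochains_zmul[OF cyl_word_closed[OF assms], of k]
  by (simp add: cyl_word_def)

lemma cyl_word_val_closed: "Poly_Mapping.keys u \<subseteq> S \<Longrightarrow> E u w \<in> carrier A"
  using cyl_word_closed by (simp add: word_cochains_carrier)

lemma cyl_word_sum:
  assumes "finite I" "\<And>i. i \<in> I \<Longrightarrow> Poly_Mapping.keys (g i) \<subseteq> S"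
  shows "E (\<Sum>i\<in>I. g i) w = (\<Oplus>i\<in>I. E (g i) w)"
  using assms
proof (induction I rule: finite_induct)
  case (insert i I)
  have "Poly_Mapping.keys (sum g I) \<subseteq> S" by (rule keys_sum_subset) (use insert in auto)
  with insert show ?case
    by (subst finsum_insert) (auto simp: cyl_word_add cyl_word_val_closed)
qed (simp add: cyl_word_zero)

section \<open>The biadditivity relations as the kernel of evaluation\<close>

private abbreviation "rel \<equiv> tensor_rel C A"

lemma tensor_rel_subgroup: "subgroup rel (free_Abelian_group S)"
  unfolding tensor_rel_def tensor_free_def cochains_sel(1)
proof (rule group.generate_is_subgroup[OF group_free_Abelian_group])
qed (auto simp: keys_diff_subset cochain_carrier_add)

lemma tensor_rel_keys: "u \<in> rel \<Longrightarrow> Poly_Mapping.keys u \<subseteq> S"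
  using subsetD[OF subgroup.subset[OF tensor_rel_subgroup]] by simp

lemma tensor_rel_zero: "0 \<in> rel"
  using subgroup.one_closed[OF tensor_rel_subgroup] by simp

lemma tensor_rel_add: "u \<in> rel \<Longrightarrow> v \<in> rel \<Longrightarrow> u + v \<in> rel"
  using subgroup.m_closed[OF tensor_rel_subgroup] by simp

lemma tensor_rel_minus: "u \<in> rel \<Longrightarrow> - u \<in> rel"
  using subgroup.m_inv_closed[OF tensor_rel_subgroup, of u] tensor_rel_keys[of u] by simp

lemma tensor_rel_diff: "u \<in> rel \<Longrightarrow> v \<in> rel \<Longrightarrow> u - v \<in> rel"
  using tensor_rel_add[OF _ tensor_rel_minus] by simp

lemma tensor_rel_sum: "(\<And>i. i \<in> I \<Longrightarrow> g i \<in> rel) \<Longrightarrow> sum g I \<in> rel"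
  by (induction I rule: infinite_finite_induct) (auto simp: tensor_rel_zero tensor_rel_add)

lemma tensor_rel_left:
  assumes "\<phi> \<in> cochain_carrier (std_simplex q)" "\<psi> \<in> cochain_carrier (std_simplex q)" "b \<in> carrier A"
  shows "frag_of (\<lambda>p x. \<phi> p x + \<psi> p x, b) - frag_of (\<phi>, b) - frag_of (\<psi>, b) \<in> rel"
  unfolding tensor_rel_def
  by (rule generate.incl, rule UnI1, rule CollectI, rule exI[of _ \<phi>], rule exI[of _ \<psi>], rule exI[of _ b])
    (simp add: assms)

lemma tensor_rel_right:
  assumes "\<phi> \<in> cochain_carrier (std_simplex q)" "b \<in> carrier A" "b' \<in> carrier A"
  shows "frag_of (\<phi>, b \<oplus> b') - frag_of (\<phi>, b) - frag_of (\<phi>, b') \<in> rel"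
  unfolding tensor_rel_def
  by (rule generate.incl, rule UnI2, rule CollectI, rule exI[of _ \<phi>], rule exI[of _ b], rule exI[of _ b'])
    (simp add: assms)

lemma tensor_rel_zero_left: "b \<in> carrier A \<Longrightarrow> frag_of (\<lambda>p x. 0, b) \<in> rel"
  using tensor_rel_minus[OF tensor_rel_left[of "\<lambda>p x. 0" "\<lambda>p x. 0" b]] by simp

lemma tensor_rel_zero_right: "\<phi> \<in> cochain_carrier (std_simplex q) \<Longrightarrow> frag_of (\<phi>, \<zero>) \<in> rel"
  using tensor_rel_minus[OF tensor_rel_right[of \<phi> \<zero> \<zero>]] by simp

lemma tensor_rel_right_diff:
  assumes "\<phi> \<in> cochain_carrier (std_simplex q)" "b \<in> carrier A" "b' \<in> carrier A"
  shows "frag_of (\<phi>, b \<ominus> b') - frag_of (\<phi>, b) + frag_of (\<phi>, b') \<in> rel"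
proof -
  have "b \<ominus> b' \<oplus> b' = b" using minus_eq_iff[of b b' "b \<ominus> b'"] assms by simp
  with tensor_rel_minus[OF tensor_rel_right[of \<phi> "b \<ominus> b'" b']] assms show ?thesis
    by (simp add: algebra_simps)
qed

text \<open>Integers move across the tensor sign. As the relations only express biadditivity, this
  takes an induction on \<open>k\<close> in both directions from zero.\<close>

lemma tensor_rel_scale:
  assumes \<phi>: "\<phi> \<in> cochain_carrier (std_simplex q)" and b: "b \<in> carrier A"
  shows "frag_of (\<lambda>p x. k * \<phi> p x, b) - frag_of (\<phi>, [k] \<cdot> b) \<in> rel"
proof (induction k rule: int_induct[where k = 0])
  case base
  show ?case using tensor_rel_diff[OF tensor_rel_zero_left[OF b] tensor_rel_zero_right[OF \<phi>]] by simp
next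
  case (step1 k)
  have 1: "frag_of (\<lambda>p x. k * \<phi> p x + \<phi> p x, b) - frag_of (\<lambda>p x. k * \<phi> p x, b) - frag_of (\<phi>, b) \<in> rel"
    by (rule tensor_rel_left[OF cochain_carrier_scale[OF \<phi>] \<phi> b])
  have 2: "frag_of (\<phi>, [k] \<cdot> b \<oplus> b) - frag_of (\<phi>, [k] \<cdot> b) - frag_of (\<phi>, b) \<in> rel"
    by (rule tensor_rel_right[OF \<phi> _ b]) (simp add: b)
  have eq: "[(k + 1)] \<cdot> b = [k] \<cdot> b \<oplus> b" using zmul_add_left[of b k 1] b by simp
  have eq': "(\<lambda>p x. (k + 1) * \<phi> p x) = (\<lambda>p x. k * \<phi> p x + \<phi> p x)" by (simp add: algebra_simps)
  from tensor_rel_add[OF tensor_rel_diff[OF 1 2] step1(2)] show ?case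
    unfolding eq eq' by (simp add: algebra_simps)
next
  case (step2 k)
  have 1: "frag_of (\<lambda>p x. (k - 1) * \<phi> p x + \<phi> p x, b) - frag_of (\<lambda>p x. (k - 1) * \<phi> p x, b) - frag_of (\<phi>, b) \<in> rel"
    by (rule tensor_rel_left[OF cochain_carrier_scale[OF \<phi>] \<phi> b])
  have 2: "frag_of (\<phi>, [(k - 1)] \<cdot> b \<oplus> b) - frag_of (\<phi>, [(k - 1)] \<cdot> b) - frag_of (\<phi>, b) \<in> rel"
    by (rule tensor_rel_right[OF \<phi> _ b]) (simp add: b)
  have eq: "[(k - 1)] \<cdot> b \<oplus> b = [k] \<cdot> b" using zmul_add_left[of b "k - 1" 1] b by simp
  have eq': "(\<lambda>p x. (k - 1) * \<phi> p x + \<phi> p x) = (\<lambda>p x. k * \<phi> p x)" by (simp add: algebra_simps)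
  from tensor_rel_diff[OF step2(2) tensor_rel_diff[OF 1 2]] show ?case
    unfolding eq eq' by (simp add: algebra_simps)
qed

lemma tensor_rel_delta_sum:
  assumes "finite I" "I \<subseteq> cyl_words q" "b \<in> carrier A"
  shows "frag_of (\<lambda>p x. \<Sum>w\<in>I. k w * delta_cochain q w p x, b) -
      (\<Sum>w\<in>I. frag_of (delta_cochain q w, [(k w)] \<cdot> b)) \<in> rel"
    and "(\<lambda>p x. \<Sum>w\<in>I. k w * delta_cochain q w p x) \<in> cochain_carrier (std_simplex q)"
  using assms(1,2)
proof (induction I rule: finite_induct)
  case empty
  { case 1 show ?case using assms(3) by (simp add: tensor_rel_zero_left) }
  { case 2 show ?case by simp }
next
  case (insert w I)
  have \<delta>: "delta_cochain q w \<in> cochain_carrier (std_simplex q)"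
    if "insert w I \<subseteq> cyl_words q" using that by (intro delta_cochain_carrier) auto
  { case 1
    let ?\<phi> = "\<lambda>p x. \<Sum>w\<in>I. k w * delta_cochain q w p x" and ?\<psi> = "\<lambda>p x. k w * delta_cochain q w p x"
    let ?s = "\<Sum>w\<in>I. frag_of (delta_cochain q w, [(k w)] \<cdot> b)"
    have a: "frag_of (\<lambda>p x. ?\<psi> p x + ?\<phi> p x, b) - frag_of (?\<psi>, b) - frag_of (?\<phi>, b) \<in> rel"
      using insert.IH(2) 1 assms(3) by (intro tensor_rel_left cochain_carrier_scale[OF \<delta>]) auto
    have s: "frag_of (?\<psi>, b) - frag_of (delta_cochain q w, [(k w)] \<cdot> b) \<in> rel"
      using 1 assms(3) by (intro tensor_rel_scale \<delta>)
    have i: "frag_of (?\<phi>, b) - ?s \<in> rel" using insert.IH(1) 1 by simp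
    have "frag_of (\<lambda>p x. ?\<psi> p x + ?\<phi> p x, b) - (frag_of (delta_cochain q w, [(k w)] \<cdot> b) + ?s) =
      (frag_of (\<lambda>p x. ?\<psi> p x + ?\<phi> p x, b) - frag_of (?\<psi>, b) - frag_of (?\<phi>, b)) +
      (frag_of (?\<psi>, b) - frag_of (delta_cochain q w, [(k w)] \<cdot> b)) + (frag_of (?\<phi>, b) - ?s)"
      by (simp add: algebra_simps)
    also have "\<dots> \<in> rel" by (intro tensor_rel_add a s i)
    finally show ?case using insert.hyps by simp }
  { case 2
    then show ?case using insert cochain_carrier_add[OF cochain_carrier_scale[OF \<delta>[OF 2]] insert.IH(2)] by simp }
qed

text \<open>Every tensor is congruent to a sum of terms \<open>\<delta>\<^sub>w \<otimes> b\<^sub>w\<close> with \<open>b\<^sub>w\<close> its value at \<open>w\<close>, so the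
  kernel of evaluation on words is exactly the subgroup of relations.\<close>

lemma tensor_normal_form:
  assumes "Poly_Mapping.keys u \<subseteq> S"
  shows "u - (\<Sum>w\<in>cyl_words q. frag_of (delta_cochain q w, E u w)) \<in> rel"
  using assms
proof (induction u rule: free_Abelian_induct)
  case zero
  have "(\<Sum>w\<in>cyl_words q. frag_of (delta_cochain q w, \<zero>)) \<in> rel"
    by (intro tensor_rel_sum tensor_rel_zero_right delta_cochain_carrier)
  then show ?case by (simp add: cyl_word_zero tensor_rel_minus)
next
  case (diff u v)
  let ?N = "\<lambda>u. \<Sum>w\<in>cyl_words q. frag_of (delta_cochain q w, E u w)"
  have "(\<Sum>w\<in>cyl_words q. frag_of (delta_cochain q w, E u w \<ominus> E v w) -
      frag_of (delta_cochain q w, E u w) + frag_of (delta_cochain q w, E v w)) \<in> rel"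
    using diff by (intro tensor_rel_sum tensor_rel_right_diff delta_cochain_carrier cyl_word_val_closed)
  then have "?N (u - v) - ?N u + ?N v \<in> rel"
    using diff by (simp add: cyl_word_diff_val sum.distrib sum_subtractf)
  from tensor_rel_diff[OF tensor_rel_diff[OF diff(3,4)] this] show ?case
    by (simp add: algebra_simps)
next
  case (of x)
  then obtain \<phi> b where x: "x = (\<phi>, b)" "\<phi> \<in> cochain_carrier (std_simplex q)" "b \<in> carrier A" by auto
  from tensor_rel_delta_sum(1)[OF finite_cyl_words subset_refl x(3), of "cochain_val \<phi>"]
  show ?case
    unfolding cochain_delta_expansion[OF x(2), symmetric] using of x(1) by (simp add: cyl_word_of pair_word_def)
qed

text \<open>Evaluation is additive in the cochain and in the coefficient, so it kills the generating
  relations and hence the subgroup they generate.\<close>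

lemma cyl_word_rel:
  assumes "u \<in> rel"
  shows "E u = (\<lambda>w. \<zero>)"
proof -
  have hom: "E \<in> hom (free_Abelian_group S) (add_monoid W)"
    using cyl_word_closed cyl_word_add by (auto simp: hom_def)
  interpret group_hom "free_Abelian_group S" "add_monoid W" E
    by (intro group_hom.intro group_hom_axioms.intro group_free_Abelian_group W.a_group hom)
  have "rel \<subseteq> kernel (free_Abelian_group S) (add_monoid W) E"
    unfolding tensor_rel_def tensor_free_def cochains_sel(1)
  proof (rule group.generate_subgroup_incl[OF group_free_Abelian_group _ subgroup_kernel])
    have "E (frag_of (\<lambda>p x. \<phi> p x + \<psi> p x, b) - frag_of (\<phi>, b) - frag_of (\<psi>, b)) w = \<zero>"
      if "\<phi> \<in> cochain_carrier (std_simplex q)" "\<psi> \<in> cochain_carrier (std_simplex q)" "b \<in> carrier A" for \<phi> \<psi> b w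
      using that
      by (simp add: cyl_word_diff_val keys_diff_subset cochain_carrier_add cyl_word_of pair_word_def
          cochain_val_add zmul_add_left add_minus_minus)
    moreover have "E (frag_of (\<phi>, b \<oplus> b') - frag_of (\<phi>, b) - frag_of (\<phi>, b')) w = \<zero>"
      if "\<phi> \<in> cochain_carrier (std_simplex q)" "b \<in> carrier A" "b' \<in> carrier A" for \<phi> b b' w
      using that
      by (simp add: cyl_word_diff_val keys_diff_subset cyl_word_of pair_word_def
          zmul_add_right add_minus_minus)
    ultimately show "{frag_of (a \<oplus>\<^bsub>C\<^esub> a', b) - frag_of (a, b) - frag_of (a', b) |a a' b.
         a \<in> cochain_carrier (std_simplex q) \<and> a' \<in> cochain_carrier (std_simplex q) \<and> b \<in> carrier A} \<union>
      {frag_of (a, b \<oplus> b') - frag_of (a, b) - frag_of (a, b') |a b b'.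
         a \<in> cochain_carrier (std_simplex q) \<and> b \<in> carrier A \<and> b' \<in> carrier A}
      \<subseteq> kernel (free_Abelian_group S) (add_monoid W) E"
      by (intro Un_least subsetI; elim CollectE exE conjE;
          simp add: kernel_def fun_eq_iff keys_diff_subset cochain_carrier_add)
  qed
  with assms show ?thesis by (auto simp: kernel_def)
qed

lemma tensor_rel_iff:
  assumes "Poly_Mapping.keys u \<subseteq> S"
  shows "u \<in> rel \<longleftrightarrow> E u = (\<lambda>w. \<zero>)"
proof
  assume "E u = (\<lambda>w. \<zero>)"
  then have "u - (\<Sum>w\<in>cyl_words q. frag_of (delta_cochain q w, \<zero>)) \<in> rel"
    using tensor_normal_form[OF assms] by simp
  moreover have "(\<Sum>w\<in>cyl_words q. frag_of (delta_cochain q w, \<zero>)) \<in> rel"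
    by (intro tensor_rel_sum tensor_rel_zero_right delta_cochain_carrier)
  ultimately show "u \<in> rel" using tensor_rel_add by fastforce
qed (rule cyl_word_rel)

text \<open>Cosets are the fibres of evaluation. Hence a union over representatives collapses to one
  class as soon as the evaluated result depends only on the evaluated arguments, which makes the
  operations of \<open>tensor\<close> well defined.\<close>

lemma tensor_class_eq:
  assumes u: "Poly_Mapping.keys u \<subseteq> S"
  shows "tensor_class C A u = {v. Poly_Mapping.keys v \<subseteq> S \<and> E v = E u}"
proof -
  have "tensor_class C A u = {r + u |r. r \<in> rel}"
    by (auto simp: tensor_class_def r_coset_def tensor_free_def)
  also have "\<dots> = {v. Poly_Mapping.keys v \<subseteq> S \<and> E v = E u}"
  proof (intro subset_antisym subsetI; clarify)
    fix r assume "r \<in> rel"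
    then show "Poly_Mapping.keys (r + u) \<subseteq> S \<and> E (r + u) = E u"
      using tensor_rel_keys[of r] cyl_word_rel[of r] u cyl_word_val_closed[OF u]
      by (simp add: cyl_word_add keys_add_subset)
  next
    fix v assume v: "Poly_Mapping.keys v \<subseteq> S" "E v = E u"
    then have "E (v - u) = (\<lambda>w. \<zero>)"
      using u cyl_word_val_closed[OF u] by (auto simp: cyl_word_diff_val a_minus_def r_neg)
    then have "v - u \<in> rel" using tensor_rel_iff keys_diff_subset[OF v(1) u] by blast
    then show "\<exists>r. v = r + u \<and> r \<in> rel" by (intro exI[of _ "v - u"]) simp
  qed
  finally show ?thesis .
qed

section \<open>Product and differential on representatives\<close>

lemma word_cochains_eqI:
  assumes "P \<in> carrier W" "Q \<in> carrier W" "\<And>w. w \<in> cyl_words q \<Longrightarrow> P w = Q w"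
  shows "P = Q"
proof
  fix w show "P w = Q w"
  proof (cases "w \<in> cyl_words q")
    case False
    then have "w = [] \<or> w \<notin> simplex_words q" by (auto simp: cyl_words_def)
    then show ?thesis using assms(1,2) by (auto simp: word_cochains_carrier)
  qed (rule assms)
qed

lemma cyl_words_sorted:
  "w \<in> cyl_words q \<Longrightarrow> w \<noteq> [] \<and> sorted w \<and> set w \<subseteq> {..q}"
  by (auto simp: cyl_words_def simplex_words_def strict_sorted_imp_sorted)

text \<open>The two sums are resolved in turn: the one over the components of \<open>b\<close>
  collects the signs \<open>ksign (i * j)\<close> into \<open>twist A i b\<close>, and the one over
  the degrees of \<open>\<psi>\<close> is then \<open>cup_zmul\<close>.\<close>

lemma mult_rep_pair:
  assumes \<phi>: "\<phi> \<in> cochain_carrier (std_simplex q)" and \<psi>: "\<psi> \<in> cochain_carrier (std_simplex q)"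
    and b: "b \<in> carrier A" and c: "c \<in> carrier A"
  defines "r \<equiv> \<Sum>i\<in>hsupp C \<psi>. \<Sum>j\<in>hsupp A b.
    frag_cmul (ksign (i * j)) (frag_of (\<phi> \<otimes>\<^bsub>C\<^esub> hcomp C \<psi> i, hcomp A b j \<otimes> c))"
  shows "Poly_Mapping.keys r \<subseteq> S" and "E r = cup A (pair_word A (\<phi>, b)) (pair_word A (\<psi>, c))"
proof -
  let ?t = "\<lambda>i j. frag_cmul (ksign (i * j)) (frag_of (\<phi> \<otimes>\<^bsub>C\<^esub> hcomp C \<psi> i, hcomp A b j \<otimes> c))"
  have pair: "(\<phi> \<otimes>\<^bsub>C\<^esub> hcomp C \<psi> i, hcomp A b j \<otimes> c) \<in> S" for i j
    using cochain_mult_carrier[OF \<phi> cochains_hcomp_carrier[OF \<psi>]] hcomp_closed[OF b] c by simp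
  have t: "Poly_Mapping.keys (?t i j) \<subseteq> S" for i j
    by (rule keys_frag_cmul_subset) (use pair in simp)
  have s: "Poly_Mapping.keys (\<Sum>j\<in>hsupp A b. ?t i j) \<subseteq> S" for i
    by (rule keys_sum_subset) (rule t)
  show r: "Poly_Mapping.keys r \<subseteq> S"
    unfolding r_def by (rule keys_sum_subset) (rule s)
  note fin = finite_hsupp[OF b] finite_cochains_hsupp[OF \<psi>]
  show "E r = cup A (pair_word A (\<phi>, b)) (pair_word A (\<psi>, c))"
  proof (rule word_cochains_eqI[OF cyl_word_closed[OF r]])
    show "cup A (pair_word A (\<phi>, b)) (pair_word A (\<psi>, c)) \<in> carrier W"
      using W.m_closed[OF pair_word_carrier pair_word_carrier, of "(\<phi>, b)" "(\<psi>, c)"] \<phi> \<psi> b c by simp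
    fix w assume w: "w \<in> cyl_words q"
    note w' = cyl_words_sorted[OF w]
    let ?k = "\<lambda>i. int_cup (cochain_val \<phi>) (cochain_val (hcomp C \<psi> i)) w"
    have inner: "E (\<Sum>j\<in>hsupp A b. ?t i j) w = [(?k i)] \<cdot> (twist A i b \<otimes> c)" for i
    proof -
      have "E (\<Sum>j\<in>hsupp A b. ?t i j) w = (\<Oplus>j\<in>hsupp A b. E (?t i j) w)"
        by (rule cyl_word_sum[OF fin(1) t])
      also have "\<dots> = (\<Oplus>j\<in>hsupp A b. [(?k i)] \<cdot> (([ksign (i * j)] \<cdot> hcomp A b j) \<otimes> c))"
      proof (rule finsum_cong'[OF refl])
        show "E (?t i j) w = [(?k i)] \<cdot> (([ksign (i * j)] \<cdot> hcomp A b j) \<otimes> c)" for j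
          using pair[of i j] hcomp_closed[OF b, of j] c cochain_val_mult[of w q \<phi> "hcomp C \<psi> i"] w'
          by (simp add: cyl_word_cmul cyl_word_of pair_word_def add_pow_ldistr_int zmul_zmul mult.commute)
      qed (use hcomp_closed[OF b] c in auto)
      also have "\<dots> = [(?k i)] \<cdot> (\<Oplus>j\<in>hsupp A b. ([ksign (i * j)] \<cdot> hcomp A b j) \<otimes> c)"
        using hcomp_closed[OF b] c by (intro zmul_finsum_right[symmetric] fin) auto
      also have "(\<Oplus>j\<in>hsupp A b. ([ksign (i * j)] \<cdot> hcomp A b j) \<otimes> c) = twist A i b \<otimes> c"
        unfolding twist_def using hcomp_closed[OF b] c by (intro finsum_ldistr[symmetric] fin) auto
      finally show ?thesis .
    qed
    have "E r w = (\<Oplus>i\<in>hsupp C \<psi>. E (\<Sum>j\<in>hsupp A b. ?t i j) w)"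
      unfolding r_def by (rule cyl_word_sum[OF fin(2) s])
    also have "\<dots> = (\<Oplus>i\<in>hsupp C \<psi>. [(int_cup (cochain_val \<phi>)
        (\<lambda>w. if int (length w) = i + 1 then cochain_val \<psi> w else 0) w)] \<cdot> (twist A i b \<otimes> c))"
      unfolding inner cochain_val_hcomp[OF \<psi>, abs_def] ..
    also have "\<dots> = cup A (pair_word A (\<phi>, b)) (pair_word A (\<psi>, c)) w"
      unfolding pair_word_def prod.case
      by (rule cup_zmul[OF fin(2) b c]) (rule cochain_val_nonzero_hsupp[OF \<psi>])
    finally show "E r w = cup A (pair_word A (\<phi>, b)) (pair_word A (\<psi>, c)) w" .
  qed
qed

lemma cyl_word_mult_rep:
  assumes u: "Poly_Mapping.keys u \<subseteq> S" and v: "Poly_Mapping.keys v \<subseteq> S"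
  shows "Poly_Mapping.keys (tensor_mult_rep C A u v) \<subseteq> S"
    and "E (tensor_mult_rep C A u v) = E u \<otimes>\<^bsub>W\<^esub> E v"
proof -
  define g where "g = (\<lambda>(\<phi>, b) (\<psi>, c). \<Sum>i\<in>hsupp C \<psi>. \<Sum>j\<in>hsupp A b.
    frag_cmul (ksign (i * j)) (frag_of (\<phi> \<otimes>\<^bsub>C\<^esub> hcomp C \<psi> i, hcomp A b j \<otimes> c)))"
  have g: "Poly_Mapping.keys (g x y) \<subseteq> S" "E (g x y) = pair_word A x \<otimes>\<^bsub>W\<^esub> pair_word A y"
    if "x \<in> S" "y \<in> S" for x y
    using that mult_rep_pair[of "fst x" "fst y" "snd x" "snd y"] by (auto simp: g_def split_beta)
  have rep: "tensor_mult_rep C A u v = frag_extend (\<lambda>x. frag_extend (g x) v) u"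
    unfolding tensor_mult_rep_def
    by (rule arg_cong[of _ _ "\<lambda>f. frag_extend f u"]) (auto simp: fun_eq_iff g_def)
  have inner: "Poly_Mapping.keys (frag_extend (g x) v) \<subseteq> S"
      "E (frag_extend (g x) v) = pair_word A x \<otimes>\<^bsub>W\<^esub> E v" if x: "x \<in> S" for x
  proof -
    note xc = pair_word_carrier[OF x]
    have "pair_word A x \<otimes>\<^bsub>W\<^esub> (P \<ominus>\<^bsub>W\<^esub> Q) = pair_word A x \<otimes>\<^bsub>W\<^esub> P \<ominus>\<^bsub>W\<^esub> pair_word A x \<otimes>\<^bsub>W\<^esub> Q"
      if "P \<in> carrier W" "Q \<in> carrier W" for P Q
      using xc that by (simp only: a_minus_def W.r_distr W.r_minus W.a_inv_closed)
    from cyl_word_frag_extend[where T = "\<lambda>P. pair_word A x \<otimes>\<^bsub>W\<^esub> P", OF v g[OF x] this W.r_null[OF xc]]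
    show "Poly_Mapping.keys (frag_extend (g x) v) \<subseteq> S" "E (frag_extend (g x) v) = pair_word A x \<otimes>\<^bsub>W\<^esub> E v"
      by blast+
  qed
  note vc = cyl_word_closed[OF v]
  have "(P \<ominus>\<^bsub>W\<^esub> Q) \<otimes>\<^bsub>W\<^esub> E v = P \<otimes>\<^bsub>W\<^esub> E v \<ominus>\<^bsub>W\<^esub> Q \<otimes>\<^bsub>W\<^esub> E v"
    if "P \<in> carrier W" "Q \<in> carrier W" for P Q
    using vc that by (simp only: a_minus_def W.l_distr W.l_minus W.a_inv_closed)
  from cyl_word_frag_extend[where T = "\<lambda>P. P \<otimes>\<^bsub>W\<^esub> E v", OF u inner this W.l_null[OF vc]]
  show "Poly_Mapping.keys (tensor_mult_rep C A u v) \<subseteq> S"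
    and "E (tensor_mult_rep C A u v) = E u \<otimes>\<^bsub>W\<^esub> E v"
    unfolding rep by blast+
qed

lemma diff_rep_pair:
  assumes \<phi>: "\<phi> \<in> cochain_carrier (std_simplex q)" and b: "b \<in> carrier A"
  defines "r \<equiv> frag_of (differential C \<phi>, b) +
    (\<Sum>i\<in>hsupp C \<phi>. frag_cmul (ksign i) (frag_of (hcomp C \<phi> i, differential A b)))"
  shows "Poly_Mapping.keys r \<subseteq> S" and "E r = differential W (pair_word A (\<phi>, b))"
proof -
  let ?t = "\<lambda>i. frag_cmul (ksign i) (frag_of (hcomp C \<phi> i, differential A b))"
  have pair: "(hcomp C \<phi> i, differential A b) \<in> S" for i
    using cochains_hcomp_carrier[OF \<phi>] b by simp
  have t: "Poly_Mapping.keys (?t i) \<subseteq> S" for i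
    by (rule keys_frag_cmul_subset) (use pair in simp)
  have s: "Poly_Mapping.keys (\<Sum>i\<in>hsupp C \<phi>. ?t i) \<subseteq> S"
    by (rule keys_sum_subset) (rule t)
  have d: "(differential C \<phi>, b) \<in> S" using cochain_differential_carrier[OF \<phi>] b by simp
  then have d': "Poly_Mapping.keys (frag_of (differential C \<phi>, b)) \<subseteq> S" by simp
  show r: "Poly_Mapping.keys r \<subseteq> S"
    unfolding r_def by (rule keys_add_subset[OF d' s])
  note fin = finite_cochains_hsupp[OF \<phi>]
  show "E r = differential W (pair_word A (\<phi>, b))"
  proof (rule word_cochains_eqI[OF cyl_word_closed[OF r] W.diff_closed[OF pair_word_carrier]])
    show "(\<phi>, b) \<in> S" using \<phi> b by simp
    fix w assume w: "w \<in> cyl_words q"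
    note w' = cyl_words_sorted[OF w]
    let ?n = "int (length w) - 1"
    \<comment> \<open>At \<open>w\<close> only the component of \<open>\<phi>\<close> of degree
      \<open>length w - 1\<close> is seen, and this number has the same parity as
      \<open>length w + 1\<close>.\<close>
    have E_t: "E (?t i) w = (if ?n = i then [(ksign (int (length w) + 1) * cochain_val \<phi> w)] \<cdot> differential A b else \<zero>)" for i
    proof -
      have "E (?t i) w = [ksign i] \<cdot> ([(cochain_val (hcomp C \<phi> i) w)] \<cdot> differential A b)"
        using pair[of i] by (simp add: cyl_word_cmul cyl_word_of pair_word_def)
      moreover have "ksign (int (length w) + 1) = ksign (int (length w) - 1)" by (simp add: ksign_def)
      ultimately show ?thesis using b by (auto simp: cochain_val_hcomp[OF \<phi>] zmul_zmul)
    qed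
    have "E (\<Sum>i\<in>hsupp C \<phi>. ?t i) w = (\<Oplus>i\<in>hsupp C \<phi>. E (?t i) w)"
      by (rule cyl_word_sum[OF fin t])
    also have "\<dots> = [(ksign (int (length w) + 1) * cochain_val \<phi> w)] \<cdot> differential A b"
    proof (cases "?n \<in> hsupp C \<phi>")
      case True
      then show ?thesis unfolding E_t using b by (intro finsum_singleton fin) auto
    next
      case False
      then have "cochain_val \<phi> w = 0" using cochain_val_nonzero_hsupp[OF \<phi>] by blast
      then have "(\<Oplus>i\<in>hsupp C \<phi>. E (?t i) w) = (\<Oplus>i\<in>hsupp C \<phi>. \<zero>)"
        unfolding E_t by (intro finsum_cong') auto
      with \<open>cochain_val \<phi> w = 0\<close> show ?thesis by simp
    qed
    finally have 2: "E (\<Sum>i\<in>hsupp C \<phi>. ?t i) w = [(ksign (int (length w) + 1) * cochain_val \<phi> w)] \<cdot> differential A b" .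
    have 1: "E (frag_of (differential C \<phi>, b)) w = [(int_cobd (cochain_val \<phi>) w)] \<cdot> b"
      using cochain_val_differential[of w q \<phi>] w' cyl_word_of[OF d] by (simp add: pair_word_def)
    have "E r w = E (frag_of (differential C \<phi>, b)) w \<oplus> E (\<Sum>i\<in>hsupp C \<phi>. ?t i) w"
      unfolding r_def cyl_word_add[OF d' s] ..
    also have "\<dots> = cobd A (pair_word A (\<phi>, b)) w"
      unfolding 1 2 pair_word_def prod.case by (rule cobd_zmul[OF b, symmetric])
    finally show "E r w = differential W (pair_word A (\<phi>, b)) w"
      using w by (simp add: cyl_words_def)
  qed
qed

lemma cyl_word_diff_rep:
  assumes u: "Poly_Mapping.keys u \<subseteq> S"
  shows "Poly_Mapping.keys (tensor_diff_rep C A u) \<subseteq> S"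
    and "E (tensor_diff_rep C A u) = differential W (E u)"
proof -
  define g where "g = (\<lambda>(\<phi>, b). frag_of (differential C \<phi>, b) +
    (\<Sum>i\<in>hsupp C \<phi>. frag_cmul (ksign i) (frag_of (hcomp C \<phi> i, differential A b))))"
  have g: "Poly_Mapping.keys (g x) \<subseteq> S" "E (g x) = differential W (pair_word A x)" if "x \<in> S" for x
    using that diff_rep_pair[of "fst x" "snd x"] by (auto simp: g_def split_beta)
  have rep: "tensor_diff_rep C A u = frag_extend g u"
    by (simp add: tensor_diff_rep_def g_def)
  from cyl_word_frag_extend[where T = "differential W", OF u g W.diff_diff_distrib W.diff_zero]
  show "Poly_Mapping.keys (tensor_diff_rep C A u) \<subseteq> S"
    and "E (tensor_diff_rep C A u) = differential W (E u)"
    unfolding rep by blast+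
qed

section \<open>Evaluation as an isomorphism from the cylinder to word cochains\<close>

private abbreviation "cls \<equiv> tensor_class C A"

lemma Cyl_carrier: "carrier (Cyl q A) = {cls u |u. Poly_Mapping.keys u \<subseteq> S}"
  by (auto simp: Cyl_def N_ring_def tensor_def FactGroup_def RCOSETS_def tensor_class_def tensor_free_def)

lemma Cyl_cases:
  assumes "U \<in> carrier (Cyl q A)"
  obtains u where "Poly_Mapping.keys u \<subseteq> S" "U = cls u"
  using assms by (auto simp: Cyl_carrier)

lemma tensor_class_self: "Poly_Mapping.keys u \<subseteq> S \<Longrightarrow> u \<in> cls u"
  by (simp add: tensor_class_eq)

lemma tensor_class_cong: "\<lbrakk>Poly_Mapping.keys u \<subseteq> S; Poly_Mapping.keys v \<subseteq> S; E u = E v\<rbrakk> \<Longrightarrow> cls u = cls v"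
  by (simp add: tensor_class_eq)

lemma cyl_eval_class:
  assumes "Poly_Mapping.keys u \<subseteq> S"
  shows "cyl_eval q A (cls u) = E u"
proof -
  have "(SOME v. v \<in> cls u) \<in> cls u" using tensor_class_self[OF assms] by (rule someI)
  then show ?thesis unfolding cyl_eval_def tensor_class_eq[OF assms] by blast
qed

lemma Cyl_add:
  assumes u: "Poly_Mapping.keys u \<subseteq> S" and v: "Poly_Mapping.keys v \<subseteq> S"
  shows "cls u \<oplus>\<^bsub>Cyl q A\<^esub> cls v = cls (u + v)"
proof -
  have "cls u \<oplus>\<^bsub>Cyl q A\<^esub> cls v = (\<Union>h\<in>cls u. \<Union>k\<in>cls v. {h + k})"
    by (simp add: Cyl_def N_ring_def tensor_def FactGroup_def set_mult_def tensor_free_def)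
  also have "\<dots> = cls (u + v)"
  proof (intro subset_antisym subsetI)
    fix w assume "w \<in> (\<Union>h\<in>cls u. \<Union>k\<in>cls v. {h + k})"
    then obtain h k where hk: "h \<in> cls u" "k \<in> cls v" "w = h + k" by blast
    then have "Poly_Mapping.keys h \<subseteq> S" "Poly_Mapping.keys k \<subseteq> S" "E h = E u" "E k = E v"
      using u v by (simp_all add: tensor_class_eq)
    with hk(3) u v show "w \<in> cls (u + v)"
      by (simp add: tensor_class_eq keys_add_subset cyl_word_add)
  next
    fix w assume "w \<in> cls (u + v)"
    then have w: "Poly_Mapping.keys w \<subseteq> S" "E w = (\<lambda>x. E u x \<oplus> E v x)"
      using u v by (simp_all add: tensor_class_eq keys_add_subset cyl_word_add)
    have "E (w - u) x = E v x" for x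
      unfolding cyl_word_diff_val[OF w(1) u] w(2)
      using cyl_word_val_closed[OF u, of x] cyl_word_val_closed[OF v, of x]
      by (simp add: minus_eq_iff a_comm)
    then have "w - u \<in> cls v"
      using w(1) u v by (auto simp: tensor_class_eq keys_diff_subset)
    moreover have "w = u + (w - u)" by simp
    ultimately show "w \<in> (\<Union>h\<in>cls u. \<Union>k\<in>cls v. {h + k})"
      using tensor_class_self[OF u] by blast
  qed
  finally show ?thesis .
qed

lemma Cyl_mult:
  assumes u: "Poly_Mapping.keys u \<subseteq> S" and v: "Poly_Mapping.keys v \<subseteq> S"
  shows "cls u \<otimes>\<^bsub>Cyl q A\<^esub> cls v = cls (tensor_mult_rep C A u v)"
proof -
  have "cls u \<otimes>\<^bsub>Cyl q A\<^esub> cls v = (\<Union>h\<in>cls u. \<Union>k\<in>cls v. cls (tensor_mult_rep C A h k))"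
    by (simp add: Cyl_def N_ring_def tensor_def Let_def)
  also have "\<dots> = (\<Union>h\<in>cls u. \<Union>k\<in>cls v. cls (tensor_mult_rep C A u v))"
  proof (intro SUP_cong refl tensor_class_cong)
    fix h k assume "h \<in> cls u" "k \<in> cls v"
    then have hk: "Poly_Mapping.keys h \<subseteq> S" "Poly_Mapping.keys k \<subseteq> S" "E h = E u" "E k = E v"
      using u v by (simp_all add: tensor_class_eq)
    show "Poly_Mapping.keys (tensor_mult_rep C A h k) \<subseteq> S" "Poly_Mapping.keys (tensor_mult_rep C A u v) \<subseteq> S"
      by (intro cyl_word_mult_rep hk u v)+
    show "E (tensor_mult_rep C A h k) = E (tensor_mult_rep C A u v)"
      unfolding cyl_word_mult_rep(2)[OF hk(1,2)] cyl_word_mult_rep(2)[OF u v] hk(3,4) ..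
  qed
  also have "\<dots> = cls (tensor_mult_rep C A u v)"
    using tensor_class_self[OF u] tensor_class_self[OF v] by blast
  finally show ?thesis .
qed

lemma Cyl_differential:
  assumes u: "Poly_Mapping.keys u \<subseteq> S"
  shows "differential (Cyl q A) (cls u) = cls (tensor_diff_rep C A u)"
proof -
  have "differential (Cyl q A) (cls u) = (\<Union>h\<in>cls u. cls (tensor_diff_rep C A h))"
    by (simp add: Cyl_def N_ring_def tensor_def Let_def)
  also have "\<dots> = (\<Union>h\<in>cls u. cls (tensor_diff_rep C A u))"
  proof (intro SUP_cong refl tensor_class_cong)
    fix h assume "h \<in> cls u"
    then have h: "Poly_Mapping.keys h \<subseteq> S" "E h = E u"
      using u by (simp_all add: tensor_class_eq)
    show "Poly_Mapping.keys (tensor_diff_rep C A h) \<subseteq> S" "Poly_Mapping.keys (tensor_diff_rep C A u) \<subseteq> S"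
      by (intro cyl_word_diff_rep h u)+
    show "E (tensor_diff_rep C A h) = E (tensor_diff_rep C A u)"
      unfolding cyl_word_diff_rep(2)[OF h(1)] cyl_word_diff_rep(2)[OF u] h(2) ..
  qed
  also have "\<dots> = cls (tensor_diff_rep C A u)"
    using tensor_class_self[OF u] by blast
  finally show ?thesis .
qed

lemma Cyl_one: "\<one>\<^bsub>Cyl q A\<^esub> = cls (frag_of (\<one>\<^bsub>C\<^esub>, \<one>))"
  by (simp add: Cyl_def N_ring_def tensor_def Let_def)

lemma one_pair: "(\<one>\<^bsub>C\<^esub>, \<one>) \<in> S"
  using cochain_one_carrier by (simp del: cochains_sel)

lemma cyl_eval_closed: "U \<in> carrier (Cyl q A) \<Longrightarrow> cyl_eval q A U \<in> carrier W"
  by (erule Cyl_cases) (simp only: cyl_eval_class cyl_word_closed)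

lemma cyl_eval_mult:
  assumes "U \<in> carrier (Cyl q A)" "V \<in> carrier (Cyl q A)"
  shows "U \<otimes>\<^bsub>Cyl q A\<^esub> V \<in> carrier (Cyl q A)"
    and "cyl_eval q A (U \<otimes>\<^bsub>Cyl q A\<^esub> V) = cyl_eval q A U \<otimes>\<^bsub>W\<^esub> cyl_eval q A V"
proof -
  obtain u v where u: "Poly_Mapping.keys u \<subseteq> S" "U = cls u" and v: "Poly_Mapping.keys v \<subseteq> S" "V = cls v"
    using assms by (auto elim!: Cyl_cases)
  note m = cyl_word_mult_rep[OF u(1) v(1)]
  show "U \<otimes>\<^bsub>Cyl q A\<^esub> V \<in> carrier (Cyl q A)"
    unfolding u(2) v(2) Cyl_mult[OF u(1) v(1)] Cyl_carrier using m(1) by blast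
  show "cyl_eval q A (U \<otimes>\<^bsub>Cyl q A\<^esub> V) = cyl_eval q A U \<otimes>\<^bsub>W\<^esub> cyl_eval q A V"
    unfolding u(2) v(2) Cyl_mult[OF u(1) v(1)] cyl_eval_class[OF m(1)] m(2)
      cyl_eval_class[OF u(1)] cyl_eval_class[OF v(1)] ..
qed

lemma cyl_eval_add:
  assumes "U \<in> carrier (Cyl q A)" "V \<in> carrier (Cyl q A)"
  shows "U \<oplus>\<^bsub>Cyl q A\<^esub> V \<in> carrier (Cyl q A)"
    and "cyl_eval q A (U \<oplus>\<^bsub>Cyl q A\<^esub> V) = cyl_eval q A U \<oplus>\<^bsub>W\<^esub> cyl_eval q A V"
proof -
  obtain u v where u: "Poly_Mapping.keys u \<subseteq> S" "U = cls u" and v: "Poly_Mapping.keys v \<subseteq> S" "V = cls v"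
    using assms by (auto elim!: Cyl_cases)
  note k = keys_add_subset[OF u(1) v(1)]
  show "U \<oplus>\<^bsub>Cyl q A\<^esub> V \<in> carrier (Cyl q A)"
    unfolding u(2) v(2) Cyl_add[OF u(1) v(1)] Cyl_carrier using k by blast
  show "cyl_eval q A (U \<oplus>\<^bsub>Cyl q A\<^esub> V) = cyl_eval q A U \<oplus>\<^bsub>W\<^esub> cyl_eval q A V"
    unfolding u(2) v(2) Cyl_add[OF u(1) v(1)] cyl_eval_class[OF k]
      cyl_eval_class[OF u(1)] cyl_eval_class[OF v(1)] cyl_word_add[OF u(1) v(1)] by simp
qed

lemma cyl_eval_differential:
  assumes "U \<in> carrier (Cyl q A)"
  shows "differential (Cyl q A) U \<in> carrier (Cyl q A)"
    and "cyl_eval q A (differential (Cyl q A) U) = differential W (cyl_eval q A U)"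
proof -
  obtain u where u: "Poly_Mapping.keys u \<subseteq> S" "U = cls u" using assms by (rule Cyl_cases)
  note d = cyl_word_diff_rep[OF u(1)]
  show "differential (Cyl q A) U \<in> carrier (Cyl q A)"
    unfolding u(2) Cyl_differential[OF u(1)] Cyl_carrier using d(1) by blast
  show "cyl_eval q A (differential (Cyl q A) U) = differential W (cyl_eval q A U)"
    unfolding u(2) Cyl_differential[OF u(1)] cyl_eval_class[OF d(1)] d(2) cyl_eval_class[OF u(1)] ..
qed

lemma cyl_eval_one:
  shows "\<one>\<^bsub>Cyl q A\<^esub> \<in> carrier (Cyl q A)" and "cyl_eval q A \<one>\<^bsub>Cyl q A\<^esub> = \<one>\<^bsub>W\<^esub>"
proof -
  have k: "Poly_Mapping.keys (frag_of (\<one>\<^bsub>C\<^esub>, \<one>)) \<subseteq> S" using one_pair by (simp del: cochains_sel)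
  show "\<one>\<^bsub>Cyl q A\<^esub> \<in> carrier (Cyl q A)" unfolding Cyl_one Cyl_carrier using k by blast
  show "cyl_eval q A \<one>\<^bsub>Cyl q A\<^esub> = \<one>\<^bsub>W\<^esub>"
    unfolding Cyl_one cyl_eval_class[OF k] cyl_word_of[OF one_pair] pair_word_def prod.case cochain_val_one
    by (simp add: fun_eq_iff)
qed

text \<open>The normal form of \<open>tensor_normal_form\<close> with prescribed values, which
  provides a section of evaluation.\<close>

definition word_rep :: "(nat list \<Rightarrow> 'a) \<Rightarrow> ((nat \<Rightarrow> (nat \<Rightarrow> nat) \<Rightarrow> int) \<times> 'a) \<Rightarrow>\<^sub>0 int" where
  "word_rep P = (\<Sum>w\<in>cyl_words q. frag_of (delta_cochain q w, P w))"

lemma word_rep: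
  assumes P: "P \<in> carrier W"
  shows "Poly_Mapping.keys (word_rep P) \<subseteq> S" and "E (word_rep P) = P"
proof -
  have Pc: "P w \<in> carrier A" for w using P by (simp add: word_cochains_carrier)
  have pair: "(delta_cochain q w, P w) \<in> S" if "w \<in> cyl_words q" for w
    using delta_cochain_carrier[OF that] Pc by simp
  show k: "Poly_Mapping.keys (word_rep P) \<subseteq> S"
    unfolding word_rep_def by (rule keys_sum_subset) (use pair in simp)
  show "E (word_rep P) = P"
  proof (rule word_cochains_eqI[OF cyl_word_closed[OF k] P])
    fix v assume v: "v \<in> cyl_words q"
    have "E (word_rep P) v = (\<Oplus>w\<in>cyl_words q. E (frag_of (delta_cochain q w, P w)) v)"
      unfolding word_rep_def by (rule cyl_word_sum[OF finite_cyl_words]) (use pair in simp)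
    also have "\<dots> = (\<Oplus>w\<in>cyl_words q. if v = w then P w else \<zero>)"
      by (rule finsum_cong') (auto simp: cyl_word_of[OF pair] pair_word_def delta_cochain_val Pc)
    also have "\<dots> = P v" by (rule finsum_singleton[OF v finite_cyl_words]) (simp add: Pc)
    finally show "E (word_rep P) v = P v" .
  qed
qed

lemma cyl_eval_bij: "bij_betw (cyl_eval q A) (carrier (Cyl q A)) (carrier W)"
proof (rule bij_betw_imageI)
  show "inj_on (cyl_eval q A) (carrier (Cyl q A))"
  proof (rule inj_onI)
    fix U V assume "U \<in> carrier (Cyl q A)" "V \<in> carrier (Cyl q A)" and eq: "cyl_eval q A U = cyl_eval q A V"
    then obtain u v where u: "Poly_Mapping.keys u \<subseteq> S" "U = cls u" and v: "Poly_Mapping.keys v \<subseteq> S" "V = cls v"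
      by (auto elim!: Cyl_cases)
    from eq have "E u = E v" unfolding u(2) v(2) cyl_eval_class[OF u(1)] cyl_eval_class[OF v(1)] .
    then show "U = V" unfolding u(2) v(2) by (rule tensor_class_cong[OF u(1) v(1)])
  qed
  show "cyl_eval q A ` carrier (Cyl q A) = carrier W"
  proof (intro subset_antisym subsetI)
    fix P assume P: "P \<in> carrier W"
    have "cls (word_rep P) \<in> carrier (Cyl q A)" unfolding Cyl_carrier using word_rep(1)[OF P] by blast
    moreover have "cyl_eval q A (cls (word_rep P)) = P"
      using cyl_eval_class[OF word_rep(1)[OF P]] word_rep(2)[OF P] by simp
    ultimately show "P \<in> cyl_eval q A ` carrier (Cyl q A)" by (metis imageI)
  qed (use cyl_eval_closed in blast)
qed

text \<open>A generator \<open>a\<close> tensor \<open>b\<close> with \<open>a\<close> of degree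
  \<open>j\<close> is supported on words of length \<open>j + 1\<close>, which gives one inclusion.
  Conversely the summand of the normal form at \<open>w\<close> has degrees
  \<open>length w - 1\<close> and \<open>i + 1 - length w\<close>, which add up to
  \<open>i\<close>.\<close>

lemma cyl_eval_grd: "grd (Cyl q A) i = {U \<in> carrier (Cyl q A). cyl_eval q A U \<in> grd W i}"
proof -
  let ?Q = "tensor_free C A Mod tensor_rel C A"
  let ?G = "{cls (frag_of (a, b)) |a b. \<exists>j k. j + k = i \<and> a \<in> grd C j \<and> b \<in> grd A k}"
  have Q: "carrier ?Q = carrier (Cyl q A)" "mult ?Q = add (Cyl q A)" "\<one>\<^bsub>?Q\<^esub> = \<zero>\<^bsub>Cyl q A\<^esub>"
    and grd: "grd (Cyl q A) i = generate ?Q ?G"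
    by (simp_all add: Cyl_def N_ring_def tensor_def Let_def)
  have z: "\<one>\<^bsub>?Q\<^esub> = cls 0"
    by (auto simp: FactGroup_def tensor_class_def r_coset_def tensor_free_def)
  have "tensor_rel C A \<lhd> tensor_free C A"
    unfolding tensor_free_def cochains_sel(1)
    by (rule comm_group.subgroup_imp_normal[OF abelian_free_Abelian_group tensor_rel_subgroup])
  then have Qg: "group ?Q" by (rule normal.factorgroup_is_group)
  have hom: "cyl_eval q A \<in> hom ?Q (add_monoid W)"
    unfolding hom_def Q using cyl_eval_closed cyl_eval_add(2) by simp
  interpret group_hom ?Q "add_monoid W" "cyl_eval q A"
    by (intro group_hom.intro group_hom_axioms.intro Qg W.a_group hom)
  have gens: "cls (frag_of (a, b)) \<in> carrier (Cyl q A) \<and> cyl_eval q A (cls (frag_of (a, b))) \<in> grd W i"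
    if "j + k = i" "a \<in> grd C j" "b \<in> grd A k" for a b j k
  proof -
    have ab: "(a, b) \<in> S" using that(2,3) grd_closed by simp
    then have key: "Poly_Mapping.keys (frag_of (a, b)) \<subseteq> S" by simp
    have "pair_word A (a, b) w \<in> grd A (i + 1 - int (length w))" for w
    proof (cases "w \<noteq> [] \<and> int (length w - 1) = j")
      case True
      then have "i + 1 - int (length w) = k" using that(1) by (cases w) auto
      then show ?thesis using that(3) by (simp add: pair_word_def zmul_grd)
    next
      case False
      then have "cochain_val a w = 0" using that(2) by (auto simp: cochain_val_def)
      then show ?thesis by (simp add: pair_word_def)
    qed
    then have "pair_word A (a, b) \<in> grd W i"
      using pair_word_carrier[OF ab] unfolding word_cochains_carrier word_cochains_grd by blast
    with key show ?thesis unfolding cyl_eval_class[OF key] cyl_word_of[OF ab] Cyl_carrier by blast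
  qed
  have sub: "generate ?Q ?G \<subseteq> {U \<in> carrier (Cyl q A). cyl_eval q A U \<in> grd W i}"
  proof (rule group.generate_subgroup_incl[OF Qg])
    show "?G \<subseteq> {U \<in> carrier (Cyl q A). cyl_eval q A U \<in> grd W i}" using gens by blast
    have "subgroup {U \<in> carrier ?Q. cyl_eval q A U \<in> grd W i} ?Q"
    proof (rule group.subgroupI[OF Qg])
      have "\<one>\<^bsub>?Q\<^esub> \<in> {U \<in> carrier ?Q. cyl_eval q A U \<in> grd W i}"
        using subgroup.one_closed[OF W.grd_subgroup[of i]]
        by (intro CollectI conjI G.one_closed) (simp only: hom_one)
      then show "{U \<in> carrier ?Q. cyl_eval q A U \<in> grd W i} \<noteq> {}" by blast
    next
      fix U assume "U \<in> {U \<in> carrier ?Q. cyl_eval q A U \<in> grd W i}"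
      then have U: "U \<in> carrier ?Q" "cyl_eval q A U \<in> grd W i" by blast+
      show "inv\<^bsub>?Q\<^esub> U \<in> {U \<in> carrier ?Q. cyl_eval q A U \<in> grd W i}"
        using subgroup.m_inv_closed[OF W.grd_subgroup U(2)]
        by (intro CollectI conjI G.inv_closed U(1)) (simp only: hom_inv[OF U(1)])
    next
      fix U V
      assume "U \<in> {U \<in> carrier ?Q. cyl_eval q A U \<in> grd W i}" "V \<in> {U \<in> carrier ?Q. cyl_eval q A U \<in> grd W i}"
      then have U: "U \<in> carrier ?Q" "cyl_eval q A U \<in> grd W i" and V: "V \<in> carrier ?Q" "cyl_eval q A V \<in> grd W i"
        by blast+
      show "U \<otimes>\<^bsub>?Q\<^esub> V \<in> {U \<in> carrier ?Q. cyl_eval q A U \<in> grd W i}"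
        using subgroup.m_closed[OF W.grd_subgroup U(2) V(2)]
        by (intro CollectI conjI G.m_closed U(1) V(1)) (simp only: hom_mult[OF U(1) V(1)])
    qed blast
    then show "subgroup {U \<in> carrier (Cyl q A). cyl_eval q A U \<in> grd W i} ?Q" unfolding Q .
  qed
  have "U \<in> generate ?Q ?G" if U: "U \<in> carrier (Cyl q A)" and g: "cyl_eval q A U \<in> grd W i" for U
  proof -
    let ?P = "cyl_eval q A U"
    have Pc: "?P \<in> carrier W" using cyl_eval_closed[OF U] .
    have "cls (\<Sum>w\<in>I. frag_of (delta_cochain q w, ?P w)) \<in> generate ?Q ?G" if "I \<subseteq> cyl_words q" for I
      using finite_subset[OF that finite_cyl_words] that
    proof (induction I rule: finite_induct)
      case empty
      show ?case unfolding sum.empty z[symmetric] by (rule generate.one)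
    next
      case (insert w I)
      have w: "w \<in> cyl_words q" using insert.prems by simp
      have len: "length w \<noteq> 0" using w by (simp add: cyl_words_def)
      have d: "delta_cochain q w \<in> grd C (int (length w) - 1)"
        using delta_cochain_carrier[OF w] len
        by (auto simp: delta_cochain_def word_cochain_def)
      have "?P w \<in> grd A (i + 1 - int (length w))" using g by (simp add: word_cochains_grd)
      with d have 1: "cls (frag_of (delta_cochain q w, ?P w)) \<in> generate ?Q ?G"
        by (intro generate.incl CollectI exI[of _ "delta_cochain q w"] exI[of _ "?P w"] conjI refl
            exI[of _ "int (length w) - 1"] exI[of _ "i + 1 - int (length w)"]) simp_all
      have pair: "(delta_cochain q v, ?P v) \<in> S" if "v \<in> cyl_words q" for v
        using delta_cochain_carrier[OF that] Pc by (simp add: word_cochains_carrier)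
      have k1: "Poly_Mapping.keys (frag_of (delta_cochain q w, ?P w)) \<subseteq> S" using pair[OF w] by simp
      have k2: "Poly_Mapping.keys (\<Sum>w\<in>I. frag_of (delta_cochain q w, ?P w)) \<subseteq> S"
        by (rule keys_sum_subset) (use pair insert.prems in auto)
      have "cls (\<Sum>w\<in>I. frag_of (delta_cochain q w, ?P w)) \<in> generate ?Q ?G" using insert by simp
      from generate.eng[OF 1 this, unfolded Q(2) Cyl_add[OF k1 k2]] show ?case
        unfolding sum.insert[OF insert.hyps] .
    qed
    from this[OF subset_refl] have "cls (word_rep ?P) \<in> generate ?Q ?G" by (simp add: word_rep_def)
    moreover have "cls (word_rep ?P) = U"
    proof -
      obtain u where u: "Poly_Mapping.keys u \<subseteq> S" "U = cls u" using U by (rule Cyl_cases)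
      show ?thesis
        using word_rep[OF Pc] cyl_eval_class[OF u(1)] unfolding u(2)
        by (intro tensor_class_cong u(1)) simp_all
    qed
    ultimately show ?thesis by simp
  qed
  with sub show ?thesis unfolding grd by blast
qed

end

section \<open>Naturality of evaluation in the simplex\<close>

lemma cyl_word_map:
  assumes \<theta>: "\<theta> \<in> mono_maps m n" and u: "Poly_Mapping.keys u \<subseteq> cyl_pairs n A"
  defines "f \<equiv> \<lambda>(\<phi>, b). frag_of (cochain_map (std_simplex m) (std_simplex_map \<theta>) \<phi>, b)"
  shows "Poly_Mapping.keys (frag_extend f u) \<subseteq> cyl_pairs m A"
    and "cyl_word m A (frag_extend f u) = word_pull A m \<theta> (cyl_word n A u)"
proof -
  note rings = ring_word_cochains[of n] ring_word_cochains[of m]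
  note pull = word_pull_hom(1)[OF \<theta>]
  have f: "Poly_Mapping.keys (f x) \<subseteq> cyl_pairs m A" "cyl_word m A (f x) = word_pull A m \<theta> (pair_word A x)"
    if "x \<in> cyl_pairs n A" for x
  proof -
    from that obtain \<phi> b where x: "x = (\<phi>, b)" "\<phi> \<in> cochain_carrier (std_simplex n)" "b \<in> carrier A" by auto
    let ?\<phi> = "cochain_map (std_simplex m) (std_simplex_map \<theta>) \<phi>"
    have y: "(?\<phi>, b) \<in> cyl_pairs m A" using cochain_map_carrier[OF \<theta> x(2)] x(3) by simp
    then show "Poly_Mapping.keys (f x) \<subseteq> cyl_pairs m A" by (simp add: f_def x(1))
    have "pair_word A (?\<phi>, b) = word_pull A m \<theta> (pair_word A (\<phi>, b))"
    proof (rule word_cochains_eqI[OF pair_word_carrier[OF y]])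
      show "word_pull A m \<theta> (pair_word A (\<phi>, b)) \<in> carrier (word_cochains m A)"
        using x by (intro ring_hom_closed[OF pull] pair_word_carrier) simp
      fix w assume w: "w \<in> cyl_words m"
      then have "cochain_val ?\<phi> w = cochain_val \<phi> (map \<theta> w)"
        using cyl_words_sorted[OF w] by (intro cochain_val_map) auto
      with w show "pair_word A (?\<phi>, b) w = word_pull A m \<theta> (pair_word A (\<phi>, b)) w"
        by (simp add: pair_word_def word_pull_def cyl_words_def)
    qed
    then show "cyl_word m A (f x) = word_pull A m \<theta> (pair_word A x)"
      using cyl_word_of[OF y] x(1) by (simp add: f_def)
  qed
  from cyl_word_frag_extend[where T = "word_pull A m \<theta>", OF u f ring_hom_diff[OF pull rings] ring_hom_zero[OF pull rings]]
  show "Poly_Mapping.keys (frag_extend f u) \<subseteq> cyl_pairs m A"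
    and "cyl_word m A (frag_extend f u) = word_pull A m \<theta> (cyl_word n A u)"
    by blast+
qed

lemma cyl_eval_act:
  assumes \<theta>: "\<theta> \<in> mono_maps m n" and U: "U \<in> carrier (Cyl n A)"
  shows "Cyl_act m \<theta> A U \<in> carrier (Cyl m A)"
    and "cyl_eval m A (Cyl_act m \<theta> A U) = word_pull A m \<theta> (cyl_eval n A U)"
proof -
  let ?cls = "tensor_class (cochains (std_simplex m)) A"
  define f where "f = (\<lambda>(\<phi>, b :: 'a). frag_of (cochain_map (std_simplex m) (std_simplex_map \<theta>) \<phi>, b))"
  obtain u where u: "Poly_Mapping.keys u \<subseteq> cyl_pairs n A" "U = tensor_class (cochains (std_simplex n)) A u"
    using U by (rule Cyl_cases)
  note f = cyl_word_map[OF \<theta>, folded f_def]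
  have "Cyl_act m \<theta> A U = (\<Union>v\<in>U. ?cls (frag_extend f v))"
    by (simp add: Cyl_act_def N_map_def tensor_map_def f_def)
  also have "\<dots> = (\<Union>v\<in>U. ?cls (frag_extend f u))"
  proof (intro SUP_cong refl tensor_class_cong)
    fix v assume "v \<in> U"
    then have v: "Poly_Mapping.keys v \<subseteq> cyl_pairs n A" "cyl_word n A v = cyl_word n A u"
      using u by (simp_all add: tensor_class_eq)
    show "Poly_Mapping.keys (frag_extend f v) \<subseteq> cyl_pairs m A" "Poly_Mapping.keys (frag_extend f u) \<subseteq> cyl_pairs m A"
      by (rule f(1)[OF v(1)], rule f(1)[OF u(1)])
    show "cyl_word m A (frag_extend f v) = cyl_word m A (frag_extend f u)"
      unfolding f(2)[OF v(1)] f(2)[OF u(1)] v(2) ..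
  qed
  also have "\<dots> = ?cls (frag_extend f u)"
    using tensor_class_self[OF u(1)] u(2) by blast
  finally have eq: "Cyl_act m \<theta> A U = ?cls (frag_extend f u)" .
  show "Cyl_act m \<theta> A U \<in> carrier (Cyl m A)"
    unfolding eq Cyl_carrier using f(1)[OF u(1)] by blast
  have "cyl_eval n A U = cyl_word n A u"
    unfolding u(2) by (rule cyl_eval_class[OF u(1)])
  moreover have "cyl_eval m A (Cyl_act m \<theta> A U) = cyl_word m A (frag_extend f u)"
    unfolding eq by (rule cyl_eval_class[OF f(1)[OF u(1)]])
  ultimately show "cyl_eval m A (Cyl_act m \<theta> A U) = word_pull A m \<theta> (cyl_eval n A U)"
    using f(2)[OF u(1)] by simp
qed

lemma cyl_eval_hom:
  "cyl_eval q A \<in> ring_hom (Cyl q A) (word_cochains q A)"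
  by (rule ring_hom_memI[OF cyl_eval_closed cyl_eval_mult(2) cyl_eval_add(2) cyl_eval_one(2)])

text \<open>\<open>cyl_eval\<close> is a bijection respecting all operations, and these stay inside
  the carrier of \<open>Cyl q A\<close>; so the inverse respects them too, without ring laws in the
  cylinder.\<close>

lemma cyl_eval_inv_hom:
  defines "e \<equiv> \<lambda>q. inv_into (carrier (Cyl q A)) (cyl_eval q A)"
  shows "e q \<in> ring_hom (word_cochains q A) (Cyl q A)"
    and "P \<in> grd (word_cochains q A) i \<Longrightarrow> e q P \<in> grd (Cyl q A) i"
    and "P \<in> carrier (word_cochains q A) \<Longrightarrow>
      e q (differential (word_cochains q A) P) = differential (Cyl q A) (e q P)"
proof -
  let ?W = "word_cochains q A" and ?Z = "Cyl q A"
  have eq: "e q (cyl_eval q A U) = U" if "U \<in> carrier ?Z" for U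
    unfolding e_def using that bij_betw_imp_inj_on[OF cyl_eval_bij] by (simp add: inv_into_f_f)
  have ex: "\<exists>U\<in>carrier ?Z. P = cyl_eval q A U" if "P \<in> carrier ?W" for P
    using that bij_betw_imp_surj_on[OF cyl_eval_bij, of q] by blast
  show "e q \<in> ring_hom ?W ?Z"
  proof (rule ring_hom_memI)
    fix P Q assume "P \<in> carrier ?W" "Q \<in> carrier ?W"
    then obtain U V where U: "U \<in> carrier ?Z" "P = cyl_eval q A U" and V: "V \<in> carrier ?Z" "Q = cyl_eval q A V"
      using ex by meson
    show "e q P \<in> carrier ?Z" using eq U by simp
    show "e q (P \<otimes>\<^bsub>?W\<^esub> Q) = e q P \<otimes>\<^bsub>?Z\<^esub> e q Q"
      unfolding U(2) V(2) cyl_eval_mult(2)[OF U(1) V(1), symmetric] eq[OF U(1)] eq[OF V(1)]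
      by (rule eq[OF cyl_eval_mult(1)[OF U(1) V(1)]])
    show "e q (P \<oplus>\<^bsub>?W\<^esub> Q) = e q P \<oplus>\<^bsub>?Z\<^esub> e q Q"
      unfolding U(2) V(2) cyl_eval_add(2)[OF U(1) V(1), symmetric] eq[OF U(1)] eq[OF V(1)]
      by (rule eq[OF cyl_eval_add(1)[OF U(1) V(1)]])
  next
    show "e q \<one>\<^bsub>?W\<^esub> = \<one>\<^bsub>?Z\<^esub>"
      unfolding cyl_eval_one(2)[symmetric] by (rule eq[OF cyl_eval_one(1)])
  qed
  show "e q P \<in> grd ?Z i" if P: "P \<in> grd ?W i"
  proof -
    obtain U where U: "U \<in> carrier ?Z" "P = cyl_eval q A U"
      using ex[OF word_cochains_grd_closed[OF P]] by blast
    with P show ?thesis unfolding U(2) eq[OF U(1)] cyl_eval_grd by blast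
  qed
  show "e q (differential ?W P) = differential ?Z (e q P)" if P: "P \<in> carrier ?W"
  proof -
    obtain U where U: "U \<in> carrier ?Z" "P = cyl_eval q A U" using ex[OF P] by blast
    show ?thesis
      unfolding U(2) eq[OF U(1)] cyl_eval_differential(2)[OF U(1), symmetric]
      by (rule eq[OF cyl_eval_differential(1)[OF U(1)]])
  qed
qed

lemma dg_hom_Cyl_bij:
  assumes R: "predg_ring R"
  shows "bij_betw (compose (carrier R) (cyl_eval q A)) (dg_hom R (Cyl q A)) (dg_hom R (word_cochains q A))"
proof (rule bij_betw_byWitness[where f' = "compose (carrier R) (inv_into (carrier (Cyl q A)) (cyl_eval q A))"])
  let ?e = "inv_into (carrier (Cyl q A)) (cyl_eval q A)"
  have inv: "?e (cyl_eval q A U) = U" if "U \<in> carrier (Cyl q A)" for U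
    using that bij_betw_imp_inj_on[OF cyl_eval_bij] by (simp add: inv_into_f_f)
  have inv': "cyl_eval q A (?e P) = P" if "P \<in> carrier (word_cochains q A)" for P
    using that bij_betw_imp_surj_on[OF cyl_eval_bij, of q] by (intro f_inv_into_f) simp
  show "\<forall>f\<in>dg_hom R (Cyl q A). compose (carrier R) ?e (compose (carrier R) (cyl_eval q A) f) = f"
  proof (rule ballI, rule ext)
    fix f a assume f: "f \<in> dg_hom R (Cyl q A)"
    show "compose (carrier R) ?e (compose (carrier R) (cyl_eval q A) f) a = f a"
    proof (cases "a \<in> carrier R")
      case True
      then show ?thesis using inv[OF dg_hom_closed[OF f True]] by (simp add: compose_def)
    next
      case False
      then show ?thesis using extensional_arb[OF dg_hom_extensional[OF f] False] by (simp add: compose_def)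
    qed
  qed
  show "\<forall>f\<in>dg_hom R (word_cochains q A). compose (carrier R) (cyl_eval q A) (compose (carrier R) ?e f) = f"
  proof (rule ballI, rule ext)
    fix f a assume f: "f \<in> dg_hom R (word_cochains q A)"
    show "compose (carrier R) (cyl_eval q A) (compose (carrier R) ?e f) a = f a"
    proof (cases "a \<in> carrier R")
      case True
      then show ?thesis using inv'[OF dg_hom_closed[OF f True]] by (simp add: compose_def)
    next
      case False
      then show ?thesis using extensional_arb[OF dg_hom_extensional[OF f] False] by (simp add: compose_def)
    qed
  qed
  show "compose (carrier R) (cyl_eval q A) ` dg_hom R (Cyl q A) \<subseteq> dg_hom R (word_cochains q A)"
  proof (rule image_subsetI)
    fix f assume f: "f \<in> dg_hom R (Cyl q A)"
    show "compose (carrier R) (cyl_eval q A) f \<in> dg_hom R (word_cochains q A)"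
      by (rule dg_hom_compose[OF R f cyl_eval_hom])
        (auto simp only: cyl_eval_grd mem_Collect_eq cyl_eval_differential)
  qed
  show "compose (carrier R) ?e ` dg_hom R (word_cochains q A) \<subseteq> dg_hom R (Cyl q A)"
  proof (rule image_subsetI)
    fix f assume f: "f \<in> dg_hom R (word_cochains q A)"
    show "compose (carrier R) ?e f \<in> dg_hom R (Cyl q A)"
      by (rule dg_hom_compose[OF R f cyl_eval_inv_hom(1)]; rule cyl_eval_inv_hom)
  qed
qed

end

section \<open>Transfer to the simplicial set of homomorphisms\<close>

text \<open>\<open>X\<close> is not assumed to be a simplicial set: its identities are those of
  \<open>Y\<close>, pulled back along the injections \<open>e n\<close>. Horns are pushed forward to
  \<open>Y\<close>, filled there, and the filler is brought back by the inverses.\<close>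

lemma kan_complex_transfer:
  assumes Y: "kan_complex Y"
    and e: "\<And>n. bij_betw (e n) (simplices X n) (simplices Y n)"
    and act: "\<And>m n \<theta> x. \<lbrakk>\<theta> \<in> mono_maps m n; x \<in> simplices X n\<rbrakk> \<Longrightarrow>
      act X m n \<theta> x \<in> simplices X m \<and> e m (act X m n \<theta> x) = act Y m n \<theta> (e n x)"
  shows "kan_complex X"
proof -
  interpret Y: kan_complex Y by fact
  have closed: "e n x \<in> simplices Y n" if "x \<in> simplices X n" for n x
    using bij_betwE[OF e] that by blast
  have inj: "x = y" if "x \<in> simplices X n" "y \<in> simplices X n" "e n x = e n y" for n x y
    using bij_betw_imp_inj_on[OF e] that by (meson inj_onD)
  define e' where "e' n = inv_into (simplices X n) (e n)" for n
  have e': "e' n y \<in> simplices X n" "e n (e' n y) = y" if "y \<in> simplices Y n" for n y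
    unfolding e'_def using that bij_betw_imp_surj_on[OF e, of n] by (simp_all add: inv_into_into f_inv_into_f)
  have e'e: "e' n (e n x) = x" if "x \<in> simplices X n" for n x
    using e'[OF closed[OF that]] that by (intro inj[where n = n])
  have id: "(\<lambda>i\<in>{..n}. i) \<in> mono_maps n n" for n :: nat
    by (auto simp: mono_maps_def intro!: mono_onI)
  show ?thesis
  proof
    fix m n \<theta> x assume "\<theta> \<in> mono_maps m n" "x \<in> simplices X n"
    then show "act X m n \<theta> x \<in> simplices X m" using act by blast
  next
    fix n x assume x: "x \<in> simplices X n"
    show "act X n n (\<lambda>i\<in>{..n}. i) x = x"
      using act[OF id x] Y.act_id[OF closed[OF x]] x by (intro inj[where n = n]) simp_all
  next
    fix \<eta> l m \<theta> n x assume h: "\<eta> \<in> mono_maps l m" "\<theta> \<in> mono_maps m n" and x: "x \<in> simplices X n"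
    note 1 = act[OF compose_mono_maps[OF h] x] and 2 = act[OF h(2) x]
    note 3 = act[OF h(1) conjunct1[OF 2]]
    show "act X l n (compose {..l} \<theta> \<eta>) x = act X l m \<eta> (act X m n \<theta> x)"
      using 1 2 3 Y.act_comp[OF h closed[OF x]] by (intro inj[where n = l]) simp_all
  next
    fix n k f assume n: "1 \<le> n" "k \<le> n" and f: "simplicial_map (horn n k) X f"
    have fX: "f p x \<in> simplices X p" if "x \<in> simplices (horn n k) p" for p x
      using f that by (auto simp: simplicial_map_def)
    have "simplicial_map (horn n k) Y (\<lambda>p x. e p (f p x))"
      unfolding simplicial_map_def
    proof (intro conjI allI ballI)
      show "(\<lambda>x. e p (f p x)) \<in> simplices (horn n k) p \<rightarrow> simplices Y p" for p
        using fX closed by blast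
      show "e m (f m (act (horn n k) m p \<theta> x)) = act Y m p \<theta> (e p (f p x))"
        if "\<theta> \<in> mono_maps m p" "x \<in> simplices (horn n k) p" for m p \<theta> x
        using f that act[OF that(1) fX[OF that(2)]] by (simp add: simplicial_map_def)
    qed
    from Y.horn_filler[OF n this] obtain g where g: "simplicial_map (std_simplex n) Y g"
      and gf: "\<And>p x. x \<in> simplices (horn n k) p \<Longrightarrow> g p x = e p (f p x)" by blast
    have gY: "g p x \<in> simplices Y p" if "x \<in> simplices (std_simplex n) p" for p x
      using g that by (auto simp: simplicial_map_def)
    have "simplicial_map (std_simplex n) X (\<lambda>p x. e' p (g p x))"
      unfolding simplicial_map_def
    proof (intro conjI allI ballI)
      show "(\<lambda>x. e' p (g p x)) \<in> simplices (std_simplex n) p \<rightarrow> simplices X p" for p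
        using gY e' by blast
      fix m p \<theta> x assume \<theta>: "\<theta> \<in> mono_maps m p" and x: "x \<in> simplices (std_simplex n) p"
      have "g m (act (std_simplex n) m p \<theta> x) = act Y m p \<theta> (g p x)"
        using g \<theta> x unfolding simplicial_map_def by blast
      also have "\<dots> = e m (act X m p \<theta> (e' p (g p x)))"
        using act[OF \<theta> e'(1)[OF gY[OF x]]] e'(2)[OF gY[OF x]] by simp
      finally show "e' m (g m (act (std_simplex n) m p \<theta> x)) = act X m p \<theta> (e' p (g p x))"
        using e'e[OF conjunct1[OF act[OF \<theta> e'(1)[OF gY[OF x]]]]] by simp
    qed
    moreover have "e' p (g p x) = f p x" if "x \<in> simplices (horn n k) p" for p x
      unfolding gf[OF that] by (rule e'e[OF fX[OF that]])
    ultimately show "\<exists>g. simplicial_map (std_simplex n) X g \<and>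
        (\<forall>p. \<forall>x\<in>simplices (horn n k) p. g p x = f p x)" by blast
  qed
qed

theorem theorem0p3:
  fixes A :: "'a dg_ring" and B :: "'b dg_ring"
  assumes "dg_ring A" and "semi_free TYPE('x) A" and "dg_ring B"
  shows "kan_complex (SHom A B)"
proof (rule kan_complex_transfer[OF word_SHom_kan_complex[OF assms],
      where e = "\<lambda>q. compose (carrier A) (cyl_eval q B)"])
  interpret A: dg_ring A by fact
  interpret B: dg_ring B by fact
  note A = A.pre.predg_ring_axioms
  show bij: "bij_betw (compose (carrier A) (cyl_eval q B)) (simplices (SHom A B) q) (simplices (word_SHom A B) q)" for q
    using B.dg_hom_Cyl_bij[OF A] by (simp add: SHom_def word_SHom_def)
  fix m n \<theta> f assume \<theta>: "\<theta> \<in> mono_maps m n" and "f \<in> simplices (SHom A B) n"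
  then have f: "f \<in> dg_hom A (Cyl n B)" by (simp add: SHom_def)
  let ?g = "compose (carrier A) (Cyl_act m \<theta> B) f"
  let ?f = "compose (carrier A) (cyl_eval n B) f"
  have eq: "compose (carrier A) (cyl_eval m B) ?g = compose (carrier A) (word_pull B m \<theta>) ?f"
    using B.cyl_eval_act(2)[OF \<theta> dg_hom_closed[OF f]] by (auto simp: compose_def)
  have "?f \<in> dg_hom A (word_cochains n B)"
    using bij_betwE[OF B.dg_hom_Cyl_bij[OF A]] f by blast
  then have "compose (carrier A) (word_pull B m \<theta>) ?f \<in> dg_hom A (word_cochains m B)"
    by (rule B.word_SHom_act_closed[OF A \<theta>])
  \<comment> \<open>That \<open>?g\<close> is a DG homomorphism is obtained indirectly: its
    evaluation is one, hence is the evaluation of some DG homomorphism \<open>g\<close>, and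
    injectivity of evaluation identifies \<open>g\<close> with \<open>?g\<close>.\<close>
  then have "compose (carrier A) (word_pull B m \<theta>) ?f \<in> compose (carrier A) (cyl_eval m B) ` dg_hom A (Cyl m B)"
    unfolding bij_betw_imp_surj_on[OF B.dg_hom_Cyl_bij[OF A]] .
  then obtain g where g: "g \<in> dg_hom A (Cyl m B)"
    and geq: "compose (carrier A) (cyl_eval m B) g = compose (carrier A) (word_pull B m \<theta>) ?f"
    by (metis (no_types) imageE)
  have "?g = g"
  proof
    fix a show "?g a = g a"
    proof (cases "a \<in> carrier A")
      case True
      have "cyl_eval m B (?g a) = cyl_eval m B (g a)"
        using fun_cong[OF eq, of a] fun_cong[OF geq, of a] True by (simp add: compose_def)
      moreover have "?g a \<in> carrier (Cyl m B)"
        using True B.cyl_eval_act(1)[OF \<theta> dg_hom_closed[OF f True]] by (simp add: compose_def)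
      ultimately show ?thesis
        using dg_hom_closed[OF g True] by (rule inj_onD[OF bij_betw_imp_inj_on[OF B.cyl_eval_bij]])
    next
      case False
      then show ?thesis using extensional_arb[OF dg_hom_extensional[OF g] False] by (simp add: compose_def)
    qed
  qed
  with g eq show "act (SHom A B) m n \<theta> f \<in> simplices (SHom A B) m \<and>
      compose (carrier A) (cyl_eval m B) (act (SHom A B) m n \<theta> f) =
      act (word_SHom A B) m n \<theta> (compose (carrier A) (cyl_eval n B) f)"
    by (simp add: SHom_def word_SHom_def)
qed

end
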